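(* Let $\mathcal{L}=\bigoplus_{i\in\mathbb{Z}}\mathcal{L}_i$ be a $\mathbb{Z}$-graded Lie conformal algebra of class $\mathcal{V}$, with structure polynomials $p_{i,j}$. Then $\deg p_{-1,1}(\partial)+\deg p_{0,1}(\lambda)\ne 1$. Furthermore: (1) If $\deg p_{-1,1}(\partial)+\deg p_{0,1}(\lambda)=0$, then $\mathcal{L}$ is isomorphic to one of $\mathrm{Cur}\,\mathfrak{sl}(2,\mathbb{C})$, $M(1)$, $M(2)$. (2) If $\deg p_{-1,1}(\partial)+\deg p_{0,1}(\lambda)=2$, then $\mathcal{L}$ is isomorphic to one of $ECL(s)$, $SCL_2(0,s)$, $CL_2(0,s)$, $CL_3(s)$ for some $s\in\mathbb{C}$.
   Context: All vector spaces are over $\mathbb{C}$. A Lie conformal algebra is a $\mathbb{C}[\partial]$-module $\mathcal{S}$ with a $\mathbb{C}$-bilinear $\lambda$-bracket $[\cdot_\lambda\cdot]:\mathcal{S}\otimes\mathcal{S}\to\mathcal{S}[\lambda]$ such that $[\partial a_\lambda b]=-\lambda[a_\lambda b]$, $[a_\lambda\partial b]=(\partial+\lambda)[a_\lambda b]$, $[a_\lambda b]=-[b_{-\lambda-\partial}a]$, $[a_\lambda[b_\mu c]]=[[a_\lambda b]_{\lambda+\mu}c]+[b_\mu[a_\lambda c]]$. It is $\mathbb{Z}$-graded if $\mathcal{L}=\bigoplus_{i\in\mathbb{Z}}\mathcal{L}_i$ with $\mathbb{C}[\partial]$-submodules $\mathcal{L}_i$ and $[{\mathcal{L}_i}_\lambda\mathcal{L}_j]\subset\mathcal{L}_{i+j}[\lambda]$.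 $\mathcal{L}$ is of class $\mathcal{V}$ if: (C1) $\operatorname{rank}\mathcal{L}_i\le1$ for each $i\in\mathbb{Z}$ and $\operatorname{rank}\mathcal{L}_1=\operatorname{rank}\mathcal{L}_{-1}=\operatorname{rank}\mathcal{L}_0=1$; (C2) $\mathcal{L}$ is generated as a Lie conformal algebra by $\mathcal{L}_1,\mathcal{L}_0,\mathcal{L}_{-1}$; (C3) $[{\mathcal{L}_{-1}}_\lambda\mathcal{L}_1]\ne0$, $[{\mathcal{L}_0}_\lambda\mathcal{L}_1]\ne0$, $[{\mathcal{L}_0}_\lambda\mathcal{L}_0]=0$. Convention: each nonzero $\mathcal{L}_i$ is free of rank one over $\mathbb{C}[\partial]$ with basis $L_i$, and $p_{i,j}(\partial,\lambda)\in\mathbb{C}[\partial,\lambda]$ is defined by $[{L_i}_\lambda L_j]=p_{i,j}(\partial,\lambda)L_{i+j}$. One has $p_{0,1}\in\mathbb{C}[\lambda]$ and $p_{-1,1}\in\mathbb{C}[\partial]$. Degree means total degree. Algebras (brackets not listed follow by skew-symmetry; a bracket neither listed nor obtained so is zero): - $\mathrm{Cur}\,\mathfrak{g}=\mathbb{C}[\partial]\otimes\mathfrak{g}$, $[x_\lambda y]=[x,y]$ for $x,y\in\mathfrak{g}$. - $M(1)=\bigoplus_{i\ge-1}\mathbb{C}[\partial]L_i$: $[{L_1}_\lambda L_1]=(\partial+2\lambda)L_2$; $[{L_{-1}}_\lambda L_j]=\frac{(j+1)(j-2)}{2}L_{j-1}$ for $j\ge1$; $[{L_0}_\lambda L_j]=-jL_j$;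 $[{L_1}_\lambda L_j]=L_{j+1}$ for $j\ge2$; $[{L_i}_\lambda L_j]=0$ for $i,j\ge2$. - $M(2)=\bigoplus_{i\in\mathbb{Z}}\mathbb{C}[\partial]L_i$: $[{L_{-1}}_\lambda L_{-1}]=(\partial+2\lambda)L_{-2}$; $[{L_{-1}}_\lambda L_j]=L_{j-1}$ for $j\le-2$; $[{L_{-1}}_\lambda L_j]=\frac{(j+1)(j-2)}{2}L_{j-1}$ for $j\ge1$; $[{L_0}_\lambda L_j]=-jL_j$; $[{L_1}_\lambda L_1]=(\partial+2\lambda)L_2$; $[{L_1}_\lambda L_j]=\frac{(j-1)(j+2)}{2}L_{j+1}$ for $j\le-2$; $[{L_1}_\lambda L_j]=L_{j+1}$ for $j\ge2$; $[{L_i}_\lambda L_j]=0$ for $|i|,|j|\ge2$. - $CL_2(0,s)=\bigoplus_{i\in\mathbb{Z}}\mathbb{C}[\partial]L_i$: $[{L_i}_\lambda L_j]=(i\partial+(i+j)\lambda+s(i-j))L_{i+j}$. - $SCL_2(0,s)=\bigoplus_{i\ne0}\mathbb{C}[\partial]L_i\oplus\mathbb{C}[\partial](\partial+2s)L_0\subset CL_2(0,s)$. - $CL_3(s)=\bigoplus_{i\in\mathbb{Z}}\mathbb{C}[\partial]L_i$: $[{L_i}_\lambda L_{-i}]=i(\partial+s)L_0$; $[{L_0}_\lambda L_j]=-j(-\lambda+2s)L_j$; $[{L_i}_\lambda L_0]=i(\partial+\lambda+2s)L_i$; otherwise $[{L_i}_\lambda L_j]=(i\partial+(i+j)\lambda+s(i-j))L_{i+j}$.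 - $ECL(s)=\bigoplus_{i\in\mathbb{Z}}\mathbb{C}[\partial]L_i$: $[{L_i}_\lambda L_{-i}]=i(\partial+s)(\partial+2s)L_0$; $[{L_0}_\lambda L_j]=-jL_j$; $[{L_i}_\lambda L_0]=iL_i$; otherwise $[{L_i}_\lambda L_j]=(i\partial+(i+j)\lambda+s(i-j))L_{i+j}$. *)

theory Defs
  imports
    "HOL-Analysis.Analysis"
    "HOL-Computational_Algebra.Polynomial"
    "HOL-Library.Poly_Mapping"
    "HOL-Library.Extended_Nat"
begin

section \<open>Polynomials in lambda with coefficients in a module\<close>

text \<open>
  A \<open>\<complex>[\<partial>]\<close>-module is an instance of locale \<^locale>\<open>module\<close> over the ring \<^typ>\<open>complex poly\<close>
  whose indeterminate is \<open>\<partial>\<close>. For a module on the type \<open>'v\<close>, the space \<open>V[\<lambda>]\<close> is \<open>'v poly\<close>, and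
  \<open>V[\<lambda>,\<mu>] = V[\<mu>][\<lambda>]\<close> is \<open>'v poly poly\<close> with \<open>\<lambda>\<close> the outer variable.
  On \<open>V[\<lambda>]\<close>, multiplication by the variable is \<^term>\<open>pCons 0\<close>.
\<close>

definition mult_del :: "(complex poly \<Rightarrow> 'v::ab_group_add \<Rightarrow> 'v) \<Rightarrow> 'v poly \<Rightarrow> 'v poly"
  where "mult_del sc f = map_poly (sc [:0, 1:]) f"

text \<open>
  \<open>subst_op T \<iota> f\<close> is \<open>\<Sum>\<^sub>n T\<^sup>n (\<iota> f\<^sub>n)\<close> for \<open>f = \<Sum>\<^sub>n f\<^sub>n X\<^sup>n\<close>: the variable is replaced by the
  operator \<open>T\<close> and the coefficients are mapped by \<open>\<iota>\<close>.
\<close>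

definition subst_op :: "('w::ab_group_add \<Rightarrow> 'w) \<Rightarrow> ('v::zero \<Rightarrow> 'w) \<Rightarrow> 'v poly \<Rightarrow> 'w"
  where "subst_op T \<iota> f = (\<Sum>n\<le>degree f. (T ^^ n) (\<iota> (coeff f n)))"

text \<open>
  In the Jacobi identity below, \<open>pCons 0\<close> is multiplication by \<open>\<lambda>\<close> and \<open>map_poly (pCons 0)\<close> is
  multiplication by \<open>\<mu>\<close>. The three terms are, in this order, \<open>[a\<^sub>\<lambda> [b\<^sub>\<mu> c]]\<close>,
  \<open>[[a\<^sub>\<lambda> b]\<^bsub>\<lambda>+\<mu>\<^esub> c]\<close> and \<open>[b\<^sub>\<mu> [a\<^sub>\<lambda> c]]\<close>.
\<close>

locale lie_conformal_algebra = module sc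
  for sc :: "complex poly \<Rightarrow> 'v::ab_group_add \<Rightarrow> 'v" +
  fixes br :: "'v \<Rightarrow> 'v \<Rightarrow> 'v poly"
  assumes br_add_left: "br (a + a') b = br a b + br a' b"
    and br_add_right: "br a (b + b') = br a b + br a b'"
    and br_scale_left: "br (sc [:z:] a) b = map_poly (sc [:z:]) (br a b)"
    and br_scale_right: "br a (sc [:z:] b) = map_poly (sc [:z:]) (br a b)"
    and br_del_left: "br (sc [:0, 1:] a) b = - pCons 0 (br a b)"
    and br_del_right: "br a (sc [:0, 1:] b) = mult_del sc (br a b) + pCons 0 (br a b)"
    and br_skew:
      "br a b = - subst_op (\<lambda>g. - pCons 0 g - mult_del sc g) (\<lambda>v. [:v:]) (br b a)"
    and br_jacobi:
      "subst_op (map_poly (pCons 0)) (\<lambda>v. map_poly (\<lambda>w. [:w:]) (br a v)) (br b c) =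
       subst_op (pCons 0)
         (\<lambda>v. subst_op (\<lambda>g. pCons 0 g + map_poly (pCons 0) g) (\<lambda>w. [:[:w:]:]) (br v c)) (br a b)
       + subst_op (pCons 0) (\<lambda>v. [:br b v:]) (br a c)"


section \<open>Gradings and class V\<close>

definition module_rank :: "(complex poly \<Rightarrow> 'v::ab_group_add \<Rightarrow> 'v) \<Rightarrow> 'v set \<Rightarrow> enat"
  where "module_rank sc M =
    (SUP B \<in> {B. B \<subseteq> M \<and> finite B \<and> \<not> module.dependent sc B}. enat (card B))"

definition Z_graded ::
  "(complex poly \<Rightarrow> 'v::ab_group_add \<Rightarrow> 'v) \<Rightarrow> ('v \<Rightarrow> 'v \<Rightarrow> 'v poly) \<Rightarrow> (int \<Rightarrow> 'v set) \<Rightarrow> bool"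
  where "Z_graded sc br L \<longleftrightarrow>
    (\<forall>i. module.subspace sc (L i)) \<and>
    (\<forall>x. \<exists>!f :: int \<Rightarrow>\<^sub>0 'v. (\<forall>i. Poly_Mapping.lookup f i \<in> L i) \<and>
        x = (\<Sum>i\<in>Poly_Mapping.keys f. Poly_Mapping.lookup f i)) \<and>
    (\<forall>i j. \<forall>a\<in>L i. \<forall>b\<in>L j. \<forall>n. coeff (br a b) n \<in> L (i + j))"

definition lca_subalgebra ::
  "(complex poly \<Rightarrow> 'v::ab_group_add \<Rightarrow> 'v) \<Rightarrow> ('v \<Rightarrow> 'v \<Rightarrow> 'v poly) \<Rightarrow> 'v set \<Rightarrow> bool"
  where "lca_subalgebra sc br W \<longleftrightarrow>
    module.subspace sc W \<and> (\<forall>a\<in>W. \<forall>b\<in>W. \<forall>n. coeff (br a b) n \<in> W)"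

definition class_V ::
  "(complex poly \<Rightarrow> 'v::ab_group_add \<Rightarrow> 'v) \<Rightarrow> ('v \<Rightarrow> 'v \<Rightarrow> 'v poly) \<Rightarrow> (int \<Rightarrow> 'v set) \<Rightarrow> bool"
  where "class_V sc br L \<longleftrightarrow>
    (\<forall>i. module_rank sc (L i) \<le> 1) \<and>
    module_rank sc (L 1) = 1 \<and> module_rank sc (L (-1)) = 1 \<and> module_rank sc (L 0) = 1 \<and>
    lca_subalgebra sc br hull (L 1 \<union> L 0 \<union> L (-1)) = UNIV \<and>
    (\<exists>a\<in>L (-1). \<exists>b\<in>L 1. br a b \<noteq> 0) \<and>
    (\<exists>a\<in>L 0. \<exists>b\<in>L 1. br a b \<noteq> 0) \<and>
    (\<forall>a\<in>L 0. \<forall>b\<in>L 0. br a b = 0)"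

text \<open>
  Every nonzero \<open>L i\<close> is free of rank one with basis \<open>e i\<close>; where \<open>L i = 0\<close>, the value is \<open>e i = 0\<close>.
\<close>

definition graded_basis ::
  "(complex poly \<Rightarrow> 'v::ab_group_add \<Rightarrow> 'v) \<Rightarrow> (int \<Rightarrow> 'v set) \<Rightarrow> (int \<Rightarrow> 'v) \<Rightarrow> bool"
  where "graded_basis sc L e \<longleftrightarrow>
    (\<forall>i. if L i = {0} then e i = 0
         else \<not> module.dependent sc {e i} \<and> module.span sc {e i} = L i)"

text \<open>
  \<open>\<complex>[\<partial>,\<lambda>] = \<complex>[\<partial>][\<lambda>]\<close> is \<^typ>\<open>complex poly poly\<close>, with \<open>\<lambda>\<close> the outer variable.
\<close>

definition poly_act ::
  "(complex poly \<Rightarrow> 'v::ab_group_add \<Rightarrow> 'v) \<Rightarrow> complex poly poly \<Rightarrow> 'v \<Rightarrow> 'v poly"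
  where "poly_act sc p v = map_poly (\<lambda>q. sc q v) p"

definition structure_polys ::
  "(complex poly \<Rightarrow> 'v::ab_group_add \<Rightarrow> 'v) \<Rightarrow> ('v \<Rightarrow> 'v \<Rightarrow> 'v poly) \<Rightarrow> (int \<Rightarrow> 'v) \<Rightarrow>
    (int \<Rightarrow> int \<Rightarrow> complex poly poly) \<Rightarrow> bool"
  where "structure_polys sc br e p \<longleftrightarrow>
    (\<forall>i j. br (e i) (e j) = poly_act sc (p i j) (e (i + j)))"

definition total_degree :: "complex poly poly \<Rightarrow> nat"
  where "total_degree p = Max (insert 0 {m + n | m n. coeff (coeff p n) m \<noteq> 0})"


section \<open>Isomorphism\<close>

text \<open>
  The target is a conformal algebra whose underlying module is a submodule \<open>V'\<close> of a module given on a
  whole type.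
\<close>

definition lca_isomorphic ::
  "(complex poly \<Rightarrow> 'v::ab_group_add \<Rightarrow> 'v) \<Rightarrow> ('v \<Rightarrow> 'v \<Rightarrow> 'v poly) \<Rightarrow>
   'w set \<Rightarrow> (complex poly \<Rightarrow> 'w::ab_group_add \<Rightarrow> 'w) \<Rightarrow> ('w \<Rightarrow> 'w \<Rightarrow> 'w poly) \<Rightarrow> bool"
  where "lca_isomorphic sc br V' sc' br' \<longleftrightarrow>
    (\<exists>\<phi>. module_hom sc sc' \<phi> \<and> bij_betw \<phi> UNIV V' \<and>
         (\<forall>a b. map_poly \<phi> (br a b) = br' (\<phi> a) (\<phi> b)))"


section \<open>Current algebras\<close>

text \<open>
  \<open>\<complex>[\<partial>] \<otimes> g\<close> is the set of polynomials in \<open>\<partial>\<close> with coefficients in \<open>g\<close>. The bracket is the extension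
  \<open>[\<partial>\<^sup>m x \<^sub>\<lambda> \<partial>\<^sup>n y] = (-\<lambda>)\<^sup>m (\<partial>+\<lambda>)\<^sup>n [x,y]\<close> of the Lie bracket; in its value, a polynomial of
  polynomials, \<open>\<lambda>\<close> is the outer and \<open>\<partial>\<close> the inner variable.
\<close>

definition cur_carrier :: "'g::ab_group_add set \<Rightarrow> 'g poly set"
  where "cur_carrier G = {x. \<forall>n. coeff x n \<in> G}"

definition cur_scale ::
  "(complex \<Rightarrow> 'g::ab_group_add \<Rightarrow> 'g) \<Rightarrow> complex poly \<Rightarrow> 'g poly \<Rightarrow> 'g poly"
  where "cur_scale \<sigma> q x = subst_op (pCons 0) (\<lambda>c. map_poly (\<sigma> c) x) q"

definition cur_bracket ::
  "('g::ab_group_add \<Rightarrow> 'g \<Rightarrow> 'g) \<Rightarrow> 'g poly \<Rightarrow> 'g poly \<Rightarrow> 'g poly poly"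
  where "cur_bracket lb x y =
    subst_op (\<lambda>g. - pCons 0 g)
      (\<lambda>u. subst_op (\<lambda>g. map_poly (pCons 0) g + pCons 0 g) (\<lambda>v. [:[:lb u v:]:]) y) x"

definition sl2 :: "(complex^2^2) set"
  where "sl2 = {A. trace A = 0}"

definition mat_scale :: "complex \<Rightarrow> complex^2^2 \<Rightarrow> complex^2^2"
  where "mat_scale c A = map_matrix ((*) c) A"

definition mat_comm :: "complex^2^2 \<Rightarrow> complex^2^2 \<Rightarrow> complex^2^2"
  where "mat_comm A B = A ** B - B ** A"


section \<open>Algebras given by structure polynomials\<close>

abbreviation Del :: "complex poly poly" where "Del \<equiv> [:[:0, 1:]:]"
abbreviation Lam :: "complex poly poly" where "Lam \<equiv> [:0, 1:]"
abbreviation Cst :: "complex \<Rightarrow> complex poly poly" where "Cst c \<equiv> [:[:c:]:]"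

text \<open>
  The free module with basis \<open>L\<^sub>i\<close>, \<open>i \<in> \<int>\<close>, is \<^typ>\<open>int \<Rightarrow>\<^sub>0 complex poly\<close>. Its bracket is the extension
  \<open>[f(\<partial>)L\<^sub>i \<^sub>\<lambda> g(\<partial>)L\<^sub>j] = f(-\<lambda>) g(\<partial>+\<lambda>) P\<^sub>i\<^sub>j(\<partial>,\<lambda>) L\<^bsub>i+j\<^esub>\<close> of a table \<open>P\<close> of
  brackets of basis elements.
\<close>

definition free_scale :: "complex poly \<Rightarrow> (int \<Rightarrow>\<^sub>0 complex poly) \<Rightarrow> (int \<Rightarrow>\<^sub>0 complex poly)"
  where "free_scale q f = Poly_Mapping.map ((*) q) f"

definition eval_at :: "complex poly poly \<Rightarrow> complex poly \<Rightarrow> complex poly poly"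
  where "eval_at t q = poly (map_poly Cst q) t"

definition free_bracket ::
  "(int \<Rightarrow> int \<Rightarrow> complex poly poly) \<Rightarrow>
    (int \<Rightarrow>\<^sub>0 complex poly) \<Rightarrow> (int \<Rightarrow>\<^sub>0 complex poly) \<Rightarrow> (int \<Rightarrow>\<^sub>0 complex poly) poly"
  where "free_bracket P f g =
    (\<Sum>i\<in>Poly_Mapping.keys f. \<Sum>j\<in>Poly_Mapping.keys g.
      map_poly (Poly_Mapping.single (i + j))
        (eval_at (- Lam) (Poly_Mapping.lookup f i) *
         eval_at (Del + Lam) (Poly_Mapping.lookup g j) * P i j))"

text \<open>
  Completion of a partial table of brackets: a missing entry \<open>(i,j)\<close> is \<open>-Q\<^sub>j\<^sub>i(\<partial>,-\<lambda>-\<partial>)\<close> if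
  \<open>(j,i)\<close> is listed, and zero otherwise.
\<close>

definition skew_completion ::
  "(int \<Rightarrow> int \<Rightarrow> complex poly poly option) \<Rightarrow> int \<Rightarrow> int \<Rightarrow> complex poly poly"
  where "skew_completion Q i j =
    (case Q i j of Some p \<Rightarrow> p
     | None \<Rightarrow> (case Q j i of Some p \<Rightarrow> - (p \<circ>\<^sub>p (- Lam - Del)) | None \<Rightarrow> 0))"

definition M1_carrier :: "(int \<Rightarrow>\<^sub>0 complex poly) set"
  where "M1_carrier = {f. Poly_Mapping.keys f \<subseteq> {-1..}}"

definition M1_table :: "int \<Rightarrow> int \<Rightarrow> complex poly poly option"
  where "M1_table i j =
    (if i < -1 \<or> j < -1 then None
     else if i = 1 \<and> j = 1 then Some (Del + 2 * Lam)
     else if i = -1 \<and> j \<ge> 1 then Some (Cst (of_int ((j + 1) * (j - 2)) / 2))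
     else if i = 0 then Some (Cst (- of_int j))
     else if i = 1 \<and> j \<ge> 2 then Some 1
     else if i \<ge> 2 \<and> j \<ge> 2 then Some 0
     else None)"

definition M2_table :: "int \<Rightarrow> int \<Rightarrow> complex poly poly option"
  where "M2_table i j =
    (if i = -1 \<and> j = -1 then Some (Del + 2 * Lam)
     else if i = -1 \<and> j \<le> -2 then Some 1
     else if i = -1 \<and> j \<ge> 1 then Some (Cst (of_int ((j + 1) * (j - 2)) / 2))
     else if i = 0 then Some (Cst (- of_int j))
     else if i = 1 \<and> j = 1 then Some (Del + 2 * Lam)
     else if i = 1 \<and> j \<le> -2 then Some (Cst (of_int ((j - 1) * (j + 2)) / 2))
     else if i = 1 \<and> j \<ge> 2 then Some 1
     else if \<bar>i\<bar> \<ge> 2 \<and> \<bar>j\<bar> \<ge> 2 then Some 0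
     else None)"

definition CL2_table :: "complex \<Rightarrow> int \<Rightarrow> int \<Rightarrow> complex poly poly"
  where "CL2_table s i j =
    of_int i * Del + of_int (i + j) * Lam + Cst (s * of_int (i - j))"

definition SCL2_carrier :: "complex \<Rightarrow> (int \<Rightarrow>\<^sub>0 complex poly) set"
  where "SCL2_carrier s = {f. [:2 * s, 1:] dvd Poly_Mapping.lookup f 0}"

definition CL3_table :: "complex \<Rightarrow> int \<Rightarrow> int \<Rightarrow> complex poly poly"
  where "CL3_table s i j =
    (if i + j = 0 then of_int i * (Del + Cst s)
     else if i = 0 then - of_int j * (- Lam + Cst (2 * s))
     else if j = 0 then of_int i * (Del + Lam + Cst (2 * s))
     else CL2_table s i j)"

definition ECL_table :: "complex \<Rightarrow> int \<Rightarrow> int \<Rightarrow> complex poly poly"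
  where "ECL_table s i j =
    (if i + j = 0 then of_int i * (Del + Cst s) * (Del + Cst (2 * s))
     else if i = 0 then - of_int j
     else if j = 0 then of_int i
     else CL2_table s i j)"


section \<open>Isomorphism to the algebras of the classification\<close>

definition iso_Cur_sl2 ::
  "(complex poly \<Rightarrow> 'v::ab_group_add \<Rightarrow> 'v) \<Rightarrow> ('v \<Rightarrow> 'v \<Rightarrow> 'v poly) \<Rightarrow> bool"
  where "iso_Cur_sl2 sc br \<longleftrightarrow>
    lca_isomorphic sc br (cur_carrier sl2) (cur_scale mat_scale) (cur_bracket mat_comm)"

definition iso_M1 ::
  "(complex poly \<Rightarrow> 'v::ab_group_add \<Rightarrow> 'v) \<Rightarrow> ('v \<Rightarrow> 'v \<Rightarrow> 'v poly) \<Rightarrow> bool"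
  where "iso_M1 sc br \<longleftrightarrow>
    lca_isomorphic sc br M1_carrier free_scale (free_bracket (skew_completion M1_table))"

definition iso_M2 ::
  "(complex poly \<Rightarrow> 'v::ab_group_add \<Rightarrow> 'v) \<Rightarrow> ('v \<Rightarrow> 'v \<Rightarrow> 'v poly) \<Rightarrow> bool"
  where "iso_M2 sc br \<longleftrightarrow>
    lca_isomorphic sc br UNIV free_scale (free_bracket (skew_completion M2_table))"

definition iso_CL2 ::
  "complex \<Rightarrow> (complex poly \<Rightarrow> 'v::ab_group_add \<Rightarrow> 'v) \<Rightarrow> ('v \<Rightarrow> 'v \<Rightarrow> 'v poly) \<Rightarrow> bool"
  where "iso_CL2 s sc br \<longleftrightarrow>
    lca_isomorphic sc br UNIV free_scale (free_bracket (CL2_table s))"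

definition iso_SCL2 ::
  "complex \<Rightarrow> (complex poly \<Rightarrow> 'v::ab_group_add \<Rightarrow> 'v) \<Rightarrow> ('v \<Rightarrow> 'v \<Rightarrow> 'v poly) \<Rightarrow> bool"
  where "iso_SCL2 s sc br \<longleftrightarrow>
    lca_isomorphic sc br (SCL2_carrier s) free_scale (free_bracket (CL2_table s))"

definition iso_CL3 ::
  "complex \<Rightarrow> (complex poly \<Rightarrow> 'v::ab_group_add \<Rightarrow> 'v) \<Rightarrow> ('v \<Rightarrow> 'v \<Rightarrow> 'v poly) \<Rightarrow> bool"
  where "iso_CL3 s sc br \<longleftrightarrow>
    lca_isomorphic sc br UNIV free_scale (free_bracket (CL3_table s))"

definition iso_ECL ::
  "complex \<Rightarrow> (complex poly \<Rightarrow> 'v::ab_group_add \<Rightarrow> 'v) \<Rightarrow> ('v \<Rightarrow> 'v \<Rightarrow> 'v poly) \<Rightarrow> bool"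
  where "iso_ECL s sc br \<longleftrightarrow>
    lca_isomorphic sc br UNIV free_scale (free_bracket (ECL_table s))"

end

theory Submission
  imports Defs "HOL-Computational_Algebra.Fundamental_Theorem_Algebra"
begin

text \<open>
  Everything is reduced to identities between the structure polynomials, read as functions
  \<open>P\<^sub>i\<^sub>j(x,l)\<close> of two complex numbers, \<open>x\<close> for \<open>\<partial>\<close> and \<open>l\<close> for \<open>\<lambda>\<close>. Identities of polynomials can
  then be used by inserting numbers, and a bracket \<open>[a \<^sub>\<lambda> b]\<close> at a numerical \<open>\<lambda>\<close> is just a vector.

  Since \<open>[L\<^sub>0 \<^sub>\<lambda> L\<^sub>0] = 0\<close>, the Jacobi identity says that the operators of \<open>L\<^sub>0\<close> on each \<open>L\<^sub>k\<close>
  commute, which forces \<open>P\<^sub>0\<^sub>k\<close> to depend on \<open>\<lambda>\<close> alone (\<open>commuting_action_const\<close>). Comparing leading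
  coefficients in the identity for \<open>0,j,k\<close> shows that \<open>P\<^sub>0\<^sub>k = k f(\<lambda>)\<close> with one polynomial \<open>f\<close>. After
  division by \<open>f\<close> the same identity becomes a linear functional equation for \<open>P\<^sub>j\<^sub>k\<close>, whose solutions
  are \<open>a (j\<partial> + (j+k)\<lambda>) + b\<close> if \<open>j\<close>, \<open>k\<close>, \<open>j+k\<close> are nonzero, and polynomials in \<open>\<partial>\<close> if \<open>j + k = 0\<close>
  (\<open>shift_relation_affine\<close>). So the algebra is described by \<open>f\<close>, by \<open>g = P\<^sub>-\<^sub>1\<^sub>,\<^sub>1\<close>, and by numbers.

  The factors \<open>f\<close> and \<open>g\<close> enter the identities between these numbers only through \<open>F(x) = g(x) f(-x)\<close>. The identity
  for \<open>1,-1,1\<close> gives \<open>F(x) = \<alpha> x\<^sup>2 + \<beta> x + \<gamma>\<close>, so the sum of the two degrees in the theorem is the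
  degree of \<open>F\<close>. The identities for \<open>1,-1,k\<close> form a recursion that expresses the products of the
  coefficients of \<open>P\<^sub>1\<^sub>k\<close> and \<open>P\<^sub>-\<^sub>1\<^sub>,\<^sub>k\<^sub>+\<^sub>1\<close> by \<open>\<alpha>\<close>, \<open>\<beta>\<close>, \<open>\<gamma>\<close> (\<open>relations\<close>). Two conclusions carry the
  theorem. Either \<open>L\<^sub>2 = 0\<close>, and \<open>F\<close> is constant, or all \<open>L\<^sub>k\<close> with \<open>k \<ge> 1\<close> are nonzero, because a
  vanishing \<open>P\<^sub>1\<^sub>k\<close> with \<open>k \<ge> 2\<close> would make \<open>F\<close> vanish. In the second case a two by two matrix of products has
  rank one, so \<open>9 \<alpha> \<gamma> = 2 \<beta>\<^sup>2\<close> and \<open>\<alpha> = 0\<close> implies \<open>\<beta> = 0\<close>: the degree of \<open>F\<close> is not one, and if it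
  is two, then \<open>F(x) = \<alpha> (x + s) (x + 2s)\<close>.

  Rescaling the \<open>L\<^sub>k\<close> brings \<open>P\<^sub>\<plusminus>\<^sub>1\<^sub>,\<^sub>k\<close> to a normal form, first for positive \<open>k\<close>, then for negative \<open>k\<close> by
  the symmetry \<open>L\<^sub>i \<mapsto> - L\<^sub>-\<^sub>i\<close>, which preserves \<open>f\<close> and \<open>g\<close> (\<open>flip\<close>). The Jacobi identities for
  \<open>1,i,k\<close> determine \<open>P\<^sub>i\<^sub>+\<^sub>1\<^sub>,\<^sub>k\<close> from \<open>P\<^sub>1\<close> and \<open>P\<^sub>i\<close>, so these rows determine all structure
  polynomials (\<open>CL_determined\<close>, \<open>far_zero\<close>). If \<open>F\<close> is constant, the four possibilities for the
  vanishing of \<open>L\<^sub>2\<close> and \<open>L\<^sub>-\<^sub>2\<close> give the current algebra, \<open>M(1)\<close> twice, and \<open>M(2)\<close>. If \<open>F\<close> has degree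
  two, the four algebras correspond to the ways of splitting \<open>(x + s) (x + 2s)\<close> into \<open>g(x)\<close> and
  \<open>f(-x)\<close>.
\<close>

section \<open>Values of polynomials in two variables\<close>

definition peval :: "complex poly poly \<Rightarrow> complex \<Rightarrow> complex \<Rightarrow> complex"
  where "peval p x l = poly (poly p [:l:]) x"

lemma peval_simps [simp]:
  "peval 0 x l = 0" "peval 1 x l = 1"
  "peval (p + q) x l = peval p x l + peval q x l"
  "peval (p - q) x l = peval p x l - peval q x l"
  "peval (- p) x l = - peval p x l"
  "peval (p * q) x l = peval p x l * peval q x l"
  "peval (pCons c p) x l = poly c x + l * peval p x l"
  "peval (of_int n) x l = of_int n"
  "peval (numeral k) x l = numeral k"
  by (simp_all add: peval_def of_int_poly numeral_poly)

lemma poly_map_const: "poly (map_poly (\<lambda>c. [:c:]) f) [:l:] = [:poly f l:]"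
  by (induction f) (simp_all add: map_poly_pCons mult.commute)

lemma peval_map_const [simp]: "peval (map_poly (\<lambda>c. [:c:]) f) x l = poly f l"
  by (simp add: peval_def poly_map_const)

lemma poly_poly_eval: "poly (poly p q) x = poly (map_poly (\<lambda>c. poly c x) p) (poly q x)"
  by (induction p) (simp_all add: map_poly_pCons)

lemma peval_alt: "peval p x l = poly (map_poly (\<lambda>c. poly c x) p) l"
  by (simp add: peval_def poly_poly_eval)

lemma poly_poly_peval: "poly (poly p q) x = peval p x (poly q x)"
  by (simp add: peval_alt poly_poly_eval)

lemma peval_pcompose [simp]: "peval (p \<circ>\<^sub>p q) x l = peval p x (peval q x l)"
  by (simp add: peval_def poly_pcompose poly_poly_eval)

lemma poly_eq_0_of_infinite:
  fixes f :: "complex poly"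
  assumes "infinite A" "\<And>x. x \<in> A \<Longrightarrow> poly f x = 0"
  shows "f = 0"
  using assms poly_roots_finite[of f] finite_subset[of A "{x. poly f x = 0}"] by blast

lemma finite_lambda_zero:
  assumes "p \<noteq> 0" shows "finite {l. \<forall>x. peval p x l = 0}"
proof -
  have "{l. \<forall>x. peval p x l = 0} \<subseteq> (\<lambda>q. coeff q 0) ` {q. poly p q = 0}"
  proof
    fix l assume "l \<in> {l. \<forall>x. peval p x l = 0}"
    then have "poly p [:l:] = 0" by (simp add: peval_def poly_all_0_iff_0)
    then show "l \<in> (\<lambda>q. coeff q 0) ` {q. poly p q = 0}" by force
  qed
  then show ?thesis using poly_roots_finite[OF assms] finite_surj by blast
qed

lemma finite_del_zero:
  assumes "p \<noteq> 0" shows "finite {x. \<forall>l. peval p x l = 0}"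
proof -
  have "{x. \<forall>l. peval p x l = 0} \<subseteq> {x. poly (lead_coeff p) x = 0}"
  proof
    fix x assume "x \<in> {x. \<forall>l. peval p x l = 0}"
    then have "map_poly (\<lambda>c. poly c x) p = 0" by (simp add: peval_alt poly_all_0_iff_0)
    then have "coeff (map_poly (\<lambda>c. poly c x) p) (degree p) = 0" by simp
    then show "x \<in> {x. poly (lead_coeff p) x = 0}" by (simp add: coeff_map_poly)
  qed
  moreover have "finite {x. poly (lead_coeff p) x = 0}"
    using assms by (intro poly_roots_finite) simp
  ultimately show ?thesis by (rule finite_subset)
qed

lemma peval_eq_0_iff: "p = 0 \<longleftrightarrow> (\<forall>x l. peval p x l = 0)"
proof
  assume z: "\<forall>x l. peval p x l = 0"
  then have "{l. \<forall>x. peval p x l = 0} = UNIV" by simp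
  then show "p = 0" using finite_lambda_zero[of p] infinite_UNIV_char_0[where 'a=complex] by metis
qed simp

lemma peval_eqI: "(\<And>x l. peval p x l = peval q x l) \<Longrightarrow> p = q"
  using peval_eq_0_iff[of "p - q"] by simp

text \<open>
  Products of this shape are what the Jacobi identity leaves when two of its three terms vanish:
  the first argument of the outer factor of \<open>[[a \<^sub>\<lambda> b] \<^sub>\<lambda>\<^sub>+\<^sub>\<mu> c]\<close> is \<open>-\<lambda>-\<mu>\<close>. The substitution
  \<open>(\<lambda>,\<mu>) \<mapsto> (-\<lambda>-\<mu>,\<lambda>)\<close> is invertible, so neither factor becomes zero unless it was.
\<close>

lemma peval_cancel:
  assumes "\<And>x y l. peval p y l * peval q x (- y) = 0" and "p \<noteq> 0"
  shows "q = 0"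
proof -
  have "peval q x l = 0" for x l
  proof -
    let ?A = "- {y. \<forall>l. peval p y l = 0}"
    have inf: "infinite ?A"
      using finite_del_zero[OF assms(2)] by (simp add: finite_compl infinite_UNIV_char_0 Compl_eq_Diff_UNIV Diff_infinite_finite)
    have "poly (map_poly (\<lambda>c. poly c x) q \<circ>\<^sub>p [:0,-1:]) y = 0" if y: "y \<in> ?A" for y
    proof -
      obtain l where "peval p y l \<noteq> 0" using y by blast
      then have "peval q x (- y) = 0" using assms(1)[of y l x] by simp
      then show ?thesis by (simp add: poly_pcompose peval_alt)
    qed
    then have "map_poly (\<lambda>c. poly c x) q \<circ>\<^sub>p [:0,-1:] = 0"
      using poly_eq_0_of_infinite[OF inf] by blast
    then have "poly (map_poly (\<lambda>c. poly c x) q \<circ>\<^sub>p [:0,-1:]) (-l) = 0" by simp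
    then show ?thesis by (simp add: poly_pcompose peval_alt)
  qed
  then show ?thesis by (simp add: peval_eq_0_iff)
qed

text \<open>
  The hypothesis says that the operators \<open>q(\<partial>,\<lambda>)\<close> of a rank one module over an abelian rank one
  algebra commute. Suppose that \<open>q(x,l)\<close>, for some fixed \<open>l\<close>, is not constant in \<open>x\<close>. It then has a
  root \<open>r\<close>, and the hypothesis at \<open>x = r\<close> makes \<open>q(r,m)\<close> vanish for all \<open>m\<close>. Moving this root to
  \<open>r - k\<close> produces, for every \<open>k\<close>, another slice of \<open>q\<close> that vanishes identically, and a nonzero
  polynomial has only finitely many of those.
\<close>

lemma commuting_action_const:
  assumes comm: "\<And>x l m. peval q (x + l) m * peval q x l = peval q (x + m) l * peval q x m"
  shows "peval q x l = peval q 0 l"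
proof (cases "q = 0")
  case False
  have noroot: "peval q r l \<noteq> 0" if nz: "poly q [:l:] \<noteq> 0" for r l
  proof
    assume r0: "peval q r l = 0"
    (* The first factor below is q(r + m, l) as a polynomial in m. It is nonzero, so the second one vanishes. *)
    have zr: "peval q r m = 0" for m
    proof -
      have "poly (poly q [:l:] \<circ>\<^sub>p [:r,1:] * map_poly (\<lambda>c. poly c r) q) m = 0" for m
        using comm[of r l m] r0 by (simp add: poly_pcompose peval_alt[symmetric]) (simp add: peval_def)
      then have "poly q [:l:] \<circ>\<^sub>p [:r,1:] * map_poly (\<lambda>c. poly c r) q = 0"
        by (simp only: poly_all_0_iff_0[symmetric]) simp
      moreover have "poly q [:l:] \<circ>\<^sub>p [:r,1:] \<noteq> 0" using nz by (simp add: pcompose_eq_0_iff)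
      ultimately show ?thesis by (simp add: peval_alt)
    qed
    (* Insert x = r - k and l = k: one factor is q(r, _), hence 0, and the other two give the two alternatives. *)
    have "UNIV \<subseteq> {l. \<forall>x. peval q x l = 0} \<union> (\<lambda>y. r - y) ` {x. \<forall>l. peval q x l = 0}"
    proof
      fix k
      have "poly (poly q [:k:] \<circ>\<^sub>p [:r - k,1:] * map_poly (\<lambda>c. poly c (r - k)) q) m = 0" for m
        using comm[of "r - k" k m] zr[of m]
        by (simp add: poly_pcompose peval_alt[symmetric] add.commute) (simp add: peval_def add.commute)
      then have "poly q [:k:] \<circ>\<^sub>p [:r - k,1:] * map_poly (\<lambda>c. poly c (r - k)) q = 0"
        by (simp only: poly_all_0_iff_0[symmetric]) simp
      then have "poly q [:k:] = 0 \<or> map_poly (\<lambda>c. poly c (r - k)) q = 0"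
        by (auto simp: pcompose_eq_0_iff)
      then show "k \<in> {l. \<forall>x. peval q x l = 0} \<union> (\<lambda>y. r - y) ` {x. \<forall>l. peval q x l = 0}"
      proof
        assume "poly q [:k:] = 0"
        then show ?thesis by (simp add: peval_def)
      next
        assume "map_poly (\<lambda>c. poly c (r - k)) q = 0"
        then have "\<forall>l. peval q (r - k) l = 0" by (simp add: peval_alt)
        moreover have "k = r - (r - k)" by simp
        ultimately show ?thesis by blast
      qed
    qed
    moreover have "finite ({l. \<forall>x. peval q x l = 0} \<union> (\<lambda>y. r - y) ` {x. \<forall>l. peval q x l = 0})"
      using finite_lambda_zero[OF False] finite_del_zero[OF False] by blast
    ultimately show False using infinite_UNIV_char_0[where 'a=complex] finite_subset by blast
  qed
  show ?thesis
  proof (cases "poly q [:l:] = 0")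
    case False
    then have "constant (poly (poly q [:l:]))"
      using noroot[of l] Fundamental_Theorem_Algebra.fundamental_theorem_of_algebra[of "poly q [:l:]"] by (auto simp: peval_def)
    then show ?thesis by (simp add: constant_def peval_def)
  qed (simp add: peval_def)
qed simp

text \<open>
  Shifting an argument does not change a leading coefficient, so the equality of coefficients can
  be read off from the leading coefficient in the second variable and, inside it, in the first.
\<close>

lemma shift_relation_coeffs:
  assumes rel: "\<And>x m. u * peval q (x + l) m = v * peval q x (l + m) + w * peval q x m"
    and "q \<noteq> 0"
  shows "u = v + w"
proof -
  define N where "N = degree q"
  define c where "c = lead_coeff q"
  have c0: "c \<noteq> 0" using assms(2) by (simp add: c_def)
  have eq: "u * poly c (x + l) = (v + w) * poly c x" for x
  proof -
    let ?Q = "\<lambda>y. map_poly (\<lambda>c. poly c y) q"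
    have poleq: "smult u (?Q (x + l)) = smult v (?Q x \<circ>\<^sub>p [:l,1:]) + smult w (?Q x)"
      using rel[of x] by (intro poly_eq_poly_eq_iff[THEN iffD1] ext)
        (simp add: poly_pcompose peval_alt add.commute)
    have deg: "degree (?Q y) \<le> N" for y unfolding N_def by (rule map_poly_degree_leq)
    have cf: "coeff (?Q y) N = poly c y" for y
      by (simp add: coeff_map_poly c_def N_def)
    have "coeff (?Q x \<circ>\<^sub>p [:l,1:]) N = coeff (?Q x) N"
    proof (cases "degree (?Q x) = N")
      case True
      then show ?thesis
        using lead_coeff_comp[of "[:l,1:]" "?Q x"] by (simp add: degree_pcompose)
    next
      case False
      then have "degree (?Q x) < N" using deg[of x] by simp
      then show ?thesis by (simp add: coeff_eq_0 degree_pcompose)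
    qed
    then show ?thesis using arg_cong[OF poleq, of "\<lambda>r. coeff r N"] cf by (simp add: algebra_simps)
  qed
  have "smult u (c \<circ>\<^sub>p [:l,1:]) = smult (v + w) c"
    using eq by (intro poly_eq_poly_eq_iff[THEN iffD1] ext) (simp add: poly_pcompose add.commute)
  note arg_cong[OF this, of "\<lambda>r. coeff r (degree c)"]
  then  have "u * lead_coeff c = (v + w) * lead_coeff c"
    using lead_coeff_comp[of "[:l,1:]" c] by (simp add: degree_pcompose)
  then show ?thesis using c0 by simp
qed

text \<open>
  At \<open>x = y\<close> the hypothesis gives \<open>q(2x) + q(0) = 2 q(x)\<close>, hence \<open>2\<^sup>n q\<^sub>n = 2 q\<^sub>n\<close> for \<open>n \<ge> 1\<close>.
\<close>

lemma additive_poly_linear: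
  fixes q :: "complex poly"
  assumes "\<And>x y. poly q (x + y) + poly q 0 = poly q x + poly q y"
  obtains a b where "\<And>x. poly q x = a * x + b"
proof -
  have eq: "q \<circ>\<^sub>p [:0,2:] + [:poly q 0:] = smult 2 q"
  proof (intro poly_eq_poly_eq_iff[THEN iffD1] ext)
    fix x :: complex
    show "poly (q \<circ>\<^sub>p [:0,2:] + [:poly q 0:]) x = poly (smult 2 q) x"
      using assms[of x x] by (simp add: poly_pcompose mult.commute[of x 2])
  qed
  have "coeff q n = 0" if n: "n \<ge> 2" for n
  proof -
    obtain k where k: "n = Suc (Suc k)" using n by (metis add_2_eq_Suc le_Suc_ex)
    have "2 ^ n * coeff q n = 2 * coeff q n"
      using arg_cong[OF eq, of "\<lambda>r. coeff r n"] k by (simp add: coeff_pcompose_linear del: power_Suc)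
    moreover have "(2::complex) ^ n \<noteq> 2"
    proof
      assume "(2::complex) ^ n = 2"
      then have "norm ((2::complex) ^ n) = 2" by simp
      then have "(2::real) ^ n = 2 ^ 1" by (simp add: norm_power)
      then show False using n by (subst (asm) power_inject_exp) auto
    qed
    ultimately show ?thesis by simp
  qed
  then have q: "q = [:coeff q 0, coeff q 1:]"
    by (intro poly_eqI) (auto simp: coeff_pCons split: nat.split)
  have "poly q x = coeff q 1 * x + coeff q 0" for x
    by (subst q) simp
  then show ?thesis by (rule that)
qed

text \<open>
  Setting \<open>x = 0\<close> expresses \<open>q\<close> by \<open>h(m) = q(0,m)\<close>. Substituted back, the relation says that
  \<open>h - h(0)\<close> is additive.
\<close>

lemma shift_relation_affine:
  fixes j k :: complex
  assumes rel: "\<And>x l m. (j + k) * peval q (x + l) m = j * peval q x (l + m) + k * peval q x m"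
    and nz: "j \<noteq> 0" "k \<noteq> 0" "j + k \<noteq> 0"
  obtains a b where "\<And>x l. peval q x l = a * (j * x + (j + k) * l) + b"
proof -
  define h where "h = map_poly (\<lambda>c. poly c 0) q"
  have h: "peval q 0 m = poly h m" for m by (simp add: h_def peval_alt)
  have Q: "(j + k) * peval q x m = j * poly h (x + m) + k * poly h m" for x m
    using rel[of 0 x m] h by simp
  have "poly h (x + y) + poly h 0 = poly h x + poly h y" for x y
  proof -
    have "(j + k) * ((j + k) * peval q (x + y) 0) = (j + k) * (j * peval q x y + k * peval q x 0)"
      using rel[of x y 0] by simp
    then have "(j + k) * (j * poly h (x + y) + k * poly h 0)
      = j * ((j + k) * peval q x y) + k * ((j + k) * peval q x 0)"
      unfolding Q[of "x + y" 0] by (simp add: algebra_simps)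
    then have "j * k * (poly h (x + y) + poly h 0) = j * k * (poly h x + poly h y)"
      unfolding Q by (simp add: algebra_simps)
    then show ?thesis using nz by simp
  qed
  then obtain a b where ab: "\<And>x. poly h x = a * x + b" using additive_poly_linear by blast
  have "peval q x l = a / (j + k) * (j * x + (j + k) * l) + b" for x l
  proof -
    have "(j + k) * (a / (j + k) * (j * x + (j + k) * l) + b)
      = a * (j * x + (j + k) * l) + (j + k) * b"
      using nz(3) by (simp add: distrib_left)
    then have "(j + k) * peval q x l = (j + k) * (a / (j + k) * (j * x + (j + k) * l) + b)"
      unfolding Q ab by (simp add: algebra_simps)
    then show ?thesis using nz by simp
  qed
  then show ?thesis by (rule that)
qed

section \<open>Consequences of the Jacobi identity for structure polynomials\<close>

text \<open>
  The recursion step for the ladder \<open>L\<^sub>1, L\<^sub>2, \<dots>\<close>: the hypothesis \<open>E\<close> is the Jacobi identity for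
  degrees \<open>1,-1,K\<close>, where \<open>a,b\<close> and \<open>a',b'\<close> are the coefficients of \<open>P\<^sub>-\<^sub>1\<^sub>,\<^sub>K\<close> and \<open>P\<^sub>-\<^sub>1\<^sub>,\<^sub>K\<^sub>+\<^sub>1\<close>, and
  \<open>c,d\<close> and \<open>c',d'\<close> those of \<open>P\<^sub>1\<^sub>,\<^sub>K\<^sub>-\<^sub>1\<close> and \<open>P\<^sub>1\<^sub>,\<^sub>K\<close>. Four of its coefficients, those of \<open>1\<close>, \<open>x\<close>, \<open>x\<^sup>2\<close>
  and \<open>m\<close>, give linear equations that determine the four new products from the old ones.
\<close>

lemma ladder_coefficients:
  fixes a b c d a' b' c' d' K \<alpha> \<beta> \<gamma> :: complex
  assumes E: "\<And>x l m. (a * (- (x + l) + (K - 1) * m) + b) * (c * (x + K * l) + d)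
      = - K * (\<alpha> * (l + m)\<^sup>2 - \<beta> * (l + m) + \<gamma>)
        + (c' * (x + m + (K + 1) * l) + d') * (a' * (- x + K * m) + b')"
    and K: "K + 1 \<noteq> 0"
    and IH: "a * c = \<alpha>" "3 * (b * c) = - \<beta> * (K + 1)"
      "3 * (a * d) = - \<beta> * (K - 2)" "2 * (b * d) = \<gamma> * ((K - 2) * (K + 1))"
  shows "a' * c' = \<alpha>" "3 * (b' * c') = - \<beta> * (K + 2)"
    "3 * (a' * d') = - \<beta> * (K - 1)" "2 * (b' * d') = \<gamma> * ((K - 1) * (K + 2))"
proof -
  define G where "G x l m = (a * (- (x + l) + (K - 1) * m) + b) * (c * (x + K * l) + d)
      + K * (\<alpha> * (l + m)\<^sup>2 - \<beta> * (l + m) + \<gamma>)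
      - (c' * (x + m + (K + 1) * l) + d') * (a' * (- x + K * m) + b')" for x l m
  have G: "G x l m = 0" for x l m using E[of x l m] by (simp add: G_def)
  (* Coefficient of x^2, as a second difference. *)
  have "2 * (a' * c' - a * c) = G 1 0 0 + G (-1) 0 0 - 2 * G 0 0 0"
    unfolding G_def by (simp add: algebra_simps power2_eq_square)
  then show "a' * c' = \<alpha>" using G IH(1) by simp
  have "b * d + K * \<gamma> - b' * d' = G 0 0 0" unfolding G_def by (simp add: algebra_simps power2_eq_square)
  then have "b' * d' = b * d + K * \<gamma>" using G by simp
  then show "2 * (b' * d') = \<gamma> * ((K - 1) * (K + 2))" using IH(4) by (simp add: algebra_simps)
  (* Coefficient of x. *)
  have "2 * (b * c - a * d - b' * c' + a' * d') = G 1 0 0 - G (-1) 0 0" unfolding G_def by (simp add: algebra_simps power2_eq_square)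
  then have "b * c - a * d - b' * c' + a' * d' = 0" by (metis G diff_0_right mult_eq_0_iff zero_neq_numeral)
  then have dx: "b' * c' = b * c - a * d + a' * d'" by (simp add: algebra_simps)
  (* Coefficient of m. *)
  have "2 * ((K - 1) * (a * d) - K * \<beta> - b' * c' - K * (a' * d')) = G 0 0 1 - G 0 0 (-1)"
    unfolding G_def by (simp add: algebra_simps power2_eq_square)
  then have "(K - 1) * (a * d) - K * \<beta> - b' * c' - K * (a' * d') = 0" by (metis G diff_0_right mult_eq_0_iff zero_neq_numeral)
  then have dm: "(K - 1) * (a * d) = K * \<beta> + b' * c' + K * (a' * d')"
    by (simp add: algebra_simps)
  have "(K + 1) * (3 * (a' * d')) = K * (3 * (a * d)) - 3 * K * \<beta> - 3 * (b * c)"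
  proof -
    have "(K + 1) * (a' * d') = K * (a * d) - K * \<beta> - b * c"
      using dm unfolding dx by (simp add: algebra_simps)
    from arg_cong[OF this, of "\<lambda>t. 3 * t"] show ?thesis by (simp add: algebra_simps)
  qed
  also have "\<dots> = (K + 1) * (- \<beta> * (K - 1))"
    unfolding IH(2,3) by (simp add: algebra_simps)
  finally show ad: "3 * (a' * d') = - \<beta> * (K - 1)"
    using K mult_cancel_left by blast
  have "3 * (b' * c') = 3 * (b * c) - 3 * (a * d) + 3 * (a' * d')"
    using dx by simp
  then show "3 * (b' * c') = - \<beta> * (K + 2)"
    unfolding ad IH(2,3) by (simp add: algebra_simps)
qed

text \<open>
  The structure polynomials of an algebra of class V, without the algebra. \<open>S\<close> is the set of degrees
  whose component is nonzero; an entry that involves a zero component is taken to be zero, which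
  makes the Jacobi identity hold without side conditions. The assumptions \<open>gen_pos\<close> and \<open>gen_neg\<close> are
  what generation by the components of degree \<open>-1\<close>, \<open>0\<close> and \<open>1\<close> means for polynomials: if
  \<open>[L\<^sub>1 \<^sub>\<lambda> L\<^sub>n]\<close> is the first to vanish, nothing exists beyond degree \<open>n\<close>.
\<close>

locale structure_system =
  fixes p :: "int \<Rightarrow> int \<Rightarrow> complex poly poly" and S :: "int set"
  assumes jacobi: "peval (p j k) (x + l) m * peval (p i (j + k)) x l =
      peval (p i j) (- l - m) l * peval (p (i + j) k) x (l + m)
      + peval (p i k) (x + m) l * peval (p j (i + k)) x m"
    and skew: "peval (p i j) x l = - peval (p j i) x (- l - x)"
    and supp: "p i j \<noteq> 0 \<Longrightarrow> i \<in> S \<and> j \<in> S \<and> i + j \<in> S"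
    and p_0_0: "p 0 0 = 0"
    and p_m1_1: "p (-1) 1 \<noteq> 0"
    and p_0_1: "p 0 1 \<noteq> 0"
    and gen_pos: "\<lbrakk>1 \<le> n; \<And>j. \<lbrakk>1 \<le> j; j < n\<rbrakk> \<Longrightarrow> p 1 j \<noteq> 0; p 1 n = 0; n < k\<rbrakk> \<Longrightarrow> k \<notin> S"
    and gen_neg: "\<lbrakk>1 \<le> n; \<And>j. \<lbrakk>1 \<le> j; j < n\<rbrakk> \<Longrightarrow> p (-1) (-j) \<noteq> 0; p (-1) (-n) = 0; n < k\<rbrakk>
      \<Longrightarrow> - k \<notin> S"
begin

abbreviation P where "P i j x l \<equiv> peval (p i j) x l"

lemma units_in_S: "-1 \<in> S" "0 \<in> S" "1 \<in> S"
  using supp[OF p_m1_1] supp[OF p_0_1] by auto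

lemma generator_bracket_nonzero:
  assumes "1 \<le> n" "n < m" "m \<in> S"
  shows "p 1 n \<noteq> 0"
  using assms(1,2)
proof (induction "nat n" arbitrary: n rule: less_induct)
  case less
  have "p 1 j \<noteq> 0" if "1 \<le> j" "j < n" for j
    using less.hyps[of j] less.prems that by auto
  then show ?case using gen_pos[of n m] less.prems assms(3) by blast
qed

lemma S_pos_down: "1 \<le> n \<Longrightarrow> n \<le> m \<Longrightarrow> m \<in> S \<Longrightarrow> n \<in> S"
  using generator_bracket_nonzero[of n m] supp[of 1 n] by (cases "n = m") auto

text \<open>
  \<open>f\<close> and \<open>g\<close> are \<open>P\<^sub>0\<^sub>1\<close> and \<open>P\<^sub>-\<^sub>1\<^sub>,\<^sub>1\<close> as polynomials in one variable, \<open>\<lambda>\<close> and \<open>\<partial>\<close> respectively;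
  the variable that is set to zero does not occur in them.
\<close>

definition f where "f = map_poly (\<lambda>c. poly c 0) (p 0 1)"
definition g where "g = poly (p (-1) 1) 0"
definition phi where "phi k l = P 0 k 0 l"

lemma p_0_indep: "P 0 k x l = phi k l"
proof -
  have "P 0 k (x + l) m * P 0 k x l = P 0 k (x + m) l * P 0 k x m" for x l m
    using jacobi[where j=0 and k=k and x=x and l=l and m=m and i=0] by (simp add: p_0_0)
  then show ?thesis unfolding phi_def by (rule commuting_action_const)
qed

lemma p_k_0: "P k 0 x l = - phi k (- l - x)"
  using skew[of k 0 x l] by (simp add: p_0_indep)

lemma poly_f: "poly f l = phi 1 l"
  by (simp add: f_def phi_def peval_alt)

lemma f_nonzero: "f \<noteq> 0"
proof
  assume "f = 0"
  then have "p 0 1 = 0" by (intro peval_eqI) (simp add: p_0_indep flip: poly_f)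
  then show False using p_0_1 by simp
qed

lemma phi_equation:
  "phi (j + k) l * P j k (x + l) m = phi j l * P j k x (l + m) + phi k l * P j k x m"
  using jacobi[where j=j and k=k and x=x and l=l and m=m and i=0] by (simp add: p_0_indep mult.commute)

lemma phi_add: "p j k \<noteq> 0 \<Longrightarrow> phi (j + k) l = phi j l + phi k l"
  using shift_relation_coeffs[of "phi (j + k) l" "p j k" l "phi j l" "phi k l"] phi_equation by blast

lemma phi_0: "phi 0 l = 0"
  by (simp add: phi_def p_0_0)

lemma phi_m1: "phi (-1) l = - phi 1 l"
  using phi_add[OF p_m1_1, of l] by (simp add: phi_0 add_eq_0_iff2)

text \<open>
  The bracket \<open>[L\<^sub>1 \<^sub>\<lambda> L\<^sub>i]\<close> is nonzero as long as \<open>L\<^sub>i\<^sub>+\<^sub>1\<close> is, so additivity can be applied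
  along the ladder.
\<close>

lemma phi_pos: "1 \<le> k \<Longrightarrow> k \<in> S \<Longrightarrow> phi k l = of_int k * phi 1 l"
proof (induction k rule: int_ge_induct)
  case (step i)
  have "p 1 i \<noteq> 0" using generator_bracket_nonzero[of i "i + 1"] step by simp
  then have "phi (1 + i) l = phi 1 l + phi i l" by (rule phi_add)
  then show ?case using step S_pos_down[of i "i + 1"] by (simp add: algebra_simps)
qed simp

text \<open>
  The symmetry \<open>L\<^sub>i \<mapsto> - L\<^sub>-\<^sub>i\<close>. The sign is what makes it fix \<open>f\<close> and \<open>g\<close> instead of negating
  them.
\<close>

lemma flip: "structure_system (\<lambda>i j. - p (- i) (- j)) {i. - i \<in> S}"
proof
  fix i j k x l m
  show "peval (- p (- j) (- k)) (x + l) m * peval (- p (- i) (- (j + k))) x l =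
    peval (- p (- i) (- j)) (- l - m) l * peval (- p (- (i + j)) (- k)) x (l + m) +
    peval (- p (- i) (- k)) (x + m) l * peval (- p (- j) (- (i + k))) x m"
    using jacobi[where j="-j" and k="-k" and x=x and l=l and m=m and i="-i"] by simp
  show "peval (- p (- i) (- j)) x l = - peval (- p (- j) (- i)) x (- l - x)"
    using skew[of "-i" "-j" x l] by simp
  show "- p (- i) (- j) \<noteq> 0 \<Longrightarrow> i \<in> {i. - i \<in> S} \<and> j \<in> {i. - i \<in> S} \<and> i + j \<in> {i. - i \<in> S}"
    using supp[of "-i" "-j"] by simp
next
  show "- p (- 0) (- 0) = 0" by (simp add: p_0_0)
next
  show "- p (- (- 1)) (- 1) \<noteq> 0"
  proof
    assume "- p (- (- 1)) (- 1) = 0"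
    then have "p (-1) 1 = 0" using skew[of "-1" 1] by (intro peval_eqI) simp
    then show False using p_m1_1 by simp
  qed
next
  show "- p (- 0) (- 1) \<noteq> 0"
  proof
    assume "- p (- 0) (- 1) = 0"
    then have "phi 1 l = 0" for l using phi_m1[of l] by (simp add: phi_def)
    then show False using f_nonzero by (simp add: poly_f flip: poly_all_0_iff_0)
  qed
next
  fix n m :: int
  assume "1 \<le> n" "\<And>j. 1 \<le> j \<Longrightarrow> j < n \<Longrightarrow> - p (- 1) (- j) \<noteq> 0" "- p (- 1) (- n) = 0" "n < m"
  then show "m \<notin> {i. - i \<in> S}" using gen_neg[of n m] by simp
next
  fix n m :: int
  assume "1 \<le> n" "\<And>j. 1 \<le> j \<Longrightarrow> j < n \<Longrightarrow> - p (- (- 1)) (- (- j)) \<noteq> 0" "- p (- (- 1)) (- (- n)) = 0" "n < m"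
  then show "- m \<notin> {i. - i \<in> S}" using gen_pos[of n m] by simp
qed

end

context structure_system begin

lemma phi_multiple: "k \<in> S \<Longrightarrow> phi k l = of_int k * phi 1 l"
proof -
  interpret fl: structure_system "\<lambda>i j. - p (- i) (- j)" "{i. - i \<in> S}" by (rule flip)
  have fl_phi: "fl.phi i l = - phi (- i) l" for i by (simp add: fl.phi_def phi_def)
  assume k: "k \<in> S"
  consider "k \<ge> 1" | "k = 0" | "k \<le> -1" by linarith
  then show ?thesis
  proof cases
    case 3
    then have "fl.phi (- k) l = of_int (- k) * fl.phi 1 l" using k by (intro fl.phi_pos) auto
    then show ?thesis by (simp add: fl_phi phi_m1)
  qed (auto simp: phi_pos phi_0 k)
qed

lemma phi_eq: "phi k l = (if k \<in> S then of_int k * poly f l else 0)"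
proof (cases "k \<in> S")
  case False
  then have "p 0 k = 0" using supp[of 0 k] by blast
  then show ?thesis using False by (simp add: phi_def)
qed (simp add: phi_multiple poly_f)

text \<open>
  The identity for \<open>0,j,k\<close> is this one multiplied by \<open>f(l)\<close>, which can be cancelled because both
  sides are polynomials in \<open>l\<close>.
\<close>

lemma shift_relation:
  "of_int (j + k) * P j k (x + l) m = of_int j * P j k x (l + m) + of_int k * P j k x m"
proof (cases "p j k = 0")
  case False
  then have S: "j \<in> S" "k \<in> S" "j + k \<in> S" using supp by auto
  let ?D = "smult (of_int (j + k)) (poly (p j k) [:m:] \<circ>\<^sub>p [:x, 1:])
    - smult (of_int j) (map_poly (\<lambda>c. poly c x) (p j k) \<circ>\<^sub>p [:m, 1:]) - [:of_int k * P j k x m:]"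
  have D: "poly ?D l = of_int (j + k) * P j k (x + l) m
      - of_int j * P j k x (l + m) - of_int k * P j k x m" for l
    by (simp add: poly_pcompose peval_alt[symmetric] peval_def[symmetric] add.commute)
  have "poly (f * ?D) l = 0" for l
    using phi_equation[of j k l x m] S unfolding poly_mult D
    by (simp add: phi_eq algebra_simps)
  then have "f * ?D = 0" using poly_all_0_iff_0 by blast
  then have "?D = 0" using f_nonzero by simp
  then have "poly ?D l = 0" by simp
  then show ?thesis unfolding D by (simp add: algebra_simps)
qed simp

lemma affine:
  assumes "j \<noteq> 0" "k \<noteq> 0" "j + k \<noteq> 0"
  shows "P j k x l = (P j k 1 0 - P j k 0 0) / of_int j * (of_int j * x + of_int (j + k) * l) + P j k 0 0"
proof -
  have "complex_of_int (j + k) \<noteq> 0" using assms(3) of_int_eq_0_iff by blast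
  then have "complex_of_int j + of_int k \<noteq> 0" by simp
  then obtain a b where ab: "\<And>x l. P j k x l = a * (of_int j * x + (of_int j + of_int k) * l) + b"
    using shift_relation_affine[of "of_int j" "of_int k" "p j k"] shift_relation[of j k] assms(1,2)
    by (metis of_int_0_eq_iff of_int_add)
  show ?thesis using assms(1) by (simp add: ab)
qed

lemma antidiagonal_indep: "j \<noteq> 0 \<Longrightarrow> P j (- j) x l = P j (- j) x 0"
  using shift_relation[of j "- j" x l 0] by simp

text \<open>
  By \<open>affine\<close>, \<open>P\<^sub>-\<^sub>1\<^sub>,\<^sub>k = A\<^sub>k (-\<partial> + (k-1)\<lambda>) + B\<^sub>k\<close> and \<open>P\<^sub>1\<^sub>,\<^sub>k = C\<^sub>k (\<partial> + (k+1)\<lambda>) + D\<^sub>k\<close>; the four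
  numbers are recovered from values at \<open>\<partial> = 0\<close> and \<open>\<partial> = 1\<close>.
\<close>

definition A where "A k = P (-1) k 0 0 - P (-1) k 1 0"
definition B where "B k = P (-1) k 0 0"
definition C where "C k = P 1 k 1 0 - P 1 k 0 0"
definition D where "D k = P 1 k 0 0"

lemma p_1: "k \<noteq> 0 \<Longrightarrow> k \<noteq> -1 \<Longrightarrow> P 1 k x l = C k * (x + of_int (k + 1) * l) + D k"
  using affine[of 1 k x l] by (simp add: C_def D_def add.commute)

lemma p_m1: "k \<noteq> 0 \<Longrightarrow> k \<noteq> 1 \<Longrightarrow> P (-1) k x l = A k * (- x + of_int (k - 1) * l) + B k"
  using affine[of "-1" k x l] by (simp add: A_def B_def)

lemma p_m1_1_val: "P (-1) 1 x l = poly g x"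
  using antidiagonal_indep[of "-1" x l] by (simp add: g_def peval_def)

lemma p_1_m1_val: "P 1 (-1) x l = - poly g x"
  using skew[of 1 "-1" x l] by (simp add: p_m1_1_val)

lemma p_0_val: "P 0 k x l = (if k \<in> S then of_int k * poly f l else 0)"
  by (simp add: p_0_indep phi_eq)

lemma p_val_0: "P k 0 x l = (if k \<in> S then - of_int k * poly f (- l - x) else 0)"
  by (simp add: p_k_0 phi_eq)

lemma D_1: "D 1 = 0"
  using skew[of 1 1 0 0] by (simp add: D_def)

text \<open>
  The coefficients of \<open>F(x) = g(x) f(-x)\<close>.
\<close>

definition \<alpha> where "\<alpha> = A 2 * C 1"
definition \<beta> where "\<beta> = - B 2 * C 1"
definition \<gamma> where "\<gamma> = poly g 0 * poly f 0"

text \<open>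
  The Jacobi identity for \<open>1,-1,1\<close> at \<open>\<lambda> = \<mu> = 0\<close>: its last term is a product of two affine
  functions, and the other two are values of \<open>F\<close>.
\<close>

lemma F_quadratic: "poly g x * poly f (- x) = \<alpha> * x\<^sup>2 + \<beta> * x + \<gamma>"
  using jacobi[where j="-1" and k=1 and x=x and l=0 and m=0 and i=1] units_in_S
  by (simp add: p_m1_1_val p_1_m1_val p_0_val p_val_0 p_1 p_m1 D_1 \<alpha>_def \<beta>_def \<gamma>_def)
    (simp add: algebra_simps power2_eq_square)

text \<open>
  Induction along the ladder by \<open>ladder_coefficients\<close>. The relations make no assumption on \<open>L\<^sub>k\<^sub>+\<^sub>1\<close>; if it
  is zero, they say that the right-hand sides vanish.
\<close>

lemma relations:
  assumes "1 \<le> k" "k \<in> S"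
  shows "A (k + 1) * C k = \<alpha> \<and> 3 * B (k + 1) * C k = - \<beta> * of_int (k + 2) \<and>
    3 * A (k + 1) * D k = - \<beta> * of_int (k - 1) \<and>
    2 * B (k + 1) * D k = \<gamma> * of_int ((k - 1) * (k + 2))"
  using assms
proof (induction k rule: int_ge_induct)
  case base
  show ?case by (simp add: \<alpha>_def \<beta>_def D_1)
next
  case (step i)
  define k where "k = i + 1"
  have i: "i = k - 1" and k2: "k \<ge> 2" and kS: "k \<in> S" using step by (auto simp: k_def)
  have iS: "i \<in> S" using S_pos_down[of i k] k2 kS i by simp
  note IH = step.IH[OF iS, unfolded i, simplified]
  have F: "poly f t * poly g (- t) = \<alpha> * t\<^sup>2 - \<beta> * t + \<gamma>" for t
    using F_quadratic[of "- t"] by (simp add: mult.commute)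
  have E: "(A k * (- (x + l) + of_int (k - 1) * m) + B k) * (C (k - 1) * (x + of_int k * l) + D (k - 1))
    = - of_int k * (\<alpha> * (l + m)\<^sup>2 - \<beta> * (l + m) + \<gamma>)
      + (C k * (x + m + of_int (k + 1) * l) + D k) * (A (k + 1) * (- x + of_int k * m) + B (k + 1))"
    for x l m
  proof -
    have "P (-1) k (x + l) m = A k * (- (x + l) + of_int (k - 1) * m) + B k"
      "P 1 (-1 + k) x l = C (k - 1) * (x + of_int k * l) + D (k - 1)"
      "P 1 k (x + m) l = C k * (x + m + of_int (k + 1) * l) + D k"
      "P (-1) (1 + k) x m = A (k + 1) * (- x + of_int k * m) + B (k + 1)"
      using p_m1[of k] p_1[of "k - 1"] p_1[of k] p_m1[of "k + 1"] k2
      by (simp_all add: add.commute)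
    moreover have "P 1 (-1) (- l - m) l * P 0 k x (l + m)
      = - of_int k * (\<alpha> * (l + m)\<^sup>2 - \<beta> * (l + m) + \<gamma>)"
    proof -
      have "- l - m = - (l + m)" by simp
      then show ?thesis unfolding F[of "l + m", symmetric] p_1_m1_val p_0_val
        using kS by simp
    qed
    ultimately show ?thesis
      using jacobi[where j="-1" and k=k and x=x and l=l and m=m and i=1] by simp
  qed
  define K where "K = complex_of_int k"
  have K: "K + 1 \<noteq> 0"
    unfolding K_def using k2 of_int_eq_0_iff[of "k + 1", where 'a=complex] by simp
  have "A (k + 1) * C k = \<alpha>" "3 * (B (k + 1) * C k) = - \<beta> * (K + 2)"
    "3 * (A (k + 1) * D k) = - \<beta> * (K - 1)" "2 * (B (k + 1) * D k) = \<gamma> * ((K - 1) * (K + 2))"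
    using ladder_coefficients[of "A k" K "B k" "C (k - 1)" "D (k - 1)" \<alpha> \<beta> \<gamma> "C k" "D k" "A (k + 1)" "B (k + 1)"]
      E K IH by (simp_all add: K_def mult.assoc)
  then show ?case by (simp add: K_def mult.assoc flip: k_def)
qed

end

section \<open>The positive half\<close>

text \<open>
  The rescaling of basis vectors that turns the factors \<open>\<kappa>\<^sub>k\<close> between consecutive ones into \<open>1\<close>.
\<close>

lemma product_scaling:
  fixes \<kappa> :: "int \<Rightarrow> complex"
  assumes "\<And>k. k \<ge> 1 \<Longrightarrow> \<kappa> k \<noteq> 0"
  obtains c where "c 1 = 1" "\<And>k. k \<ge> 1 \<Longrightarrow> c k \<noteq> 0" "\<And>k. k \<ge> 1 \<Longrightarrow> \<kappa> k * c (k + 1) = c k"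
proof (rule that[of "\<lambda>k. \<Prod>j\<in>{1..<k}. inverse (\<kappa> j)"])
  show "(\<Prod>j\<in>{1..<k}. inverse (\<kappa> j)) \<noteq> 0" if "k \<ge> 1" for k
    using assms by auto
  show "\<kappa> k * (\<Prod>j\<in>{1..<k + 1}. inverse (\<kappa> j)) = (\<Prod>j\<in>{1..<k}. inverse (\<kappa> j))" if k: "k \<ge> 1" for k
  proof -
    have "{1..<k + 1} = insert k {1..<k}" using k by auto
    then show ?thesis using assms[OF k] by simp
  qed
qed simp

context structure_system begin

lemma g_nonzero: "g \<noteq> 0"
proof
  assume "g = 0"
  then have "p (-1) 1 = 0" by (intro peval_eqI) (simp add: p_m1_1_val)
  then show False using p_m1_1 by simp
qed

lemma F_poly: "g * (f \<circ>\<^sub>p [:0,-1:]) = [:\<gamma>, \<beta>, \<alpha>:]"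
  by (rule poly_eq_poly_eq_iff[THEN iffD1], rule ext)
    (use F_quadratic in \<open>simp add: poly_pcompose power2_eq_square algebra_simps\<close>)

lemma F_nonzero: "[:\<gamma>, \<beta>, \<alpha>:] \<noteq> 0"
  using g_nonzero f_nonzero by (simp flip: F_poly add: pcompose_eq_0_iff)

lemma degree_sum: "degree g + degree f = degree [:\<gamma>, \<beta>, \<alpha>:]"
proof -
  have "degree [:\<gamma>, \<beta>, \<alpha>:] = degree g + degree (f \<circ>\<^sub>p [:0,-1:])"
    unfolding F_poly[symmetric]
    using g_nonzero f_nonzero by (intro degree_mult_eq) (auto simp: pcompose_eq_0_iff)
  then show ?thesis by (simp add: degree_pcompose)
qed

lemma p_1_1_zero:
  assumes "p 1 1 = 0"
  shows "k \<ge> 2 \<Longrightarrow> k \<notin> S" "\<alpha> = 0" "\<beta> = 0"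
  using gen_pos[of 1 k] assms by (auto simp: \<alpha>_def \<beta>_def C_def)

lemma coeffs_zero: "p 1 k = 0 \<longleftrightarrow> C k = 0 \<and> D k = 0" if "k \<ge> 1"
proof
  assume "C k = 0 \<and> D k = 0"
  then show "p 1 k = 0" using p_1[of k] that by (intro peval_eqI) simp
qed (simp add: C_def D_def)

text \<open>
  If \<open>P\<^sub>1\<^sub>,\<^sub>k\<close> were zero for some \<open>k \<ge> 2\<close>, the relations at \<open>k\<close> would force \<open>\<alpha> = \<beta> = \<gamma> = 0\<close>, but \<open>F\<close> is a
  product of two nonzero polynomials. At \<open>k = 1\<close> the last relation is \<open>0 = 0\<close>, which leaves room
  for the algebras with \<open>L\<^sub>2 = 0\<close>.
\<close>

lemma all_positive:
  assumes "p 1 1 \<noteq> 0" "k \<ge> 1"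
  shows "k \<in> S \<and> p 1 k \<noteq> 0"
  using assms(2)
proof (induction k rule: int_ge_induct)
  case base
  show ?case using assms(1) units_in_S by simp
next
  case (step i)
  then have iS: "i + 1 \<in> S" using supp[of 1 i] by (simp add: add.commute)
  have "p 1 (i + 1) \<noteq> 0"
  proof
    assume "p 1 (i + 1) = 0"
    then have "C (i + 1) = 0" "D (i + 1) = 0" by (simp_all add: C_def D_def)
    then have z: "\<alpha> = 0" "\<beta> * of_int (i + 1 + 2) = 0" "\<gamma> * of_int ((i + 1 - 1) * (i + 1 + 2)) = 0"
      using relations[of "i + 1"] iS step.hyps by auto
    have "i + 1 + 2 \<noteq> 0" "(i + 1 - 1) * (i + 1 + 2) \<noteq> 0" using step.hyps by auto
    then have "\<beta> = 0" "\<gamma> = 0" using z(2,3) by (metis mult_eq_0_iff of_int_eq_0_iff)+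
    then show False using F_nonzero z(1) by simp
  qed
  then show ?case using iS by simp
qed

text \<open>
  The reason why the degrees cannot add up to one. With \<open>\<alpha> = 0\<close> the first relation at \<open>k = 2\<close> says
  \<open>A\<^sub>3 C\<^sub>2 = 0\<close>, while a nonzero \<open>\<beta>\<close> would make both factors nonzero by the second and third.
\<close>

lemma not_linear: "\<alpha> = 0 \<Longrightarrow> \<beta> = 0"
proof (rule ccontr)
  assume a: "\<alpha> = 0" and b: "\<beta> \<noteq> 0"
  have "p 1 1 \<noteq> 0" using p_1_1_zero(3) b by blast
  then have "2 \<in> S" using all_positive[of 2] by simp
  then have "A 3 * C 2 = 0" "3 * B 3 * C 2 = - \<beta> * 4" "3 * A 3 * D 2 = - \<beta>"
    using relations[of 2] a by auto
  then show False using b by auto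
qed

text \<open>
  The parameter of the algebras of the classification: \<open>-s\<close> and \<open>-2s\<close> will be the roots of \<open>F\<close>
  when \<open>\<alpha>\<close> is nonzero.
\<close>

definition s where "s = \<beta> / (3 * \<alpha>)"

text \<open>
  The four products at \<open>k = 2\<close> satisfy \<open>(A\<^sub>3 C\<^sub>2) (B\<^sub>3 D\<^sub>2) = (B\<^sub>3 C\<^sub>2) (A\<^sub>3 D\<^sub>2)\<close>, which is
  \<open>9 \<alpha> \<gamma> = 2 \<beta>\<^sup>2\<close>.
\<close>

lemma quadratic_factor:
  assumes "\<alpha> \<noteq> 0"
  shows "\<beta> = 3 * s * \<alpha>" "\<gamma> = 2 * s\<^sup>2 * \<alpha>"
proof -
  show b: "\<beta> = 3 * s * \<alpha>" using assms by (simp add: s_def)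
  have "p 1 1 \<noteq> 0" using p_1_1_zero(2) assms by blast
  then have "2 \<in> S" using all_positive[of 2] by simp
  then have r: "A 3 * C 2 = \<alpha>" "3 * (B 3 * C 2) = - \<beta> * 4" "3 * (A 3 * D 2) = - \<beta>" "2 * (B 3 * D 2) = \<gamma> * 4"
    using relations[of 2] by (auto simp: mult.assoc)
  have bc: "B 3 * C 2 = - 4 * s * \<alpha>" and ad: "A 3 * D 2 = - s * \<alpha>" and bd: "B 3 * D 2 = 2 * \<gamma>"
    using r b by (auto simp: field_simps)
  have "\<alpha> * (2 * \<gamma>) = (A 3 * C 2) * (B 3 * D 2)" by (simp add: r(1) bd)
  also have "\<dots> = (B 3 * C 2) * (A 3 * D 2)" by (simp add: mult_ac)
  also have "\<dots> = \<alpha> * (4 * s\<^sup>2 * \<alpha>)" unfolding bc ad by (simp add: power2_eq_square)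
  finally have "2 * \<gamma> = 4 * s\<^sup>2 * \<alpha>" using assms mult_cancel_left by blast
  then show "\<gamma> = 2 * s\<^sup>2 * \<alpha>" by simp
qed

lemma F_factored: "\<alpha> \<noteq> 0 \<Longrightarrow> poly g x * poly f (- x) = \<alpha> * ((x + s) * (x + 2 * s))"
  unfolding F_quadratic using quadratic_factor by (simp add: algebra_simps power2_eq_square)

text \<open>
  Here \<open>A\<close> and \<open>C\<close> do not vanish, and the relations fix the ratios \<open>D/C\<close> and \<open>B/A\<close>. Rescaling makes all
  \<open>C\<^sub>k\<close> equal to one; the factor \<open>\<alpha>\<close> that remains in the second row will be absorbed by rescaling
  \<open>L\<^sub>-\<^sub>1\<close>.
\<close>

lemma CL_positive_scaling:
  assumes a: "\<alpha> \<noteq> 0"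
  obtains c where "c 1 = 1" "\<And>k. k \<ge> 1 \<Longrightarrow> c k \<noteq> 0"
    "\<And>k x l. k \<ge> 1 \<Longrightarrow> P 1 k x l * c (k + 1) = c k * (x + of_int (k + 1) * l + s * of_int (1 - k))"
    "\<And>k x l. k \<ge> 2 \<Longrightarrow> P (-1) k x l * c (k - 1) = \<alpha> * c k * (- x + of_int (k - 1) * l + s * of_int (-1 - k))"
proof -
  have "p 1 1 \<noteq> 0" using p_1_1_zero(2) a by blast
  then have S: "k \<in> S" if "k \<ge> 1" for k using all_positive[of k] that by simp
  note rel = relations[OF _ S]
  have AC: "A (k + 1) * C k = \<alpha>" if "k \<ge> 1" for k using rel[of k] that by simp
  have C0: "C k \<noteq> 0" if "k \<ge> 1" for k using AC[OF that] a by auto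
  have A0: "A (k + 1) \<noteq> 0" if "k \<ge> 1" for k using AC[OF that] a by auto
  have D: "D k = s * of_int (1 - k) * C k" if k: "k \<ge> 1" for k
  proof -
    have "3 * A (k + 1) * D k = 3 * A (k + 1) * (s * of_int (1 - k) * C k)"
      using rel[OF k k] unfolding quadratic_factor(1)[OF a] AC[OF k, symmetric]
      by (simp add: algebra_simps)
    then show ?thesis using A0[OF k] by simp
  qed
  have B: "B (k + 1) = s * of_int (- 2 - k) * A (k + 1)" if k: "k \<ge> 1" for k
  proof -
    have "3 * C k * B (k + 1) = 3 * C k * (s * of_int (- 2 - k) * A (k + 1))"
      using rel[OF k k] unfolding quadratic_factor(1)[OF a] AC[OF k, symmetric]
      by (simp add: algebra_simps)
    then show ?thesis using C0[OF k] by simp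
  qed
  obtain c where c: "c 1 = 1" "\<And>k. k \<ge> 1 \<Longrightarrow> c k \<noteq> 0" "\<And>k. k \<ge> 1 \<Longrightarrow> C k * c (k + 1) = c k"
    using product_scaling[of C] C0 by blast
  show ?thesis
  proof (rule that[of c, OF c(1,2)])
    fix k :: int and x l :: complex
    assume k: "k \<ge> 1"
    have "P 1 k x l = C k * (x + of_int (k + 1) * l + s * of_int (1 - k))"
      using k p_1[of k x l] unfolding D[OF k] by (simp add: algebra_simps)
    then have "P 1 k x l * c (k + 1) = (C k * c (k + 1)) * (x + of_int (k + 1) * l + s * of_int (1 - k))"
      by (simp only: mult_ac)
    then show "P 1 k x l * c (k + 1) = c k * (x + of_int (k + 1) * l + s * of_int (1 - k))"
      using c(3)[OF k] by simp
  next
    fix k :: int and x l :: complex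
    assume k: "k \<ge> 2"
    then have k1: "k - 1 \<ge> 1" by simp
    have "A k * c (k - 1) = (A k * C (k - 1)) * c k" using c(3)[OF k1] by (simp add: mult.assoc)
    also have "\<dots> = \<alpha> * c k" using AC[OF k1] by simp
    finally have Ac: "A k * c (k - 1) = \<alpha> * c k" .
    have "P (-1) k x l = A k * (- x + of_int (k - 1) * l + s * of_int (-1 - k))"
    proof -
      have "B k = s * of_int (- 1 - k) * A k" using B[OF k1] by (simp add: algebra_simps)
      then have "P (-1) k x l = A k * (- x + of_int (k - 1) * l) + s * of_int (- 1 - k) * A k"
        using k p_m1[of k x l] by simp
      then show ?thesis by (simp add: algebra_simps)
    qed
    then have "P (-1) k x l * c (k - 1) = (A k * c (k - 1)) * (- x + of_int (k - 1) * l + s * of_int (-1 - k))"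
      by (simp only: mult_ac)
    with Ac show "P (-1) k x l * c (k - 1) = \<alpha> * c k * (- x + of_int (k - 1) * l + s * of_int (-1 - k))"
      by simp
  qed
qed

text \<open>
  With \<open>\<alpha> = \<beta> = 0\<close> the only nonzero products are \<open>B\<^sub>k\<^sub>+\<^sub>1 D\<^sub>k\<close> with \<open>k \<ge> 2\<close>, so the rows of \<open>L\<^sub>1\<close> and
  \<open>L\<^sub>-\<^sub>1\<close> are constant, in degrees \<open>k \<ge> 2\<close>.
\<close>

lemma const_positive:
  assumes z: "\<alpha> = 0" "\<beta> = 0"
  shows "k \<ge> 2 \<Longrightarrow> P 1 k x l = D k" "k \<ge> 2 \<Longrightarrow> P (-1) k x l = B k" "B 2 = 0"
    "p 1 1 \<noteq> 0 \<Longrightarrow> k \<ge> 2 \<Longrightarrow> D k \<noteq> 0"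
    "k \<ge> 1 \<Longrightarrow> p 1 1 \<noteq> 0 \<Longrightarrow> 2 * B (k + 1) * D k = \<gamma> * of_int ((k - 1) * (k + 2))"
proof -
  have *: "C k = 0 \<and> (p 1 1 \<noteq> 0 \<longrightarrow> D k \<noteq> 0) \<and> A k = 0" if k: "k \<ge> 2" for k
  proof (cases "p 1 1 = 0")
    case True
    then have "p 1 k = 0" "p (-1) k = 0"
      using p_1_1_zero(1)[OF True k] supp by blast+
    then show ?thesis using True by (simp add: A_def C_def)
  next
    case False
    note S = all_positive[OF False]
    have "\<gamma> \<noteq> 0" using F_nonzero z by auto
    moreover have "(k - 1) * (k + 2) \<noteq> 0" using k by auto
    ultimately have "\<gamma> * of_int ((k - 1) * (k + 2)) \<noteq> 0" by (metis mult_eq_0_iff of_int_eq_0_iff)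
    then have "B (k + 1) \<noteq> 0" "D k \<noteq> 0" using relations[of k] S[of k] k by auto
    moreover have "3 * B (k + 1) * C k = 0" using relations[of k] S[of k] k z by auto
    moreover have "A k = 0"
    proof -
      have r: "A k * C (k - 1) = 0" "3 * A k * D (k - 1) = 0"
        using relations[of "k - 1"] S[of "k - 1"] k z by auto
      moreover have "C (k - 1) \<noteq> 0 \<or> D (k - 1) \<noteq> 0"
        using coeffs_zero[of "k - 1"] S[of "k - 1"] k by auto
      ultimately show ?thesis by auto
    qed
    ultimately show ?thesis by auto
  qed
  show "k \<ge> 2 \<Longrightarrow> P 1 k x l = D k" "k \<ge> 2 \<Longrightarrow> P (-1) k x l = B k"
    using *[of k] p_1[of k x l] p_m1[of k x l] by auto
  show "p 1 1 \<noteq> 0 \<Longrightarrow> k \<ge> 2 \<Longrightarrow> D k \<noteq> 0" using *[of k] by auto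
  show "B 2 = 0"
  proof (cases "p 1 1 = 0")
    case True
    then have "p (-1) 2 = 0" using p_1_1_zero(1)[OF True, of 2] supp by force
    then show ?thesis by (simp add: B_def)
  next
    case False
    then have "C 1 \<noteq> 0" using coeffs_zero[of 1] D_1 by auto
    then show ?thesis using z by (simp add: \<beta>_def)
  qed
  show "k \<ge> 1 \<Longrightarrow> p 1 1 \<noteq> 0 \<Longrightarrow> 2 * B (k + 1) * D k = \<gamma> * of_int ((k - 1) * (k + 2))"
    using relations[of k] all_positive[of k] by auto
qed

lemma M_positive_scaling:
  assumes z: "\<alpha> = 0" "\<beta> = 0" and nz: "p 1 1 \<noteq> 0"
  obtains c where "c 1 = 1" "\<And>k. k \<ge> 1 \<Longrightarrow> c k \<noteq> 0"
    "\<And>x l. P 1 1 x l * c 2 = x + 2 * l"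
    "\<And>k x l. k \<ge> 2 \<Longrightarrow> P 1 k x l * c (k + 1) = c k"
    "\<And>k x l. k \<ge> 2 \<Longrightarrow> P (-1) k x l * c (k - 1) = \<gamma> * c k * of_int ((k + 1) * (k - 2)) / 2"
proof -
  define \<kappa> where "\<kappa> k = (if k = 1 then C 1 else D k)" for k
  have C1: "C 1 \<noteq> 0" using coeffs_zero[of 1] nz D_1 by auto
  then have "\<kappa> k \<noteq> 0" if "k \<ge> 1" for k
    using const_positive(4)[OF z nz, of k] that by (auto simp: \<kappa>_def)
  then obtain c where c: "c 1 = 1" "\<And>k. k \<ge> 1 \<Longrightarrow> c k \<noteq> 0" "\<And>k. k \<ge> 1 \<Longrightarrow> \<kappa> k * c (k + 1) = c k"
    using product_scaling[of \<kappa>] by blast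
  show ?thesis
  proof (rule that[of c, OF c(1,2)])
    show "P 1 1 x l * c 2 = x + 2 * l" for x l
      using c(3)[of 1] c(1) p_1[of 1 x l] D_1 by (simp add: \<kappa>_def mult.commute mult.left_commute)
    show "P 1 k x l * c (k + 1) = c k" if k: "k \<ge> 2" for k x l
      using c(3)[of k] k const_positive(1)[OF z k] by (simp add: \<kappa>_def)
    show "P (-1) k x l * c (k - 1) = \<gamma> * c k * of_int ((k + 1) * (k - 2)) / 2" if k: "k \<ge> 2" for k x l
    proof (cases "k = 2")
      case True
      then show ?thesis using const_positive(2)[OF z k] const_positive(3)[OF z] by simp
    next
      case False
      then have "2 * (P (-1) k x l * c (k - 1)) = 2 * B k * D (k - 1) * c k"
        using c(3)[of "k - 1"] k const_positive(2)[OF z k] by (simp add: \<kappa>_def)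
      also have "\<dots> = \<gamma> * of_int ((k - 2) * (k + 1)) * c k"
        using const_positive(5)[OF z, of "k - 1"] k nz by simp
      finally show ?thesis by (simp add: field_simps)
    qed
  qed
qed

end

section \<open>Propagation to all degrees\<close>

definition cl2 :: "complex \<Rightarrow> int \<Rightarrow> int \<Rightarrow> complex \<Rightarrow> complex \<Rightarrow> complex"
  where "cl2 s i j x l = of_int i * x + of_int (i + j) * l + s * of_int (i - j)"

lemma peval_CL2_table: "peval (CL2_table s i j) x l = cl2 s i j x l"
proof -
  have "complex_of_int (i - j) = of_int i - of_int j" by simp
  then show ?thesis unfolding CL2_table_def cl2_def
    by (simp only: peval_simps poly_0 poly_pCons mult_zero_right add_0_right) (simp add: mult.commute)
qed

lemma cl2_jacobi:
  "cl2 s j k (x + l) m * cl2 s i (j + k) x l =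
    cl2 s i j (- l - m) l * cl2 s (i + j) k x (l + m) + cl2 s i k (x + m) l * cl2 s j (i + k) x m"
  by (simp add: cl2_def algebra_simps)

text \<open>
  The Jacobi identity for \<open>1,i,k\<close> contains \<open>Q\<^sub>i\<^sub>+\<^sub>1\<^sub>,\<^sub>k\<close> with a factor \<open>Q\<^sub>1\<^sub>,\<^sub>i\<close>, a nonzero affine function;
  everything else in it belongs to the rows of \<open>1\<close> and \<open>i\<close>. Only products \<open>g(x) f(-x)\<close> occur, so the
  computation is the one for \<open>CL\<^sub>2(0,s)\<close> whatever the factors are, except for the entries that
  contain \<open>f\<close> or \<open>g\<close> alone.
\<close>

lemma CL_determined:
  fixes Q :: "int \<Rightarrow> int \<Rightarrow> complex \<Rightarrow> complex \<Rightarrow> complex"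
  assumes jac: "\<And>i j k x l m. Q j k (x + l) m * Q i (j + k) x l =
      Q i j (- l - m) l * Q (i + j) k x (l + m) + Q i k (x + m) l * Q j (i + k) x m"
    and Q_0: "\<And>k x l. Q k 0 x l = - of_int k * f (- l - x)"
    and Q_1_m1: "\<And>x l. Q 1 (-1) x l = - g x"
    and F: "\<And>x. g x * f (- x) = (x + s) * (x + 2 * s)"
    and Q_1: "\<And>k x l. k \<noteq> 0 \<Longrightarrow> k \<noteq> -1 \<Longrightarrow> Q 1 k x l = cl2 s 1 k x l"
    and Q_m1: "\<And>k x l. k \<ge> 2 \<Longrightarrow> Q k (-1) x l = cl2 s k (-1) x l"
    and i: "i \<ge> 1"
  shows "(\<forall>k x l. k \<noteq> 0 \<longrightarrow> k \<noteq> - i \<longrightarrow> Q i k x l = cl2 s i k x l) \<and> (\<forall>x l. Q i (- i) x l = - of_int i * g x)"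
  using i
proof (induction i rule: int_ge_induct)
  case base
  show ?case using Q_1 Q_1_m1 by simp
next
  case (step i)
  have IH1: "Q i k x l = cl2 s i k x l" if "k \<noteq> 0" "k \<noteq> - i" for k x l using step.IH that by blast
  have IH2: "Q i (- i) x l = - of_int i * g x" for x l using step.IH by blast
  have i1: "complex_of_int i + 1 \<noteq> 0"
    using step.hyps of_int_eq_0_iff[of "i + 1", where 'a=complex] by simp
  have solve: "Q (i + 1) k x L = R x L"
    if "\<And>l m. Q i k (x + l) m * Q 1 (i + k) x l =
      cl2 s 1 i (- l - m) l * R x (l + m) + Q 1 k (x + m) l * Q i (1 + k) x m" for R k x L
  proof -
    (* The splitting of L into l and L - l for which the factor of the unknown entry equals 1. *)
    define l where "l = (1 + L - s * of_int (1 - i)) / (of_int i + 1)"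
    have "(of_int i + 1) * l = 1 + L - s * of_int (1 - i)" using i1 by (simp add: l_def)
    then have one: "cl2 s 1 i (- l - (L - l)) l = 1" by (simp add: cl2_def algebra_simps)
    have "cl2 s 1 i (- l - (L - l)) l * R x (l + (L - l)) = Q 1 i (- l - (L - l)) l * Q (1 + i) k x (l + (L - l))"
      using that[of l "L - l"] jac[of i k x l "L - l" 1] by simp
    moreover have "Q 1 i (- l - (L - l)) l = cl2 s 1 i (- l - (L - l)) l" using Q_1[of i] step.hyps by simp
    ultimately show ?thesis unfolding one by (simp add: add.commute)
  qed
  have "Q (i + 1) k x L = cl2 s (i + 1) k x L" if k: "k \<noteq> 0" "k \<noteq> - (i + 1)" for k x L
  proof (cases "k = -1")
    case True
    then show ?thesis using Q_m1[of "i + 1"] step.hyps by simp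
  next
    case False
    show ?thesis
    proof (rule solve)
      fix l m
      have "Q i k (x + l) m * Q 1 (i + k) x l = cl2 s i k (x + l) m * cl2 s 1 (i + k) x l"
      proof (cases "k = - i")
        case True
        have "Q i k (x + l) m * Q 1 (i + k) x l = of_int i * (g (x + l) * f (- (x + l)))"
          using Q_0[of 1 x l] by (simp add: True IH2 algebra_simps)
        also have "\<dots> = cl2 s i k (x + l) m * cl2 s 1 (i + k) x l"
          unfolding F by (simp add: cl2_def True algebra_simps)
        finally show ?thesis .
      next
        case False
        then show ?thesis using IH1[OF k(1) False] Q_1[of "i + k"] k by (simp add: algebra_simps)
      qed
      moreover have "Q 1 k (x + m) l = cl2 s 1 k (x + m) l" using Q_1 k(1) False by simp
      moreover have "Q i (1 + k) x m = cl2 s i (1 + k) x m" using IH1[of "1 + k"] k(2) False by auto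
      ultimately show "Q i k (x + l) m * Q 1 (i + k) x l =
          cl2 s 1 i (- l - m) l * cl2 s (i + 1) k x (l + m) + Q 1 k (x + m) l * Q i (1 + k) x m"
        using cl2_jacobi[of s i k x l m 1] by (simp add: add.commute)
    qed
  qed
  moreover have "Q (i + 1) (- (i + 1)) x L = - of_int (i + 1) * g x" for x L
  proof (rule solve[where R="\<lambda>x L. - of_int (i + 1) * g x"])
    fix l m
    have 1: "Q i (- (i + 1)) (x + l) m = cl2 s i (- (i + 1)) (x + l) m"
      "Q 1 (- (i + 1)) (x + m) l = cl2 s 1 (- (i + 1)) (x + m) l"
      using IH1[of "- (i + 1)"] Q_1[of "- (i + 1)"] step.hyps by auto
    have 2: "cl2 s i (- (i + 1)) (x + l) m =
        of_int (i + 1) * cl2 s 1 i (- l - m) l + of_int i * cl2 s 1 (- (i + 1)) (x + m) l"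
      by (simp add: cl2_def algebra_simps)
    show "Q i (- (i + 1)) (x + l) m * Q 1 (i + - (i + 1)) x l =
      cl2 s 1 i (- l - m) l * (- of_int (i + 1) * g x) + Q 1 (- (i + 1)) (x + m) l * Q i (1 + - (i + 1)) x m"
      unfolding 1 2 using Q_1_m1 IH2 by (simp add: algebra_simps)
  qed
  ultimately show ?case by blast
qed

context structure_system begin

interpretation fl: structure_system "\<lambda>i j. - p (- i) (- j)" "{i. - i \<in> S}" by (rule flip)

lemma flip_f: "fl.f = f"
proof (rule poly_eq_poly_eq_iff[THEN iffD1], rule ext)
  show "poly fl.f x = poly f x" for x
    unfolding fl.poly_f fl.phi_def using phi_m1[of x] by (simp add: poly_f phi_def)
qed

lemma flip_g: "fl.g = g"
proof (rule poly_eq_poly_eq_iff[THEN iffD1], rule ext)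
  show "poly fl.g x = poly g x" for x
    using fl.p_m1_1_val[of x 0] p_1_m1_val[of x 0] by simp
qed

lemma flip_params: "fl.\<alpha> = \<alpha>" "fl.\<beta> = \<beta>" "fl.\<gamma> = \<gamma>" "fl.s = s"
proof -
  have "[:fl.\<gamma>, fl.\<beta>, fl.\<alpha>:] = [:\<gamma>, \<beta>, \<alpha>:]"
    using fl.F_poly F_poly unfolding flip_f flip_g by simp
  then show "fl.\<alpha> = \<alpha>" "fl.\<beta> = \<beta>" "fl.\<gamma> = \<gamma>" by auto
  then show "fl.s = s" by (simp add: fl.s_def s_def)
qed

text \<open>
  The row of \<open>L\<^sub>1\<close> consists of constants except for \<open>P\<^sub>1\<^sub>1\<close>. Constants cancel from the identity
  for \<open>1,1,k\<close>, so that \<open>P\<^sub>1\<^sub>1\<close> times \<open>P\<^sub>2\<^sub>k\<close> is zero, and the vanishing spreads from row to row. The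
  exceptional column \<open>k = -2\<close>, whose neighbour \<open>k + 1 = -1\<close> lies outside the claim, is covered by
  \<open>P\<^sub>1\<^sub>,\<^sub>-\<^sub>2 = 0\<close>.
\<close>

lemma far_zero_positive:
  assumes z: "\<alpha> = 0" "\<beta> = 0" and i: "i \<ge> 2"
  shows "\<forall>k x l. \<bar>k\<bar> \<ge> 2 \<longrightarrow> P i k x l = 0"
proof (cases "p 1 1 = 0")
  case True
  then have "p i k = 0" for k using p_1_1_zero(1)[OF True i] supp[of i k] by blast
  then show ?thesis by simp
next
  case nz: False
  have zf: "fl.\<alpha> = 0" "fl.\<beta> = 0" using z by (simp_all add: flip_params)
  have const: "P 1 k x l = P 1 k 0 0" if "\<bar>k\<bar> \<ge> 2" for k x l
  proof (cases "k \<ge> 2")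
    case True
    then show ?thesis using const_positive(1)[OF z] by simp
  next
    case False
    then have "- k \<ge> 2" using that by linarith
    then have "- P 1 k x l = fl.B (- k)" for x l using fl.const_positive(2)[OF zf, of "- k" x l] by simp
    then have "- P 1 k x l = - P 1 k 0 0" by metis
    then show ?thesis by simp
  qed
  have m2: "P 1 (-2) x l = 0" for x l
    using fl.const_positive(2)[OF zf, of 2 x l] fl.const_positive(3)[OF zf] by simp
  have m1: "P 1 (-1) x l = - poly g 0" for x l
  proof -
    have "degree g = 0" using degree_sum z by simp
    then have "poly g x = poly g 0" by (metis degree_eq_zeroE poly_const_conv)
    then show ?thesis by (simp add: p_1_m1_val)
  qed
  show ?thesis using i
  proof (induction i rule: int_ge_induct)
    case base
    show ?case
    proof (intro allI impI)
      fix k :: int and x L :: complex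
      assume k: "\<bar>k::int\<bar> \<ge> 2"
      (* Chosen so that - L + 2 l = 1, which reduces the factor to the nonzero constant C 1. *)
      define l where "l = (1 + L) / 2"
      have "P 1 (1 + k) x l = P 1 (1 + k) 0 0" for x l
      proof (cases "k = -2")
        case True
        then show ?thesis using m1[of x l] m1[of 0 0] by simp
      next
        case False
        then have "\<bar>1 + k\<bar> \<ge> 2" using k by (cases "k \<ge> 2") auto
        then show ?thesis by (rule const)
      qed
      then have "P 1 k (x + l) m * P 1 (1 + k) x l = P 1 k (x + m) l * P 1 (1 + k) x m" for l m
        using const[OF k] by metis
      then have "P 1 1 (- l - (L - l)) l * P 2 k x L = 0"
        using jacobi[where i=1 and j=1 and k=k and x=x and l=l and m="L - l"] by simp
      moreover have "P 1 1 (- l - (L - l)) l = C 1"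
        using p_1[of 1 "-L" l] D_1 by (simp add: l_def add_divide_distrib)
      ultimately show "P 2 k x L = 0" using coeffs_zero[of 1] D_1 nz by simp
    qed
  next
    case (step i)
    show ?case
    proof (intro allI impI)
      fix k :: int and x L :: complex
      assume k: "\<bar>k::int\<bar> \<ge> 2"
      have 0: "P i k x l = 0" for x l using step.IH k by blast
      have "P 1 k (x + L) 0 = 0 \<or> P i (1 + k) x L = 0"
        using step.IH m2 k by (cases "k = -2") auto
      then have "P 1 i (- L) 0 * P (i + 1) k x L = 0"
        using jacobi[where i=1 and j=i and k=k and x=x and l=0 and m=L] 0 by (auto simp: add.commute[of 1 i])
      moreover have "P 1 i (- L) 0 \<noteq> 0"
        using const_positive(1)[OF z, of i] const_positive(4)[OF z nz, of i] step.hyps by simp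
      ultimately show "P (i + 1) k x L = 0" by simp
    qed
  qed
qed

end

context structure_system begin

interpretation fl: structure_system "\<lambda>i j. - p (- i) (- j)" "{i. - i \<in> S}" by (rule flip)

lemma far_zero:
  assumes z: "\<alpha> = 0" "\<beta> = 0" and "\<bar>i\<bar> \<ge> 2" "\<bar>k\<bar> \<ge> 2"
  shows "P i k x l = 0"
proof (cases "i \<ge> 2")
  case True
  then show ?thesis using far_zero_positive[OF z True] assms(4) by blast
next
  case False
  then have "- i \<ge> 2" using assms(3) by linarith
  moreover have "\<bar>- k\<bar> \<ge> 2" using assms(4) by simp
  moreover have "fl.\<alpha> = 0" "fl.\<beta> = 0" using z by (simp_all add: flip_params)
  ultimately have "peval (- p (- (- i)) (- (- k))) x l = 0" using fl.far_zero_positive[of "- i"] by blast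
  then show ?thesis by simp
qed

end

section \<open>Normal form when F has degree two\<close>

lemma cl2_skew: "cl2 s i j x l = - cl2 s j i x (- l - x)"
  by (simp add: cl2_def algebra_simps)

lemma cl2_flip: "cl2 s (- i) (- j) x l = - cl2 s i j x l"
  by (simp add: cl2_def algebra_simps)

context structure_system begin

interpretation fl: structure_system "\<lambda>i j. - p (- i) (- j)" "{i. - i \<in> S}" by (rule flip)

text \<open>
  The two halves are scaled separately, with the scaling factors \<open>1\<close> at \<open>L\<^sub>1\<close> and \<open>\<alpha>\<close> at \<open>L\<^sub>-\<^sub>1\<close>, after which
  \<open>F\<close> becomes \<open>(x + s) (x + 2s)\<close> and \<open>CL_determined\<close> applies to the positive rows and, through the
  flip, to the negative ones. The brackets with \<open>L\<^sub>0\<close> are left as they are, because \<open>f\<close> is still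
  arbitrary.
\<close>

lemma CL_scaling:
  assumes a: "\<alpha> \<noteq> 0"
  obtains c where "S = UNIV" "c 0 = 1" "\<And>i. c i \<noteq> 0"
    "\<And>i j x l. i \<noteq> 0 \<Longrightarrow> j \<noteq> 0 \<Longrightarrow> i + j \<noteq> 0 \<Longrightarrow> P i j x l * c (i + j) = c i * c j * cl2 s i j x l"
    "\<And>i x l. P i (- i) x l = c i * c (- i) * (- of_int i * (poly g x / \<alpha>))"
proof -
  have fa: "fl.\<alpha> \<noteq> 0" using a by (simp add: flip_params)
  obtain u where u: "u 1 = 1" "\<And>k. k \<ge> 1 \<Longrightarrow> u k \<noteq> 0"
    "\<And>k x l. k \<ge> 1 \<Longrightarrow> P 1 k x l * u (k + 1) = u k * (x + of_int (k + 1) * l + s * of_int (1 - k))"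
    "\<And>k x l. k \<ge> 2 \<Longrightarrow> P (-1) k x l * u (k - 1) = \<alpha> * u k * (- x + of_int (k - 1) * l + s * of_int (-1 - k))"
    by (rule CL_positive_scaling[OF a]) blast
  obtain v where v: "v 1 = 1" "\<And>k. k \<ge> 1 \<Longrightarrow> v k \<noteq> 0"
    "\<And>k x l. k \<ge> 1 \<Longrightarrow> - P (-1) (-k) x l * v (k + 1) = v k * (x + of_int (k + 1) * l + s * of_int (1 - k))"
    "\<And>k x l. k \<ge> 2 \<Longrightarrow> - P 1 (-k) x l * v (k - 1) = \<alpha> * v k * (- x + of_int (k - 1) * l + s * of_int (-1 - k))"
    using fl.CL_positive_scaling[OF fa] unfolding flip_params by auto
  have nz: "p 1 1 \<noteq> 0" "- p (- 1) (- 1) \<noteq> 0" 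
    using p_1_1_zero(2) fl.p_1_1_zero(2) a fa by blast+
  have S: "i \<in> S" for i
  proof -
    consider "i \<ge> 1" | "i = 0" | "- i \<ge> 1" by linarith
    then show ?thesis
      by cases (use all_positive[OF nz(1), of i] fl.all_positive[OF nz(2), of "-i"] units_in_S in auto)
  qed
  (* The powers of \<alpha> absorb the factor \<alpha> in the rows of u and v, one for each step away from 0. *)
  define c where "c i = (if i > 0 then u i else if i = 0 then 1 else \<alpha> ^ nat (- i) * v (- i))" for i
  have c: "c i \<noteq> 0" for i using u(2) v(2) a by (simp add: c_def)
  have c0: "c 0 = 1" and c1: "c 1 = 1" and cm1: "c (-1) = \<alpha>" using u(1) v(1) by (simp_all add: c_def)
  have cneg: "c (- k) = \<alpha> ^ nat k * v k" if "k \<ge> 1" for k using that by (simp add: c_def)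
  have pow: "\<alpha> ^ nat (k + 1) = \<alpha> * \<alpha> ^ nat k" if "k \<ge> 0" for k using that by (simp add: nat_add_distrib)
  define Q where "Q i j x l = P i j x l * c (i + j) / (c i * c j)" for i j x l
  have Q_of: "Q i j x l = y" if "P i j x l * c (i + j) = c i * c j * y" for i j x l y
    using that c by (simp add: Q_def)
  have Q_jac: "Q j k (x + l) m * Q i (j + k) x l =
      Q i j (- l - m) l * Q (i + j) k x (l + m) + Q i k (x + m) l * Q j (i + k) x m" for i j k x l m
  proof -
    define w where "w = c (i + j + k) / (c i * c j * c k)"
    have "Q j k (x + l) m * Q i (j + k) x l = (P j k (x + l) m * P i (j + k) x l) * w"
      using c by (simp add: Q_def w_def field_simps add.assoc)
    moreover have "Q i j (- l - m) l * Q (i + j) k x (l + m) = (P i j (- l - m) l * P (i + j) k x (l + m)) * w"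
      using c by (simp add: Q_def w_def field_simps)
    moreover have "Q i k (x + m) l * Q j (i + k) x m = (P i k (x + m) l * P j (i + k) x m) * w"
      using c by (simp add: Q_def w_def field_simps add.left_commute[of j i k] add.assoc)
    ultimately show ?thesis using jacobi[where i=i and j=j and k=k and x=x and l=l and m=m]
      by (simp add: algebra_simps)
  qed
  have Q_skew: "Q i j x l = - Q j i x (- l - x)" for i j x l
    using skew[of i j x l] by (simp add: Q_def add.commute mult.commute)
  have Q_0: "Q k 0 x l = - of_int k * poly f (- l - x)" for k x l
    using c S by (simp add: Q_def p_val_0 c0)
  define h where "h x = poly g x / \<alpha>" for x
  have F: "h x * poly f (- x) = (x + s) * (x + 2 * s)" for x
    using F_factored[OF a, of x] a by (simp add: h_def)
  have Q_1_m1: "Q 1 (-1) x l = - h x" "Q (-1) 1 x l = h x" for x l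
    by (simp_all add: Q_def p_1_m1_val p_m1_1_val c0 c1 cm1 h_def)
  have Q_1: "Q 1 k x l = cl2 s 1 k x l" if k: "k \<noteq> 0" "k \<noteq> -1" for k x l
  proof (rule Q_of, cases "k \<ge> 1")
    case True
    then show "P 1 k x l * c (1 + k) = c 1 * c k * cl2 s 1 k x l"
      using u(3)[OF True, of x l] by (simp add: c_def cl2_def u(1) add.commute)
  next
    case False
    then have k2: "- k \<ge> 2" using k by linarith
    define n where "n = - k - 1"
    have n: "k = - (n + 1)" "n \<ge> 1" using k2 by (auto simp: n_def)
    have E: "cl2 s 1 k x l = - (- x + of_int n * l + s * of_int (- 2 - n))"
      unfolding n(1) by (simp add: cl2_def algebra_simps)
    have "- (P 1 k x l * v n) = \<alpha> * v (n + 1) * (- x + of_int n * l + s * of_int (- 2 - n))"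
      using v(4)[of "n + 1" x l] n(2) unfolding n(1)[symmetric] by simp
    then have "P 1 k x l * v n = \<alpha> * v (n + 1) * cl2 s 1 k x l"
      unfolding E by (metis add.inverse_inverse mult_minus_right)
    then have "\<alpha> ^ nat n * (P 1 k x l * v n) = \<alpha> ^ nat n * (\<alpha> * v (n + 1) * cl2 s 1 k x l)" by simp
    then have "P 1 k x l * (\<alpha> ^ nat n * v n) = (\<alpha> ^ nat (n + 1) * v (n + 1)) * cl2 s 1 k x l"
      using pow[of n] n(2) by (simp add: mult_ac)
    then show "P 1 k x l * c (1 + k) = c 1 * c k * cl2 s 1 k x l"
      using cneg[of n] cneg[of "n + 1"] n c1 by simp
  qed
  have Q_m1: "Q (-1) k x l = cl2 s (-1) k x l" if k: "k \<noteq> 0" "k \<noteq> 1" for k x l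
  proof (rule Q_of, cases "k \<ge> 2")
    case True
    then show "P (-1) k x l * c (-1 + k) = c (-1) * c k * cl2 s (-1) k x l"
      using u(4)[OF True, of x l] unfolding cm1 by (simp add: c_def cl2_def)
  next
    case False
    define n where "n = - k"
    have n: "k = - n" "n \<ge> 1" using k False by (auto simp: n_def)
    have E: "cl2 s (-1) k x l = - (x + of_int (n + 1) * l + s * of_int (1 - n))"
      unfolding n(1) by (simp add: cl2_def algebra_simps)
    have "- (P (-1) k x l * v (n + 1)) = v n * (x + of_int (n + 1) * l + s * of_int (1 - n))"
      using v(3)[OF n(2), of x l] unfolding n(1)[symmetric] by simp
    then have "P (-1) k x l * v (n + 1) = v n * cl2 s (-1) k x l"
      unfolding E by (metis add.inverse_inverse mult_minus_right)
    then have "\<alpha> * \<alpha> ^ nat n * (P (-1) k x l * v (n + 1)) = \<alpha> * \<alpha> ^ nat n * (v n * cl2 s (-1) k x l)" by simp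
    then have "P (-1) k x l * (\<alpha> ^ nat (n + 1) * v (n + 1)) = \<alpha> * (\<alpha> ^ nat n * v n) * cl2 s (-1) k x l"
      using pow[of n] n(2) by (simp add: mult_ac)
    then show "P (-1) k x l * c (-1 + k) = c (-1) * c k * cl2 s (-1) k x l"
    proof -
      have "c (-1 + k) = \<alpha> ^ nat (n + 1) * v (n + 1)"
        using cneg[of "n + 1"] n by (metis ab_group_add_class.ab_diff_conv_add_uminus add.commute minus_add_distrib add_increasing2 zero_le_one)
      moreover have "c k = \<alpha> ^ nat n * v n" using cneg[of n] n by simp
      ultimately show ?thesis using cm1 \<open>P (-1) k x l * (\<alpha> ^ nat (n + 1) * v (n + 1)) = _\<close> by simp
    qed
  qed
  have pos: "(\<forall>k x l. k \<noteq> 0 \<longrightarrow> k \<noteq> - i \<longrightarrow> Q i k x l = cl2 s i k x l) \<and> (\<forall>x l. Q i (- i) x l = - of_int i * h x)"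
    if "i \<ge> 1" for i
  proof (rule CL_determined[OF Q_jac Q_0 Q_1_m1(1) F _ _ that])
    show "k \<noteq> 0 \<Longrightarrow> k \<noteq> - 1 \<Longrightarrow> Q 1 k x l = cl2 s 1 k x l" for k x l by (rule Q_1)
    show "2 \<le> k \<Longrightarrow> Q k (- 1) x l = cl2 s k (- 1) x l" for k x l
      using Q_skew[of k "-1" x l] Q_m1[of k] cl2_skew[of s k "-1" x l] by simp
  qed
  have neg: "(\<forall>k x l. k \<noteq> 0 \<longrightarrow> k \<noteq> - i \<longrightarrow> - Q (- i) (- k) x l = cl2 s i k x l) \<and> (\<forall>x l. - Q (- i) (- (- i)) x l = - of_int i * h x)"
    if "i \<ge> 1" for i
  proof (rule CL_determined[where Q="\<lambda>i j x l. - Q (- i) (- j) x l" and f="poly f", OF _ _ _ F _ _ that])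
    fix i j k x l m
    show "- Q (- j) (- k) (x + l) m * - Q (- i) (- (j + k)) x l =
      - Q (- i) (- j) (- l - m) l * - Q (- (i + j)) (- k) x (l + m) + - Q (- i) (- k) (x + m) l * - Q (- j) (- (i + k)) x m"
      using Q_jac[of "- j" "- k" x l m "- i"] by simp
  next
    show "- Q (- k) (- 0) x l = - complex_of_int k * poly f (- l - x)" for k x l using Q_0[of "- k" x l] by simp
    show "- Q (- 1) (- (- 1)) x l = - h x" for x l using Q_1_m1 by simp
    show "k \<noteq> 0 \<Longrightarrow> k \<noteq> - 1 \<Longrightarrow> - Q (- 1) (- k) x l = cl2 s 1 k x l" for k x l
      using Q_m1[of "- k" x l] cl2_flip[of s 1 k x l] by simp
    show "2 \<le> k \<Longrightarrow> - Q (- k) (- (- 1)) x l = cl2 s k (- 1) x l" for k x l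
      using Q_skew[of "- k" 1 x l] Q_1[of "- k"] cl2_skew[of s k "-1" x l] cl2_flip[of s 1 "-k"] cl2_flip[of s "-1" k] by simp
  qed
  have all: "Q i j x l = cl2 s i j x l" if "i \<noteq> 0" "j \<noteq> 0" "i + j \<noteq> 0" for i j x l
  proof (cases "i \<ge> 1")
    case True
    then show ?thesis using pos[of i] that by (metis add.right_inverse)
  next
    case False
    then have "- Q (- (- i)) (- (- j)) x l = cl2 s (- i) (- j) x l"
      using neg[of "- i"] that by (metis add.inverse_inverse add.right_inverse int_one_le_iff_zero_less linorder_not_le neg_0_less_iff_less not_less_iff_gr_or_eq neg_equal_0_iff_equal)
    then show ?thesis using cl2_flip[of s i j x l] by simp
  qed
  have anti: "Q i (- i) x l = - of_int i * h x" for i x l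
  proof -
    consider "i \<ge> 1" | "i = 0" | "- i \<ge> 1" by linarith
    then show ?thesis
    proof cases
      case 3
      then have "- Q (- (- i)) (- (- (- i))) x l = - of_int (- i) * h x" using neg[of "- i"] by blast
      then have "- Q i (- i) x l = of_int i * h x" by simp
      then show ?thesis by (metis add.inverse_inverse mult_minus_left)
    qed (use pos[of i] Q_0[of 0] in auto)
  qed
  show ?thesis
  proof (rule that[of c])
    show "S = UNIV" using S by blast
    show "P i j x l * c (i + j) = c i * c j * cl2 s i j x l" if "i \<noteq> 0" "j \<noteq> 0" "i + j \<noteq> 0" for i j x l
      using all[OF that, of x l] c by (simp add: Q_def field_simps)
    show "P i (- i) x l = c i * c (- i) * (- of_int i * (poly g x / \<alpha>))" for i x l
      using anti[of i x l] c by (simp add: Q_def c0 h_def field_simps)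
  qed (use c c0 in auto)
qed

end

section \<open>Normal form when F is constant\<close>

lemma peval_skew_completion_skew:
  assumes "\<And>q q'. Q i j = Some q \<Longrightarrow> Q j i = Some q' \<Longrightarrow> peval q x l = - peval q' x (- l - x)"
  shows "peval (skew_completion Q i j) x l = - peval (skew_completion Q j i) x (- l - x)"
  using assms by (auto simp: skew_completion_def minus_diff_commute split: option.splits)

abbreviation "m1 \<equiv> skew_completion M1_table"
abbreviation "m2 \<equiv> skew_completion M2_table"

lemma m1_skew: "peval (m1 i j) x l = - peval (m1 j i) x (- l - x)"
  by (rule peval_skew_completion_skew) (auto simp: M1_table_def split: if_splits)

lemma m2_skew: "peval (m2 i j) x l = - peval (m2 j i) x (- l - x)"
  by (rule peval_skew_completion_skew) (auto simp: M2_table_def split: if_splits)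

lemma m1_far: "\<bar>i\<bar> \<ge> 2 \<Longrightarrow> \<bar>j\<bar> \<ge> 2 \<Longrightarrow> m1 i j = 0"
  by (auto simp: skew_completion_def M1_table_def)

lemma m2_far: "\<bar>i\<bar> \<ge> 2 \<Longrightarrow> \<bar>j\<bar> \<ge> 2 \<Longrightarrow> m2 i j = 0"
  by (auto simp: skew_completion_def M2_table_def)

lemma m_nonneg:
  assumes "j \<ge> 1" "T = m1 \<or> T = m2"
  shows "peval (T 0 j) x l = - of_int j" "peval (T 1 1) x l = x + 2 * l"
    "j \<ge> 2 \<Longrightarrow> peval (T 1 j) x l = 1"
    "peval (T (-1) j) x l = of_int ((j + 1) * (j - 2)) / 2"
    "peval (T 0 0) x l = 0" "peval (T 0 (-1)) x l = 1"
    "peval (T 1 0) x l = 1" "peval (T 1 (-1)) x l = 1" "peval (T (-1) 0) x l = -1"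
  using assms by (auto simp: skew_completion_def M1_table_def M2_table_def)

lemma m2_neg:
  assumes "j \<ge> 2"
  shows "peval (m2 0 (-j)) x l = of_int j" "peval (m2 (-1) (-1)) x l = x + 2 * l"
    "peval (m2 (-1) (-j)) x l = 1" "peval (m2 1 (-j)) x l = of_int ((j + 1) * (j - 2)) / 2"
  using assms by (auto simp: skew_completion_def M2_table_def algebra_simps)

lemma m1_neg:
  assumes "j \<ge> 2"
  shows "m1 i (-j) = 0" "m1 (-1) (-1) = 0"
  using assms by (auto simp: skew_completion_def M1_table_def)

lemma neg_mult_eq: "- a * b = y \<Longrightarrow> a * b = - y" for a b y :: complex
  by auto

context structure_system begin

interpretation fl: structure_system "\<lambda>i j. - p (- i) (- j)" "{i. - i \<in> S}" by (rule flip)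

lemma constants:
  assumes "\<alpha> = 0" "\<beta> = 0"
  shows "poly f x = poly f 0" "poly g x = poly g 0" "poly f 0 \<noteq> 0" "poly g 0 \<noteq> 0"
proof -
  have "degree g = 0" "degree f = 0" using degree_sum assms by simp_all
  then show "poly f x = poly f 0" "poly g x = poly g 0" by (metis degree_eq_zeroE poly_const_conv)+
  have "\<gamma> \<noteq> 0" using F_nonzero assms by auto
  then show "poly f 0 \<noteq> 0" "poly g 0 \<noteq> 0" by (auto simp: \<gamma>_def)
qed

text \<open>
  The rows of degree \<open>-1\<close>, \<open>0\<close> and \<open>1\<close> give the corresponding columns by skew-symmetry, and \<open>far_zero\<close>
  disposes of the rest.
\<close>

lemma rows_determine:
  assumes z: "\<alpha> = 0" "\<beta> = 0"
    and skewT: "\<And>i j x l. peval (T i j) x l = - peval (T j i) x (- l - x)"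
    and far: "\<And>i j. \<bar>i\<bar> \<ge> 2 \<Longrightarrow> \<bar>j\<bar> \<ge> 2 \<Longrightarrow> T i j = 0"
    and rows: "\<And>i j x l. i = 0 \<or> i = 1 \<or> i = -1 \<Longrightarrow> P i j x l * c (i + j) = c i * c j * peval (T i j) x l"
  shows "P i j x l * c (i + j) = c i * c j * peval (T i j) x l"
proof -
  consider "i = 0 \<or> i = 1 \<or> i = -1" | "j = 0 \<or> j = 1 \<or> j = -1" | "\<bar>i\<bar> \<ge> 2" "\<bar>j\<bar> \<ge> 2" by linarith
  then show ?thesis
  proof cases
    case 1
    then show ?thesis by (rule rows)
  next
    case 2
    show ?thesis using rows[OF 2, of i x "- l - x"] skew[of i j x l] skewT[of i j x l]
      by (simp add: add.commute mult.commute)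
  next
    case 3
    then show ?thesis using far[OF 3] far_zero[OF z 3] by simp
  qed
qed

text \<open>
  \<open>M(1)\<close> and \<open>M(2)\<close> agree in these entries, so one computation serves both. The factors at degrees
  \<open>0\<close> and \<open>-1\<close> are forced by \<open>P\<^sub>0\<^sub>1 = f(0)\<close> and \<open>P\<^sub>-\<^sub>1\<^sub>,\<^sub>1 = g(0)\<close>, which the tables normalise to \<open>-1\<close>.
\<close>

lemma M_rows_nonneg:
  assumes z: "\<alpha> = 0" "\<beta> = 0" and nz: "p 1 1 \<noteq> 0"
    and T: "T = m1 \<or> T = m2"
    and c: "c 1 = 1" "c 0 = - poly f 0" "c (-1) = \<gamma>"
      "\<And>x l. P 1 1 x l * c 2 = x + 2 * l"
      "\<And>k x l. k \<ge> 2 \<Longrightarrow> P 1 k x l * c (k + 1) = c k"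
      "\<And>k x l. k \<ge> 2 \<Longrightarrow> P (-1) k x l * c (k - 1) = \<gamma> * c k * of_int ((k + 1) * (k - 2)) / 2"
    and i: "i = 0 \<or> i = 1 \<or> i = -1" and j: "j \<ge> -1" "\<not> (i = -1 \<and> j = -1)"
  shows "P i j x l * c (i + j) = c i * c j * peval (T i j) x l"
proof -
  note const = constants[OF z]
  note S = all_positive[OF nz]
  note T1 = m_nonneg[OF _ T]
  have \<gamma>: "\<gamma> = poly f 0 * poly g 0" by (simp add: \<gamma>_def)
  consider "j \<ge> 2" | "j = 1" | "j = 0" | "j = -1" using j by linarith
  then show ?thesis
  proof cases
    case 1
    show ?thesis
    proof (cases "i = -1")
      case True
      have "P (-1) j x l * c (j - 1) = \<gamma> * c j * (of_int ((j + 1) * (j - 2)) / 2)"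
        using c(6)[OF 1, of x l] by simp
      also have "of_int ((j + 1) * (j - 2)) / 2 = peval (T (-1) j) x l"
        using T1(4)[of j x l] 1 by simp
      finally show ?thesis using True c(3) by simp
    next
      case False
      then show ?thesis using 1 i c(1-3) c(5)[OF 1, of x l] T1(1,3)[of j] S[of j]
        by (auto simp: p_0_val const(1)[of l] add.commute[of 1 j])
    qed
  next
    case 2
    then show ?thesis using i c T1[of 1] units_in_S
      by (auto simp: p_0_val const(1)[of l] const(2)[of x] p_m1_1_val \<gamma>)
  next
    case 3
    then show ?thesis using i c T1[of 1] units_in_S
      by (auto simp: p_val_0 p_0_val const(1)[of "- l - x"] \<gamma>)
  next
    case 4
    then show ?thesis using i j c T1[of 1] units_in_S
      by (auto simp: p_0_val p_1_m1_val const(1)[of l] const(2)[of x] \<gamma>)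
  qed
qed

text \<open>
  In degrees below \<open>-1\<close> both the algebra and the table are zero, and the factors there are
  arbitrary.
\<close>

lemma M1_scaling:
  assumes z: "\<alpha> = 0" "\<beta> = 0" and nz: "p 1 1 \<noteq> 0" "p (-1) (-1) = 0"
  obtains c where "S = {-1..}" "\<And>i. c i \<noteq> 0"
    "\<And>i j x l. P i j x l * c (i + j) = c i * c j * peval (m1 i j) x l"
proof -
  obtain u where u: "u 1 = 1" "\<And>k. k \<ge> 1 \<Longrightarrow> u k \<noteq> 0"
    "\<And>x l. P 1 1 x l * u 2 = x + 2 * l"
    "\<And>k x l. k \<ge> 2 \<Longrightarrow> P 1 k x l * u (k + 1) = u k"
    "\<And>k x l. k \<ge> 2 \<Longrightarrow> P (-1) k x l * u (k - 1) = \<gamma> * u k * of_int ((k + 1) * (k - 2)) / 2"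
    by (rule M_positive_scaling[OF z nz(1)]) blast
  have "\<gamma> \<noteq> 0" using F_nonzero z by auto
  have notS: "k \<notin> S" if "k \<le> -2" for k
    using fl.p_1_1_zero(1)[of "- k"] nz(2) that by simp
  have "k \<in> S \<longleftrightarrow> k \<ge> -1" for k
  proof -
    consider "k \<ge> 1" | "k = 0 \<or> k = -1" | "k \<le> -2" by linarith
    then show ?thesis
      by cases (use all_positive[OF nz(1), of k] units_in_S notS[of k] in auto)
  qed
  then have S: "S = {-1..}" by auto
  define c where "c i = (if i \<ge> 1 then u i else if i = 0 then - poly f 0 else if i = -1 then \<gamma> else 1)" for i
  have c: "c i \<noteq> 0" for i using u(2) constants(3)[OF z] \<open>\<gamma> \<noteq> 0\<close> by (simp add: c_def)
  show ?thesis
  proof (rule that[OF S c], rule rows_determine[OF z m1_skew m1_far])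
    fix i j :: int and x l
    assume i: "i = 0 \<or> i = 1 \<or> i = -1"
    show "P i j x l * c (i + j) = c i * c j * peval (m1 i j) x l"
    proof (cases "j \<le> -2 \<or> (i = -1 \<and> j = -1)")
      case True
      then have "p i j = 0" using supp[of i j] notS[of j] nz(2) by (cases "j \<le> -2") auto
      moreover have "m1 i j = 0" using True m1_neg(1)[of "- j" i] m1_neg(2)[of 2] by auto
      ultimately show ?thesis by simp
    next
      case False
      show ?thesis
        by (rule M_rows_nonneg[OF z nz(1) _ _ _ _ _ _ _ i]) (use False u in \<open>auto simp: c_def\<close>)
    qed
  qed
qed

lemma M2_scaling:
  assumes z: "\<alpha> = 0" "\<beta> = 0" and nz: "p 1 1 \<noteq> 0" "p (-1) (-1) \<noteq> 0"
  obtains c where "S = UNIV" "\<And>i. c i \<noteq> 0"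
    "\<And>i j x l. P i j x l * c (i + j) = c i * c j * peval (m2 i j) x l"
proof -
  have nzf: "- p (- 1) (- 1) \<noteq> 0" using nz(2) by simp
  obtain u where u: "u 1 = 1" "\<And>k. k \<ge> 1 \<Longrightarrow> u k \<noteq> 0"
    "\<And>x l. P 1 1 x l * u 2 = x + 2 * l"
    "\<And>k x l. k \<ge> 2 \<Longrightarrow> P 1 k x l * u (k + 1) = u k"
    "\<And>k x l. k \<ge> 2 \<Longrightarrow> P (-1) k x l * u (k - 1) = \<gamma> * u k * of_int ((k + 1) * (k - 2)) / 2"
    by (rule M_positive_scaling[OF z nz(1)]) blast
  obtain v where v: "v 1 = 1" "\<And>k. k \<ge> 1 \<Longrightarrow> v k \<noteq> 0"
    "\<And>x l. - P (-1) (-1) x l * v 2 = x + 2 * l"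
    "\<And>k x l. k \<ge> 2 \<Longrightarrow> - P (-1) (-k) x l * v (k + 1) = v k"
    "\<And>k x l. k \<ge> 2 \<Longrightarrow> - P 1 (-k) x l * v (k - 1) = \<gamma> * v k * of_int ((k + 1) * (k - 2)) / 2"
    using fl.M_positive_scaling[unfolded flip_params, OF z nzf] by auto
  have \<gamma>0: "\<gamma> \<noteq> 0" using F_nonzero z by auto
  have S: "k \<in> S" for k
  proof -
    consider "k \<ge> 1" | "k = 0" | "- k \<ge> 1" by linarith
    then show ?thesis
      by cases (use all_positive[OF nz(1), of k] units_in_S fl.all_positive[OF nzf, of "-k"] in auto)
  qed
  (* The solution of \<mu> (k + 1) = - \<gamma> \<mu> k with \<mu> 1 = \<gamma>: the sign comes from the flip, the factor from c (- 1) = \<gamma>. *)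
  define \<mu> where "\<mu> k = - ((- \<gamma>) ^ nat k)" for k
  have \<mu>: "\<mu> (k + 1) = - \<gamma> * \<mu> k" if "k \<ge> 0" for k using that by (simp add: \<mu>_def nat_add_distrib)
  have \<mu>1: "\<mu> 1 = \<gamma>" by (simp add: \<mu>_def)
  define c where "c i = (if i \<ge> 1 then u i else if i = 0 then - poly f 0 else \<mu> (- i) * v (- i))" for i
  have c: "c i \<noteq> 0" for i using u(2) v(2) constants(3)[OF z] \<gamma>0 by (simp add: c_def \<mu>_def)
  have cneg: "c (- k) = \<mu> k * v k" if "k \<ge> 1" for k using that by (simp add: c_def)
  have c1: "c 1 = 1" and cm1: "c (-1) = \<gamma>" using u(1) v(1) \<mu>1 by (simp_all add: c_def)
  show ?thesis
  proof (rule that[OF _ c], use S in blast, rule rows_determine[OF z m2_skew m2_far])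
    fix i j :: int and x l
    assume i: "i = 0 \<or> i = 1 \<or> i = -1"
    consider "i = -1" "j = -1" | "j \<ge> -1" "\<not> (i = -1 \<and> j = -1)" | "j \<le> -2" by linarith
    then show "P i j x l * c (i + j) = c i * c j * peval (m2 i j) x l"
    proof cases
      case 1
      have "P (-1) (-1) x l * (\<mu> 2 * v 2) = - \<mu> 2 * (x + 2 * l)"
        unfolding v(3)[of x l, symmetric] by simp
      moreover have "\<mu> 2 = - \<gamma> * \<gamma>" using \<mu>[of 1] \<mu>1 by simp
      ultimately show ?thesis
        using 1 cneg[of 1] cneg[of 2] m2_neg(2)[of 2] v(1) \<mu>1 by simp
    next
      case 2
      show ?thesis
        by (rule M_rows_nonneg[OF z nz(1) _ _ _ _ _ _ _ i]) (use 2 u v(1) \<mu>1 in \<open>auto simp: c_def\<close>)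
    next
      case 3
      define n where "n = - j"
      have n: "n \<ge> 2" and j: "j = - n" using 3 by (auto simp: n_def)
      have cj: "c j = \<mu> n * v n" using cneg[of n] n j by simp
      from i show ?thesis
      proof (elim disjE)
        assume "i = 0"
        then show ?thesis using S j m2_neg(1)[OF n] constants(1)[OF z, of l]
          by (simp add: p_0_val c_def mult_ac)
      next
        assume i: "i = 1"
        have "i + j = - (n - 1)" using i j by simp
        then have cij: "c (i + j) = \<mu> (n - 1) * v (n - 1)" using cneg[of "n - 1"] n by simp
        have "P 1 j x l * v (n - 1) = - (\<gamma> * v n * of_int ((n + 1) * (n - 2)) / 2)"
          unfolding j by (rule neg_mult_eq) (rule v(5)[OF n, of x l])
        then have "P i j x l * c (i + j) = \<mu> (n - 1) * (- (\<gamma> * v n * of_int ((n + 1) * (n - 2)) / 2))"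
          unfolding cij unfolding i mult.left_commute[of "P 1 j x l"] by (rule arg_cong)
        also have "\<dots> = (- \<gamma> * \<mu> (n - 1)) * v n * (of_int ((n + 1) * (n - 2)) / 2)" by simp
        also have "- \<gamma> * \<mu> (n - 1) = \<mu> n" using \<mu>[of "n - 1"] n by simp
        also have "\<mu> n * v n * (of_int ((n + 1) * (n - 2)) / 2) = c i * c j * peval (m2 i j) x l"
          unfolding cj unfolding i j m2_neg(4)[OF n] using c1 by simp
        finally show ?thesis .
      next
        assume i: "i = -1"
        have "i + j = - (n + 1)" using i j by simp
        then have cij: "c (i + j) = \<mu> (n + 1) * v (n + 1)" using cneg[of "n + 1"] n by simp
        have "P (-1) j x l * v (n + 1) = - v n"
          unfolding j by (rule neg_mult_eq) (rule v(4)[OF n, of x l])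
        then have "P i j x l * c (i + j) = \<mu> (n + 1) * (- v n)"
          unfolding cij unfolding i mult.left_commute[of "P (-1) j x l"] by (rule arg_cong)
        also have "\<dots> = \<gamma> * (\<mu> n * v n)" using \<mu>[of n] n by simp
        also have "\<dots> = c i * c j * peval (m2 i j) x l"
          unfolding cj unfolding i j m2_neg(3)[OF n] using cm1 by simp
        finally show ?thesis .
      qed
    qed
  qed
qed

lemma sl2_values:
  assumes nz: "p 1 1 = 0" "p (-1) (-1) = 0"
  shows "S = {-1, 0, 1}" "p i j = 0 \<or> i + j = 0 \<or> i = 0 \<or> j = 0"
proof -
  have "k \<notin> S" if "k \<ge> 2 \<or> - k \<ge> 2" for k
    using p_1_1_zero(1)[OF nz(1), of k] fl.p_1_1_zero(1)[of "- k"] nz(2) that by auto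
  then have "k \<in> S \<longleftrightarrow> k = -1 \<or> k = 0 \<or> k = 1" for k
    using units_in_S by (cases "k \<ge> 2 \<or> - k \<ge> 2") auto
  then show S: "S = {-1, 0, 1}" by auto
  show "p i j = 0 \<or> i + j = 0 \<or> i = 0 \<or> j = 0" using supp[of i j] nz unfolding S by auto
qed

end

section \<open>Isomorphisms determined by bases\<close>

lemma map_poly_add_hom:
  fixes h :: "'a::ab_group_add \<Rightarrow> 'b::ab_group_add"
  assumes "\<And>a b. h (a + b) = h a + h b"
  shows "map_poly h (f + g) = map_poly h f + map_poly h g"
proof -
  have "h 0 = 0" using assms[of 0 0] by simp
  then show ?thesis using assms by (intro poly_eqI) (simp add: coeff_map_poly)
qed

lemma subst_op_eq_sum:
  assumes "Modules.additive T" "\<iota> 0 = 0" "degree f \<le> N"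
  shows "subst_op T \<iota> f = (\<Sum>n\<le>N. (T ^^ n) (\<iota> (coeff f n)))"
proof -
  interpret Modules.additive T by fact
  have "(T ^^ n) 0 = 0" for n by (induction n) (simp_all add: zero)
  then show ?thesis unfolding subst_op_def using assms(2,3)
    by (intro sum.mono_neutral_left) (auto simp: coeff_eq_0)
qed

lemma subst_op_add:
  assumes T: "Modules.additive T" and \<iota>: "Modules.additive \<iota>"
  shows "subst_op T \<iota> (f + g) = subst_op T \<iota> f + subst_op T \<iota> (g :: 'a::ab_group_add poly)"
proof -
  interpret T: Modules.additive T by fact
  interpret \<iota>: Modules.additive \<iota> by fact
  have pow: "(T ^^ n) (a + b) = (T ^^ n) a + (T ^^ n) b" for n a b
    by (induction n) (simp_all add: T.add)
  define N where "N = max (degree f) (degree g)"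
  have "subst_op T \<iota> h = (\<Sum>n\<le>N. (T ^^ n) (\<iota> (coeff h n)))" if "degree h \<le> N" for h
    using T \<iota>.zero that by (rule subst_op_eq_sum)
  then show ?thesis
    using degree_add_le_max[of f g] by (simp add: N_def \<iota>.add pow sum.distrib)
qed

text \<open>
  Horner's rule. It turns statements about \<open>subst_op\<close>, whose summation range depends on the degree,
  into inductions on polynomials.
\<close>

lemma subst_op_pCons:
  assumes T: "Modules.additive T" and \<iota>: "\<iota> 0 = 0"
  shows "subst_op T \<iota> (pCons a f) = \<iota> a + T (subst_op T \<iota> f)"
proof -
  interpret T: Modules.additive T by fact
  have "subst_op T \<iota> (pCons a f) = (\<Sum>n\<le>Suc (degree f). (T ^^ n) (\<iota> (coeff (pCons a f) n)))"
    using T \<iota> degree_pCons_le by (rule subst_op_eq_sum)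
  also have "\<dots> = \<iota> a + (\<Sum>n\<le>degree f. T ((T ^^ n) (\<iota> (coeff f n))))"
    by (subst sum.atMost_Suc_shift) simp
  also have "(\<Sum>n\<le>degree f. T ((T ^^ n) (\<iota> (coeff f n)))) = T (subst_op T \<iota> f)"
    by (simp add: subst_op_def T.sum)
  finally show ?thesis .
qed

lemma subst_op_0: "\<iota> 0 = 0 \<Longrightarrow> subst_op T \<iota> 0 = 0"
  by (simp add: subst_op_def)

text \<open>
  The part of the axioms of a Lie conformal algebra that expresses sesquilinearity. It is all that is
  needed to recognise an isomorphism on generators, and it is easy to check for the target algebras,
  for which the Jacobi identity is then a consequence.
\<close>

locale conformal_bracket = module sc
  for sc :: "complex poly \<Rightarrow> 'v::ab_group_add \<Rightarrow> 'v" +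
  fixes br :: "'v \<Rightarrow> 'v \<Rightarrow> 'v poly"
  assumes add_left: "br (a + a') b = br a b + br a' b"
    and add_right: "br a (b + b') = br a b + br a b'"
    and scale_left: "br (sc [:z:] a) b = map_poly (sc [:z:]) (br a b)"
    and scale_right: "br a (sc [:z:] b) = map_poly (sc [:z:]) (br a b)"
    and del_left: "br (sc [:0, 1:] a) b = - pCons 0 (br a b)"
    and del_right: "br a (sc [:0, 1:] b) = mult_del sc (br a b) + pCons 0 (br a b)"
begin

lemma zero_left [simp]: "br 0 b = 0"
  using add_left[of 0 0 b] by simp

lemma zero_right [simp]: "br a 0 = 0"
  using add_right[of a 0 0] by simp

lemma map_sc_add: "map_poly (sc q) (f + g) = map_poly (sc q) f + map_poly (sc q) g"
  by (rule map_poly_add_hom) (rule scale_right_distrib)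

end

lemma subspaceI_const_del:
  fixes sc :: "complex poly \<Rightarrow> 'v::ab_group_add \<Rightarrow> 'v"
  assumes "module sc" and "0 \<in> A" and add: "\<And>a b. a \<in> A \<Longrightarrow> b \<in> A \<Longrightarrow> a + b \<in> A"
    and const: "\<And>z a. a \<in> A \<Longrightarrow> sc [:z:] a \<in> A"
    and del: "\<And>a. a \<in> A \<Longrightarrow> sc [:0, 1:] a \<in> A"
  shows "module.subspace sc A"
proof -
  interpret module sc by fact
  have "sc q a \<in> A" if "a \<in> A" for q a
    using that
  proof (induction q arbitrary: a)
    case 0
    then show ?case using assms(2) by simp
  next
    case (pCons z q)
    have "sc (pCons z q) a = sc [:z:] a + sc q (sc [:0, 1:] a)"
      by (simp flip: scale_left_distrib)
    moreover have "sc [:z:] a + sc q (sc [:0, 1:] a) \<in> A"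
      by (intro add const pCons.IH del pCons.prems)
    ultimately show ?case by simp
  qed
  then show ?thesis using assms(2) add by (simp add: subspace_def)
qed

definition combine :: "(complex poly \<Rightarrow> 'v::ab_group_add \<Rightarrow> 'v) \<Rightarrow> (int \<Rightarrow> 'v) \<Rightarrow> (int \<Rightarrow>\<^sub>0 complex poly) \<Rightarrow> 'v"
  where "combine sc e f = (\<Sum>i\<in>Poly_Mapping.keys f. sc (Poly_Mapping.lookup f i) (e i))"

definition supported_on :: "int set \<Rightarrow> (int \<Rightarrow>\<^sub>0 complex poly) set"
  where "supported_on S = {f. Poly_Mapping.keys f \<subseteq> S}"

lemma lookup_free_scale [simp]: "Poly_Mapping.lookup (free_scale q f) i = q * Poly_Mapping.lookup f i"
  by (simp add: free_scale_def Poly_Mapping.map.rep_eq when_def)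

lemma module_free_scale: "module free_scale"
  by unfold_locales (auto intro!: poly_mapping_eqI simp: lookup_add algebra_simps)

lemma combine_eq_sum:
  assumes "module sc" "finite I" "Poly_Mapping.keys f \<subseteq> I"
  shows "combine sc e f = (\<Sum>i\<in>I. sc (Poly_Mapping.lookup f i) (e i))"
proof -
  interpret module sc by fact
  show ?thesis unfolding combine_def using assms(2,3)
    by (intro sum.mono_neutral_left) (auto simp: in_keys_iff)
qed

lemma combine_add:
  assumes "module sc" shows "combine sc e (f + g) = combine sc e f + combine sc e g"
proof -
  interpret module sc by fact
  let ?I = "Poly_Mapping.keys f \<union> Poly_Mapping.keys g"
  have "combine sc e h = (\<Sum>i\<in>?I. sc (Poly_Mapping.lookup h i) (e i))" if "Poly_Mapping.keys h \<subseteq> ?I" for h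
    by (rule combine_eq_sum[OF assms _ that]) simp
  then show ?thesis using Poly_Mapping.keys_add[of f g]
    by (simp add: lookup_add scale_left_distrib sum.distrib)
qed

lemma keys_free_scale: "Poly_Mapping.keys (free_scale q f) \<subseteq> Poly_Mapping.keys f"
  by (auto simp: in_keys_iff)

lemma combine_scale:
  assumes "module sc" shows "combine sc e (free_scale q f) = sc q (combine sc e f)"
proof -
  interpret module sc by fact
  show ?thesis
    using combine_eq_sum[OF assms finite_keys keys_free_scale, of e q f]
    by (simp add: combine_def scale_sum_right)
qed

lemma combine_single:
  assumes "module sc" shows "combine sc e (Poly_Mapping.single i q) = sc q (e i)"
proof -
  interpret module sc by fact
  show ?thesis using combine_eq_sum[OF assms, of "{i}" "Poly_Mapping.single i q" e] by simp
qed

lemma supported_on_add: "f \<in> supported_on S \<Longrightarrow> g \<in> supported_on S \<Longrightarrow> f + g \<in> supported_on S"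
  using Poly_Mapping.keys_add[of f g] by (auto simp: supported_on_def)

lemma supported_on_scale: "f \<in> supported_on S \<Longrightarrow> free_scale q f \<in> supported_on S"
  using keys_free_scale[of q f] by (auto simp: supported_on_def)

lemma map_poly_act:
  assumes "module_hom sc sc' \<phi>"
  shows "map_poly \<phi> (poly_act sc p v) = poly_act sc' p (\<phi> v)"
proof -
  interpret module_hom sc sc' \<phi> by fact
  show ?thesis by (intro poly_eqI) (simp add: poly_act_def coeff_map_poly zero scale)
qed

text \<open>
  Sesquilinearity propagates the compatibility of the brackets from pairs of generators to all
  pairs of vectors, one argument after the other. The target basis is allowed to span only a
  submodule \<open>V'\<close>, as in \<open>SCL\<^sub>2(0,s)\<close>.
\<close>

lemma isomorphic_of_bases:
  assumes br: "conformal_bracket sc br" and br': "conformal_bracket sc' br'"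
    and e: "bij_betw (combine sc e) (supported_on S) UNIV"
    and E: "bij_betw (combine sc' E) (supported_on S) V'"
    and zero: "\<And>i. i \<notin> S \<Longrightarrow> e i = 0" "\<And>i. i \<notin> S \<Longrightarrow> E i = 0"
    and p: "\<And>i j. br (e i) (e j) = poly_act sc (p i j) (e (i + j))"
    and q: "\<And>i j. i \<in> S \<Longrightarrow> j \<in> S \<Longrightarrow> br' (E i) (E j) = poly_act sc' (p i j) (E (i + j))"
  shows "lca_isomorphic sc br V' sc' br'"
proof -
  interpret b: conformal_bracket sc br by fact
  interpret b': conformal_bracket sc' br' by fact
  have m: "module sc" "module sc'" by unfold_locales
  define coord where "coord = inv_into (supported_on S) (combine sc e)"
  have coord: "coord x \<in> supported_on S" "combine sc e (coord x) = x" for x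
    using e unfolding coord_def bij_betw_def by (auto intro!: inv_into_into f_inv_into_f)
  have coord_combine: "coord (combine sc e f) = f" if "f \<in> supported_on S" for f
    using e that unfolding coord_def bij_betw_def by auto
  define \<phi> where "\<phi> x = combine sc' E (coord x)" for x
  have hom: "module_hom sc sc' \<phi>"
  proof
    fix x y q
    have "coord (x + y) = coord x + coord y"
      using coord_combine[of "coord x + coord y"] coord[of x] coord[of y]
      by (simp add: combine_add[OF m(1)] supported_on_add)
    then show "\<phi> (x + y) = \<phi> x + \<phi> y" by (simp add: \<phi>_def combine_add[OF m(2)])
    have "coord (sc q x) = free_scale q (coord x)"
      using coord_combine[of "free_scale q (coord x)"] coord[of x]
      by (simp add: combine_scale[OF m(1)] supported_on_scale)
    then show "\<phi> (sc q x) = sc' q (\<phi> x)" by (simp add: \<phi>_def combine_scale[OF m(2)])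
  qed
  interpret h: module_hom sc sc' \<phi> by fact
  have bij: "bij_betw \<phi> UNIV V'"
  proof -
    have "bij_betw coord UNIV (supported_on S)"
      unfolding coord_def by (rule bij_betw_inv_into[OF e])
    then have "bij_betw (combine sc' E \<circ> coord) UNIV V'" using E by (rule bij_betw_trans)
    then show ?thesis by (simp add: \<phi>_def[abs_def] comp_def)
  qed
  have \<phi>_e: "\<phi> (e i) = E i" for i
  proof (cases "i \<in> S")
    case True
    then have "Poly_Mapping.single i 1 \<in> supported_on S" by (simp add: supported_on_def)
    then show ?thesis
      using coord_combine[of "Poly_Mapping.single i 1"] combine_single[OF m(1), of e i 1]
        combine_single[OF m(2), of E i 1] by (simp add: \<phi>_def)
  next
    case False
    then show ?thesis using zero by (simp add: h.zero)
  qed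
  have map_add: "map_poly \<phi> (F + G) = map_poly \<phi> F + map_poly \<phi> G" for F G
    by (rule map_poly_add_hom) (rule h.add)
  have map_sc: "map_poly \<phi> (map_poly (sc r) F) = map_poly (sc' r) (map_poly \<phi> F)" for r F
    by (intro poly_eqI) (simp add: coeff_map_poly h.zero h.scale)
  have map_uminus: "map_poly \<phi> (- F) = - map_poly \<phi> F" for F
    by (intro poly_eqI) (simp add: coeff_map_poly h.zero h.neg)
  have map_lam: "map_poly \<phi> (pCons 0 F) = pCons 0 (map_poly \<phi> F)" for F
    by (simp add: map_poly_pCons h.zero)
  define A where "A = {a. \<forall>j. map_poly \<phi> (br a (e j)) = br' (\<phi> a) (E j)}"
  have "b.subspace A"
    by (rule subspaceI_const_del[OF m(1)])
      (auto simp: A_def b.add_left b'.add_left b.scale_left b'.scale_left b.del_left b'.del_left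
        h.add h.scale h.zero map_add map_sc map_uminus map_lam)
  moreover have "e i \<in> A" for i
    unfolding A_def
  proof (intro CollectI allI)
    fix j
    show "map_poly \<phi> (br (e i) (e j)) = br' (\<phi> (e i)) (E j)"
    proof (cases "i \<in> S \<and> j \<in> S")
      case True
      then show ?thesis using q[of i j] by (simp add: p map_poly_act[OF hom] \<phi>_e)
    next
      case False
      then show ?thesis using zero by (auto simp: \<phi>_e h.zero)
    qed
  qed
  ultimately have "combine sc e (coord a) \<in> A" for a
    unfolding combine_def by (intro b.subspace_sum b.subspace_scale)
  then have "a \<in> A" for a by (simp only: coord(2))
  then have left: "map_poly \<phi> (br a (e j)) = br' (\<phi> a) (\<phi> (e j))" for a j
    using \<phi>_e[of j] by (auto simp: A_def)
  define B where "B = {b. \<forall>a. map_poly \<phi> (br a b) = br' (\<phi> a) (\<phi> b)}"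
  have "b.subspace B"
    by (rule subspaceI_const_del[OF m(1)])
      (auto simp: B_def b.add_right b'.add_right b.scale_right b'.scale_right b.del_right b'.del_right
        h.add h.scale h.zero map_add map_sc map_uminus map_lam mult_del_def)
  moreover have "e i \<in> B" for i using left by (simp add: B_def)
  ultimately have "combine sc e (coord b) \<in> B" for b
    unfolding combine_def by (intro b.subspace_sum b.subspace_scale)
  then have "b \<in> B" for b by (simp only: coord(2))
  then have "map_poly \<phi> (br a b) = br' (\<phi> a) (\<phi> b)" for a b
    by (auto simp: B_def)
  then show ?thesis unfolding lca_isomorphic_def using hom bij by blast
qed

section \<open>Algebras given by tables of brackets\<close>

lemma eval_at_pCons: "eval_at t (pCons c q) = Cst c + t * eval_at t q"
  by (simp add: eval_at_def map_poly_pCons)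

lemma eval_at_0 [simp]: "eval_at t 0 = 0" by (simp add: eval_at_def)

lemma eval_at_add: "eval_at t (q + r) = eval_at t q + eval_at t r"
proof -
  have "map_poly Cst (q + r) = map_poly Cst q + map_poly Cst r"
    by (rule map_poly_add_hom) simp
  then show ?thesis by (simp add: eval_at_def)
qed

lemma eval_at_smult: "eval_at t (smult z q) = Cst z * eval_at t q"
  by (induction q) (simp_all add: eval_at_pCons algebra_simps)

lemma peval_eval_at: "peval (eval_at t q) x l = poly q (peval t x l)"
  by (induction q) (simp_all add: eval_at_pCons algebra_simps)

lemma map_single_add:
  fixes f g :: "complex poly poly"
  shows
  "map_poly (Poly_Mapping.single k) (f + g) = map_poly (Poly_Mapping.single k) f + map_poly (Poly_Mapping.single k) g"
  by (rule map_poly_add_hom) (rule single_add)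

lemma map_single_lam: "map_poly (Poly_Mapping.single k) (Lam * f) = pCons 0 (map_poly (Poly_Mapping.single k) f)"
  by (simp add: map_poly_pCons)

lemma map_single_uminus: "map_poly (Poly_Mapping.single k) (- f :: complex poly poly) = - map_poly (Poly_Mapping.single k) f"
  by (intro poly_eqI) (simp add: coeff_map_poly single_uminus)

lemma free_scale_single: "free_scale q (Poly_Mapping.single k r) = Poly_Mapping.single k (q * r)"
  by (intro poly_mapping_eqI) (simp add: lookup_single when_def)

lemma free_scale_0 [simp]: "free_scale q 0 = 0"
  by (intro poly_mapping_eqI) simp

lemma map_single_scale: "map_poly (Poly_Mapping.single k) ([:q:] * f) = map_poly (free_scale q) (map_poly (Poly_Mapping.single k) f)"
  by (intro poly_eqI) (simp add: coeff_map_poly free_scale_single)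

lemma map_free_scale_add: "map_poly (free_scale q) (f + g) = map_poly (free_scale q) f + map_poly (free_scale q) g"
  by (rule map_poly_add_hom) (intro poly_mapping_eqI, simp add: lookup_add algebra_simps)

text \<open>
  The summand of \<open>free_bracket\<close>. Being additive in both coefficients, it lets the sums be extended to
  index sets that do not depend on the supports.
\<close>

definition free_term where
  "free_term P i j u v = map_poly (Poly_Mapping.single (i + j)) (eval_at (- Lam) u * eval_at (Del + Lam) v * P i j)"

lemma free_bracket_eq_sum:
  assumes "finite I" "Poly_Mapping.keys f \<subseteq> I" "finite J" "Poly_Mapping.keys g \<subseteq> J"
  shows "free_bracket P f g = (\<Sum>i\<in>I. \<Sum>j\<in>J. free_term P i j (Poly_Mapping.lookup f i) (Poly_Mapping.lookup g j))"
proof -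
  have "free_bracket P f g = (\<Sum>i\<in>Poly_Mapping.keys f. \<Sum>j\<in>J. free_term P i j (Poly_Mapping.lookup f i) (Poly_Mapping.lookup g j))"
    unfolding free_bracket_def free_term_def[symmetric] using assms(3,4)
    by (intro sum.cong refl sum.mono_neutral_left) (auto simp: in_keys_iff free_term_def)
  also have "\<dots> = (\<Sum>i\<in>I. \<Sum>j\<in>J. free_term P i j (Poly_Mapping.lookup f i) (Poly_Mapping.lookup g j))"
    using assms(1,2) by (intro sum.mono_neutral_left) (auto simp: in_keys_iff free_term_def)
  finally show ?thesis .
qed

lemma free_term_add:
  "free_term P i j (u + u') v = free_term P i j u v + free_term P i j u' v"
  "free_term P i j u (v + v') = free_term P i j u v + free_term P i j u v'"
  by (simp_all add: free_term_def eval_at_add distrib_left distrib_right map_single_add)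

lemma free_term_const:
  "free_term P i j ([:z:] * u) v = map_poly (free_scale [:z:]) (free_term P i j u v)"
  "free_term P i j u ([:z:] * v) = map_poly (free_scale [:z:]) (free_term P i j u v)"
  unfolding free_term_def map_single_scale[symmetric]
  by (rule arg_cong[where f="map_poly _"], simp add: eval_at_smult)+

lemma free_term_del:
  "free_term P i j ([:0, 1:] * u) v = - pCons 0 (free_term P i j u v)"
  "free_term P i j u ([:0, 1:] * v) = map_poly (free_scale [:0, 1:]) (free_term P i j u v) + pCons 0 (free_term P i j u v)"
proof -
  have d: "eval_at t ([:0, 1:] * u) = t * eval_at t u" for t u
    by (simp add: eval_at_pCons)
  show "free_term P i j ([:0, 1:] * u) v = - pCons 0 (free_term P i j u v)"
    unfolding free_term_def d map_single_lam[symmetric] map_single_uminus[symmetric]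
    by (simp only: mult_minus_left mult.assoc)
  show "free_term P i j u ([:0, 1:] * v) = map_poly (free_scale [:0, 1:]) (free_term P i j u v) + pCons 0 (free_term P i j u v)"
    unfolding free_term_def d map_single_lam[symmetric] map_single_scale[symmetric] map_single_add[symmetric]
    by (rule arg_cong[where f="map_poly _"]) (simp only: algebra_simps)
qed

lemma free_bracket_conformal: "conformal_bracket free_scale (free_bracket P)"
proof -
  interpret module free_scale by (rule module_free_scale)
  have lam_sum: "pCons 0 (\<Sum>i\<in>I. F i) = (\<Sum>i\<in>I. pCons 0 (F i))" for F :: "int \<Rightarrow> (int \<Rightarrow>\<^sub>0 complex poly) poly" and I
  proof -
    have "pCons 0 (a + b) = pCons 0 a + pCons 0 b" for a b :: "(int \<Rightarrow>\<^sub>0 complex poly) poly" by simp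
    then show ?thesis by (induction I rule: infinite_finite_induct) (simp_all del: add_pCons)
  qed
  have map_sum: "map_poly (free_scale q) (\<Sum>i\<in>I. F i) = (\<Sum>i\<in>I. map_poly (free_scale q) (F i))" for q F and I :: "int set"
    by (induction I rule: infinite_finite_induct) (simp_all add: map_free_scale_add)
  show ?thesis
  proof
    fix f f' g :: "int \<Rightarrow>\<^sub>0 complex poly" and z
    let ?I = "Poly_Mapping.keys f \<union> Poly_Mapping.keys f'" and ?J = "Poly_Mapping.keys g"
    have I: "Poly_Mapping.keys (f + f') \<subseteq> ?I" "finite ?I" using Poly_Mapping.keys_add[of f f'] by auto
    note sums = free_bracket_eq_sum[OF I(2) _ finite_keys order_refl, of _ P g]
    note sums' = free_bracket_eq_sum[OF finite_keys order_refl I(2), of _ P g]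
    note sums0 = free_bracket_eq_sum[OF finite_keys[of f] _ finite_keys[of g], of _ _ P]
    show "free_bracket P (f + f') g = free_bracket P f g + free_bracket P f' g"
      using I(1) by (simp add: sums lookup_add free_term_add sum.distrib)
    show "free_bracket P g (f + f') = free_bracket P g f + free_bracket P g f'"
      using I(1) by (simp add: sums' lookup_add free_term_add sum.distrib)
    show "free_bracket P (free_scale [:z:] f) g = map_poly (free_scale [:z:]) (free_bracket P f g)"
      using keys_free_scale[of "[:z:]" f]
      by (simp add: sums0 free_term_const map_sum del: mult_pCons_left)
    show "free_bracket P f (free_scale [:z:] g) = map_poly (free_scale [:z:]) (free_bracket P f g)"
      using keys_free_scale[of "[:z:]" g]
      by (simp add: sums0 free_term_const map_sum del: mult_pCons_left)
    show "free_bracket P (free_scale [:0, 1:] f) g = - pCons 0 (free_bracket P f g)"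
      using keys_free_scale[of "[:0, 1:]" f]
      by (simp add: sums0 free_term_del lam_sum del: mult_pCons_left minus_pCons flip: sum_negf)
    show "free_bracket P f (free_scale [:0, 1:] g) = mult_del free_scale (free_bracket P f g) + pCons 0 (free_bracket P f g)"
      using keys_free_scale[of "[:0, 1:]" g]
      by (simp add: sums0 free_term_del lam_sum map_sum mult_del_def sum.distrib del: mult_pCons_left)
  qed
qed

lemma free_bracket_single:
  "free_bracket P (Poly_Mapping.single i u) (Poly_Mapping.single j v) = free_term P i j u v"
  using free_bracket_eq_sum[of "{i}" "Poly_Mapping.single i u" "{j}" "Poly_Mapping.single j v" P] by simp

lemma poly_act_single:
  "poly_act free_scale p (Poly_Mapping.single k w) = map_poly (Poly_Mapping.single k) (p * [:w:])"
  by (intro poly_eqI) (simp add: poly_act_def coeff_map_poly free_scale_single mult.commute[of _ w])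

text \<open>
  The isomorphism multiplies the basis vector of degree \<open>\<sigma> i\<close> by \<open>w\<^sub>i(\<partial>)\<close>. Constant weights are rescalings, a weight of positive
  degree describes a submodule such as \<open>SCL\<^sub>2(0,s)\<close>, and \<open>\<sigma>\<close>, which will be the identity or the
  negation, allows for a reversal of the grading.
\<close>

lemma isomorphic_to_free:
  fixes \<sigma> :: "int \<Rightarrow> int"
  assumes br: "conformal_bracket sc br"
    and e: "bij_betw (combine sc e) (supported_on S) UNIV" "\<And>i. i \<notin> S \<Longrightarrow> e i = 0"
    and p: "\<And>i j. br (e i) (e j) = poly_act sc (p i j) (e (i + j))"
    and supp: "\<And>i j. p i j \<noteq> 0 \<Longrightarrow> i + j \<in> S"
    and \<sigma>: "\<And>i. \<sigma> (\<sigma> i) = i" "\<And>i j. \<sigma> (i + j) = \<sigma> i + \<sigma> j"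
    and w: "\<And>i. w i \<noteq> 0"
    and T: "\<And>i j x l. i \<in> S \<Longrightarrow> j \<in> S \<Longrightarrow>
      peval (p i j) x l * poly (w (i + j)) x = poly (w i) (- l) * poly (w j) (x + l) * peval (T (\<sigma> i) (\<sigma> j)) x l"
    and V: "V' = {f. \<forall>i. (i \<in> S \<longrightarrow> w i dvd Poly_Mapping.lookup f (\<sigma> i)) \<and> (i \<notin> S \<longrightarrow> Poly_Mapping.lookup f (\<sigma> i) = 0)}"
  shows "lca_isomorphic sc br V' free_scale (free_bracket T)"
proof -
  define E where "E i = (if i \<in> S then Poly_Mapping.single (\<sigma> i) (w i) else 0)" for i
  have lookup_combine: "Poly_Mapping.lookup (combine free_scale E f) (\<sigma> k) = Poly_Mapping.lookup f k * w k"
    if f: "f \<in> supported_on S" for f k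
  proof -
    have *: "(\<sigma> i = \<sigma> k) = (i = k)" for i using \<sigma>(1) by metis
    have "Poly_Mapping.lookup (combine free_scale E f) (\<sigma> k)
      = (\<Sum>i\<in>Poly_Mapping.keys f. if i = k then Poly_Mapping.lookup f k * w k else 0)"
      unfolding combine_def lookup_sum using f
      by (intro sum.cong) (auto simp: E_def supported_on_def lookup_single when_def *)
    then show ?thesis by (simp add: in_keys_iff)
  qed
  have inj: "inj_on (combine free_scale E) (supported_on S)"
  proof (rule inj_onI)
    fix f g assume fg: "f \<in> supported_on S" "g \<in> supported_on S" "combine free_scale E f = combine free_scale E g"
    have "Poly_Mapping.lookup f k * w k = Poly_Mapping.lookup g k * w k" for k
      unfolding lookup_combine[OF fg(1), symmetric] lookup_combine[OF fg(2), symmetric] fg(3) by (rule refl)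
    then show "f = g" using w by (intro poly_mapping_eqI) simp
  qed
  have image: "combine free_scale E ` supported_on S = V'"
  proof (intro equalityI subsetI)
    fix h assume "h \<in> combine free_scale E ` supported_on S"
    then obtain f where "f \<in> supported_on S" "h = combine free_scale E f" by blast
    then show "h \<in> V'" unfolding V using lookup_combine
      by (auto simp: supported_on_def in_keys_iff subset_iff)
  next
    fix h assume h: "h \<in> V'"
    define f where "f = Poly_Mapping.Abs_poly_mapping (\<lambda>i. Poly_Mapping.lookup h (\<sigma> i) div w i)"
    have "finite (\<sigma> ` Poly_Mapping.keys h)" by simp
    moreover have "{i. Poly_Mapping.lookup h (\<sigma> i) div w i \<noteq> 0} \<subseteq> \<sigma> ` Poly_Mapping.keys h"
    proof
      fix i assume "i \<in> {i. Poly_Mapping.lookup h (\<sigma> i) div w i \<noteq> 0}"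
      then have "\<sigma> i \<in> Poly_Mapping.keys h" by (auto simp: in_keys_iff)
      then show "i \<in> \<sigma> ` Poly_Mapping.keys h" using \<sigma>(1)[of i] by (metis image_eqI)
    qed
    ultimately have "finite {i. Poly_Mapping.lookup h (\<sigma> i) div w i \<noteq> 0}" by (rule finite_subset[rotated])
    then have lf: "Poly_Mapping.lookup f i = Poly_Mapping.lookup h (\<sigma> i) div w i" for i
      by (simp add: f_def)
    have "Poly_Mapping.lookup f i = 0" if "i \<notin> S" for i
      using h that unfolding V lf by simp
    then have f: "f \<in> supported_on S" unfolding supported_on_def by (auto simp: in_keys_iff)
    have "Poly_Mapping.lookup (combine free_scale E f) k = Poly_Mapping.lookup h k" for k
    proof -
      define i where "i = \<sigma> k"
      have k: "k = \<sigma> i" by (simp add: i_def \<sigma>(1))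
      have "(i \<in> S \<longrightarrow> w i dvd Poly_Mapping.lookup h (\<sigma> i)) \<and> (i \<notin> S \<longrightarrow> Poly_Mapping.lookup h (\<sigma> i) = 0)"
        using h unfolding V by blast
      then show ?thesis using lookup_combine[OF f, of i] unfolding k lf by (cases "i \<in> S") auto
    qed
    then have "combine free_scale E f = h" by (intro poly_mapping_eqI)
    then show "h \<in> combine free_scale E ` supported_on S" using f by blast
  qed
  show ?thesis
  proof (rule isomorphic_of_bases[OF br free_bracket_conformal e(1) _ e(2) _ p])
    show "bij_betw (combine free_scale E) (supported_on S) V'" using inj image by (simp add: bij_betw_def)
    show "i \<notin> S \<Longrightarrow> E i = 0" for i by (simp add: E_def)
    fix i j assume ij: "i \<in> S" "j \<in> S"
    have eq: "p i j * [:w (i + j):] = eval_at (- Lam) (w i) * eval_at (Del + Lam) (w j) * T (\<sigma> i) (\<sigma> j)"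
      using T[OF ij] by (intro peval_eqI) (simp add: peval_eval_at del: mult_pCons_right)
    show "free_bracket T (E i) (E j) = poly_act free_scale (p i j) (E (i + j))"
    proof (cases "i + j \<in> S")
      case True
      then show ?thesis using ij
        by (simp only: E_def if_True free_bracket_single poly_act_single free_term_def eq \<sigma>(2))
    next
      case False
      then have "p i j = 0" using supp by blast
      moreover from this have "free_term T (\<sigma> i) (\<sigma> j) (w i) (w j) = 0"
        unfolding free_term_def eq[symmetric] by simp
      ultimately show ?thesis using ij False
        by (simp add: E_def free_bracket_single poly_act_def)
    qed
  qed
qed

section \<open>The current algebra bracket on matrices\<close>

lemma mat_scale_nth [simp]: "mat_scale c A $ i $ j = c * A $ i $ j"
  by (simp add: mat_scale_def map_matrix_def)

lemma mat_comm_nth: "mat_comm A B $ i $ j = (\<Sum>k\<in>UNIV. A $ i $ k * B $ k $ j) - (\<Sum>k\<in>UNIV. B $ i $ k * A $ k $ j)"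
  by (simp add: mat_comm_def matrix_matrix_mult_def)

lemma coeff_mat_scale [simp]: "coeff (map_poly (mat_scale c) x) n = mat_scale c (coeff x n)"
  by (rule coeff_map_poly) (simp add: vec_eq_iff)

abbreviation "curs \<equiv> cur_scale mat_scale"
abbreviation "curb \<equiv> cur_bracket mat_comm"

lemma cur_scale_0 [simp]: "curs 0 x = 0"
  unfolding cur_scale_def by (rule subst_op_0) (auto intro!: poly_eqI simp: vec_eq_iff)

lemma additive_lam: "Modules.additive (pCons (0::'a::ab_group_add))"
  by (rule additive.intro) simp

lemma cur_scale_pCons: "curs (pCons c q) x = map_poly (mat_scale c) x + pCons 0 (curs q x)"
  unfolding cur_scale_def
  by (rule subst_op_pCons[OF additive_lam]) (auto intro!: poly_eqI simp: vec_eq_iff)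

lemma cur_scale_add_left: "curs (q + r) x = curs q x + curs r x"
  unfolding cur_scale_def
  by (rule subst_op_add[OF additive_lam], rule additive.intro)
    (auto intro!: poly_eqI simp: vec_eq_iff algebra_simps)

lemma cur_scale_add_right: "curs q (x + y) = curs q x + curs q y"
proof (induction q)
  case (pCons c q)
  have "map_poly (mat_scale c) (x + y) = map_poly (mat_scale c) x + map_poly (mat_scale c) y"
    by (auto intro!: poly_eqI simp: vec_eq_iff algebra_simps)
  moreover have "pCons 0 (a + b) = pCons 0 a + pCons 0 b" for a b :: "(complex^2^2) poly" by simp
  ultimately show ?case unfolding cur_scale_pCons pCons.IH by (simp only: add_ac)
qed simp

lemma map_mat_scale_zero [simp]: "map_poly (mat_scale 0) x = 0"
  by (auto intro!: poly_eqI simp: vec_eq_iff)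

lemma cur_scale_const: "curs [:z:] x = map_poly (mat_scale z) x"
  by (simp add: cur_scale_pCons)

lemma cur_scale_smult: "curs (smult z q) x = map_poly (mat_scale z) (curs q x)"
proof (induction q)
  case (pCons c q)
  have "map_poly (mat_scale z) (map_poly (mat_scale c) x + pCons 0 y)
    = map_poly (mat_scale (z * c)) x + pCons 0 (map_poly (mat_scale z) y)" for y
    by (auto intro!: poly_eqI simp: vec_eq_iff coeff_pCons algebra_simps split: nat.split)
  then show ?case using pCons by (simp add: cur_scale_pCons)
qed simp

lemma module_cur_scale: "module curs"
proof
  show "curs q (x + y) = curs q x + curs q y" for q x y by (rule cur_scale_add_right)
  show "curs (q + r) x = curs q x + curs r x" for q r x by (rule cur_scale_add_left)
  show "curs 1 x = x" for x
    by (auto intro!: poly_eqI simp: vec_eq_iff cur_scale_const simp flip: pCons_one)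
  show "curs q (curs r x) = curs (q * r) x" for q r x
  proof (induction q)
    case (pCons c q)
    then show ?case by (simp add: cur_scale_pCons cur_scale_add_left cur_scale_smult)
  qed simp
qed

lemma cur_scale_del: "curs [:0, 1:] x = pCons 0 x"
proof -
  have "map_poly (mat_scale 0) x = 0" "map_poly (mat_scale 1) x = x"
    by (auto intro!: poly_eqI simp: vec_eq_iff)
  then show ?thesis by (simp add: cur_scale_pCons)
qed

text \<open>
  The inner substitution of \<open>cur_bracket\<close>, which is the bracket \<open>[u \<^sub>\<lambda> y]\<close> with a constant \<open>u\<close>.
\<close>

definition right_part where
  "right_part u y = subst_op (\<lambda>g. map_poly (pCons 0) g + pCons 0 g) (\<lambda>v. [:[:mat_comm u v:]:]) y"

lemma mat_comm_add: "mat_comm (u + u') v = mat_comm u v + mat_comm u' v" "mat_comm u (v + v') = mat_comm u v + mat_comm u v'"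
  by (simp_all add: vec_eq_iff mat_comm_nth algebra_simps sum.distrib)

lemma mat_comm_scale: "mat_comm (mat_scale z u) v = mat_scale z (mat_comm u v)" "mat_comm u (mat_scale z v) = mat_scale z (mat_comm u v)"
  by (simp_all add: vec_eq_iff mat_comm_nth algebra_simps sum_distrib_left)

lemma mat_comm_0: "mat_comm u 0 = 0" "mat_comm 0 u = 0"
  by (simp_all add: vec_eq_iff mat_comm_nth)

lemma additive_del_lam: "Modules.additive (\<lambda>g :: 'a::ab_group_add poly poly. map_poly (pCons 0) g + pCons 0 g)"
proof (rule additive.intro)
  fix g h :: "'a poly poly"
  have "map_poly (pCons 0) (g + h) = map_poly (pCons 0) g + map_poly (pCons 0) h"
    by (rule map_poly_add_hom) simp
  then show "map_poly (pCons 0) (g + h) + pCons 0 (g + h) = map_poly (pCons 0) g + pCons 0 g + (map_poly (pCons 0) h + pCons 0 h)"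
    by (simp add: algebra_simps)
qed

lemma additive_minus_lam: "Modules.additive (\<lambda>g :: 'a::ab_group_add poly. - pCons 0 g)"
  by (rule additive.intro) simp

lemma right_part_simps:
  "right_part u 0 = 0"
  "right_part u (pCons v y) = [:[:mat_comm u v:]:] + (map_poly (pCons 0) (right_part u y) + pCons 0 (right_part u y))"
  "right_part u (y + y') = right_part u y + right_part u y'"
  unfolding right_part_def
    apply (rule subst_op_0, simp add: mat_comm_0)
   apply (rule subst_op_pCons[OF additive_del_lam], simp add: mat_comm_0)
  apply (rule subst_op_add[OF additive_del_lam], rule additive.intro, simp add: mat_comm_add)
  done

lemma map_map_scale_add:
  "map_poly (map_poly (mat_scale z)) (F + G) = map_poly (map_poly (mat_scale z)) F + map_poly (map_poly (mat_scale z)) G"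
  by (rule map_poly_add_hom) (auto intro!: poly_eqI simp: vec_eq_iff algebra_simps)

lemma map_map_scale_del:
  "map_poly (map_poly (mat_scale z)) (map_poly (pCons 0) F) = map_poly (pCons 0) (map_poly (map_poly (mat_scale z)) F)"
  by (intro poly_eqI) (simp add: coeff_map_poly map_poly_pCons vec_eq_iff coeff_pCons split: nat.split)

lemma map_map_scale_lam:
  "map_poly (map_poly (mat_scale z)) (pCons 0 F) = pCons 0 (map_poly (map_poly (mat_scale z)) F)"
  by (simp add: map_poly_pCons)

lemma map_map_scale_uminus:
  "map_poly (map_poly (mat_scale z)) (- F) = - map_poly (map_poly (mat_scale z)) F"
  by (intro poly_eqI) (simp add: coeff_map_poly vec_eq_iff)

lemma map_map_scale_const:
  "map_poly (map_poly (mat_scale z)) [:[:A:]:] = [:[:mat_scale z A:]:]"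
  by (auto intro!: poly_eqI simp: coeff_map_poly vec_eq_iff coeff_pCons split: nat.split)

lemma right_part_add_left: "right_part (u + u') y = right_part u y + right_part u' y"
proof (induction y)
  case (pCons v y)
  interpret Modules.additive "\<lambda>g :: (complex^2^2) poly poly. map_poly (pCons 0) g + pCons 0 g" by (rule additive_del_lam)
  show ?case unfolding right_part_simps pCons add mat_comm_add by (simp add: add_ac)
qed (simp add: right_part_simps)

lemma right_part_scale:
  "right_part (mat_scale z u) y = map_poly (map_poly (mat_scale z)) (right_part u y)"
  "right_part u (map_poly (mat_scale z) y) = map_poly (map_poly (mat_scale z)) (right_part u y)"
proof -
  show "right_part (mat_scale z u) y = map_poly (map_poly (mat_scale z)) (right_part u y)"
    by (induction y) (simp_all only: right_part_simps mat_comm_scale map_map_scale_add map_map_scale_del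
        map_map_scale_lam map_map_scale_const map_poly_0)
  show "right_part u (map_poly (mat_scale z) y) = map_poly (map_poly (mat_scale z)) (right_part u y)"
  proof (induction y)
    case (pCons v y)
    have "map_poly (mat_scale z) (pCons v y) = pCons (mat_scale z v) (map_poly (mat_scale z) y)"
      by (auto intro!: poly_eqI simp: coeff_pCons split: nat.split)
    then show ?case using pCons by (simp only: right_part_simps mat_comm_scale map_map_scale_add map_map_scale_del
        map_map_scale_lam map_map_scale_const)
  qed (simp add: right_part_simps)
qed

lemma cur_bracket_simps:
  "curb 0 y = 0"
  "curb (pCons u x) y = right_part u y + - pCons 0 (curb x y)"
  "curb (x + x') y = curb x y + curb x' y"
proof -
  have z: "right_part 0 y = 0" for y using right_part_add_left[of 0 0 y] by simp
  show "curb 0 y = 0" unfolding cur_bracket_def right_part_def[symmetric]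
    by (rule subst_op_0) (rule z)
  show "curb (pCons u x) y = right_part u y + - pCons 0 (curb x y)"
    unfolding cur_bracket_def right_part_def[symmetric]
    by (rule subst_op_pCons[OF additive_minus_lam]) (rule z)
  show "curb (x + x') y = curb x y + curb x' y"
    unfolding cur_bracket_def right_part_def[symmetric]
    by (rule subst_op_add[OF additive_minus_lam], rule additive.intro) (rule right_part_add_left)
qed

lemma cur_bracket_conformal: "conformal_bracket curs curb"
proof -
  interpret module curs by (rule module_cur_scale)
  show ?thesis
  proof
    fix x x' y y' :: "(complex^2^2) poly" and z
    show "curb (x + x') y = curb x y + curb x' y" by (rule cur_bracket_simps)
    show "curb x (y + y') = curb x y + curb x y'"
      by (induction x) (simp_all add: cur_bracket_simps right_part_simps del: add_pCons minus_pCons, simp)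
    show "curb (curs [:z:] x) y = map_poly (curs [:z:]) (curb x y)"
    proof -
      have "curs [:z:] = map_poly (mat_scale z)" by (rule ext) (rule cur_scale_const)
      moreover have "curb (map_poly (mat_scale z) x) y = map_poly (map_poly (mat_scale z)) (curb x y)"
      proof (induction x)
        case (pCons u x)
        have "map_poly (mat_scale z) (pCons u x) = pCons (mat_scale z u) (map_poly (mat_scale z) x)"
          by (auto intro!: poly_eqI simp: coeff_pCons split: nat.split)
        then show ?case using pCons
          by (simp only: cur_bracket_simps right_part_scale map_map_scale_add map_map_scale_uminus map_map_scale_lam)
      qed (simp add: cur_bracket_simps)
      ultimately show ?thesis by simp
    qed
    show "curb x (curs [:z:] y) = map_poly (curs [:z:]) (curb x y)"
    proof -
      have "curs [:z:] = map_poly (mat_scale z)" by (rule ext) (rule cur_scale_const)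
      moreover have "curb x (map_poly (mat_scale z) y) = map_poly (map_poly (mat_scale z)) (curb x y)"
        by (induction x) (simp_all only: cur_bracket_simps right_part_scale map_map_scale_add
            map_map_scale_uminus map_map_scale_lam map_poly_0)
      ultimately show ?thesis by simp
    qed
    show "curb (curs [:0, 1:] x) y = - pCons 0 (curb x y)"
    proof -
      have "right_part 0 y = 0" using right_part_add_left[of 0 0 y] by simp
      then show ?thesis by (simp add: cur_scale_del cur_bracket_simps)
    qed
    show "curb x (curs [:0, 1:] y) = mult_del curs (curb x y) + pCons 0 (curb x y)"
    proof -
      have del: "mult_del curs = map_poly (pCons 0)"
        by (rule ext) (simp add: mult_del_def cur_scale_del[abs_def])
      have "right_part u (pCons 0 y) = map_poly (pCons 0) (right_part u y) + pCons 0 (right_part u y)" for u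
        by (simp add: right_part_simps mat_comm_0)
      moreover have "map_poly (pCons 0) (F + - pCons 0 G) = map_poly (pCons 0) F + - pCons 0 (map_poly (pCons 0) G)"
        for F G :: "(complex^2^2) poly poly"
        by (intro poly_eqI) (simp add: coeff_map_poly coeff_pCons split: nat.split)
      ultimately show ?thesis unfolding cur_scale_del del
        by (induction x) (simp_all add: cur_bracket_simps algebra_simps)
    qed
  qed
qed

section \<open>The current algebra of sl2\<close>

text \<open>
  The standard basis of \<open>sl\<^sub>2\<close>, graded by \<open>-1\<close>, \<open>0\<close>, \<open>1\<close>, with the two free scaling factors \<open>a\<close> for the
  diagonal and \<open>b\<close> for the lower triangular element.
\<close>

definition sl2_basis :: "complex \<Rightarrow> complex \<Rightarrow> int \<Rightarrow> complex^2^2" where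
  "sl2_basis a b i = (if i = 1 then vector [vector [0, 1], vector [0, 0]]
    else if i = 0 then vector [vector [a, 0], vector [0, - a]]
    else if i = -1 then vector [vector [0, 0], vector [b, 0]] else 0)"

lemma coeff_cur_scale_const: "coeff (curs q [:A:]) n = mat_scale (coeff q n) A"
proof (induction q arbitrary: n)
  case (pCons c q)
  then show ?case
    by (cases n) (simp_all add: cur_scale_pCons coeff_pCons vec_eq_iff)
qed (simp add: vec_eq_iff)

lemma cur_bracket_const: "curb [:A:] [:B:] = [:[:mat_comm A B:]:]"
  by (simp add: cur_bracket_simps right_part_simps)

lemma isomorphic_to_current_sl2:
  assumes br: "conformal_bracket sc br"
    and e: "bij_betw (combine sc e) (supported_on {-1, 0, 1}) UNIV" "\<And>i. i \<notin> {-1, 0, 1} \<Longrightarrow> e i = 0"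
    and p: "\<And>i j. br (e i) (e j) = poly_act sc (p i j) (e (i + j))"
    and nz: "f0 \<noteq> 0" "g0 \<noteq> 0"
    and vals: "p 0 0 = 0" "p 0 1 = Cst f0" "p 0 (-1) = Cst (- f0)" "p 1 0 = Cst (- f0)" "p (-1) 0 = Cst f0"
      "p (-1) 1 = Cst g0" "p 1 (-1) = Cst (- g0)"
  shows "lca_isomorphic sc br (cur_carrier sl2) curs curb"
proof -
  (* Forced by [h,e] = 2 e, [f,e] = - h and the prescribed brackets [L 0, L 1] = f0 L 1, [L (- 1), L 1] = g0 L 0. *)
  define a b where "a = f0 / 2" and "b = - (g0 * f0 / 2)"
  have ab: "a \<noteq> 0" "b \<noteq> 0" using nz by (simp_all add: a_def b_def)
  define X where "X = sl2_basis a b"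
  define E where "E i = (if i \<in> {-1, 0, 1} then [:X i:] else 0)" for i :: int
  let ?S = "{-1, 0, 1} :: int set"
  have coeff_combine: "coeff (combine curs E f) n =
      vector [vector [a * coeff (Poly_Mapping.lookup f 0) n, coeff (Poly_Mapping.lookup f 1) n],
        vector [b * coeff (Poly_Mapping.lookup f (-1)) n, - a * coeff (Poly_Mapping.lookup f 0) n]]"
    if "f \<in> supported_on ?S" for f n
  proof -
    have "combine curs E f = (\<Sum>i\<in>?S. curs (Poly_Mapping.lookup f i) (E i))"
      using that by (intro combine_eq_sum[OF module_cur_scale]) (auto simp: supported_on_def)
    then show ?thesis
      by (simp add: E_def coeff_cur_scale_const X_def sl2_basis_def vec_eq_iff forall_2 mult.commute)
  qed
  have inj: "inj_on (combine curs E) (supported_on ?S)"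
  proof (rule inj_onI)
    fix f g assume fg: "f \<in> supported_on ?S" "g \<in> supported_on ?S" "combine curs E f = combine curs E g"
    have c: "coeff (Poly_Mapping.lookup f i) n = coeff (Poly_Mapping.lookup g i) n" if "i \<in> ?S" for i n
      using that ab coeff_combine[OF fg(1), of n] coeff_combine[OF fg(2), of n] unfolding fg(3)
      by (auto simp: vec_eq_iff forall_2)
    show "f = g"
    proof (rule poly_mapping_eqI)
      fix i show "Poly_Mapping.lookup f i = Poly_Mapping.lookup g i"
      proof (cases "i \<in> ?S")
        case True then show ?thesis using c by (intro poly_eqI)
      next
        case False
        then have "i \<notin> Poly_Mapping.keys f" "i \<notin> Poly_Mapping.keys g" using fg(1,2) by (auto simp: supported_on_def)
        then show ?thesis by (simp add: in_keys_iff)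
      qed
    qed
  qed
  have image: "combine curs E ` supported_on ?S = cur_carrier sl2"
  proof (intro equalityI subsetI)
    fix h assume "h \<in> combine curs E ` supported_on ?S"
    then obtain f where f: "f \<in> supported_on ?S" "h = combine curs E f" by blast
    show "h \<in> cur_carrier sl2"
      unfolding f(2) cur_carrier_def sl2_def by (simp add: coeff_combine[OF f(1)] trace_def sum_2)
  next
    fix h assume h: "h \<in> cur_carrier sl2"
    define entry where "entry i j = map_poly (\<lambda>M :: complex^2^2. M $ i $ j) h" for i j
    have entry: "coeff (entry i j) n = coeff h n $ i $ j" for i j n by (simp add: entry_def coeff_map_poly)
    define f :: "int \<Rightarrow>\<^sub>0 complex poly" where "f = Poly_Mapping.single 1 (entry 1 2) + Poly_Mapping.single 0 (smult (1 / a) (entry 1 1))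
      + Poly_Mapping.single (-1) (smult (1 / b) (entry 2 1))"
    have lookup_f: "Poly_Mapping.lookup f i = (if i = 1 then entry 1 2 else if i = 0 then smult (1 / a) (entry 1 1)
      else if i = -1 then smult (1 / b) (entry 2 1) else 0)" for i
      by (simp add: f_def lookup_add lookup_single when_def)
    have f: "f \<in> supported_on ?S"
    proof -
      have "Poly_Mapping.lookup f i = 0" if "i \<notin> ?S" for i using that by (auto simp: lookup_f)
      then show ?thesis unfolding supported_on_def by (force simp: in_keys_iff)
    qed
    have "coeff (combine curs E f) n = coeff h n" for n
    proof -
      have "trace (coeff h n) = 0" using h by (simp add: cur_carrier_def sl2_def)
      then have "coeff h n $ 2 $ 2 = - (coeff h n $ 1 $ 1)"
        by (simp add: trace_def sum_2 add_eq_0_iff)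
      then show ?thesis using ab
        by (simp add: coeff_combine[OF f] lookup_f entry vec_eq_iff forall_2)
    qed
    then have "combine curs E f = h" by (intro poly_eqI)
    then show "h \<in> combine curs E ` supported_on ?S" using f by blast
  qed
  have comm: "mat_comm (X 0) (X 1) = mat_scale f0 (X 1)" "mat_comm (X 0) (X (-1)) = mat_scale (- f0) (X (-1))"
    "mat_comm (X 1) (X 0) = mat_scale (- f0) (X 1)" "mat_comm (X (-1)) (X 0) = mat_scale f0 (X (-1))"
    "mat_comm (X (-1)) (X 1) = mat_scale g0 (X 0)" "mat_comm (X 1) (X (-1)) = mat_scale (- g0) (X 0)"
    "mat_comm (X i) (X i) = 0" for i
    by (simp_all add: X_def sl2_basis_def vec_eq_iff forall_2 mat_comm_nth sum_2 a_def b_def)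
  have act: "poly_act curs (Cst c) [:A:] = [:[:mat_scale c A:]:]" for c A
    by (intro poly_eqI) (simp add: poly_act_def coeff_map_poly coeff_pCons cur_scale_pCons vec_eq_iff split: nat.split)
  have act0: "poly_act curs q 0 = 0" for q
    using module.scale_zero_right[OF module_cur_scale] by (intro poly_eqI) (simp add: poly_act_def coeff_map_poly)
  show ?thesis
  proof (rule isomorphic_of_bases[OF br cur_bracket_conformal e(1) _ e(2) _ p])
    show "bij_betw (combine curs E) (supported_on ?S) (cur_carrier sl2)" using inj image by (simp add: bij_betw_def)
    show "i \<notin> ?S \<Longrightarrow> E i = 0" for i by (simp add: E_def)
    show "curb (E i) (E j) = poly_act curs (p i j) (E (i + j))" if "i \<in> ?S" "j \<in> ?S" for i j
    proof -
      have "curb (E i) (E j) = [:[:mat_comm (X i) (X j):]:]" using that by (simp add: E_def cur_bracket_const)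
      moreover have "[:[:mat_comm (X i) (X j):]:] = poly_act curs (p i j) (E (i + j))"
        using that by (auto simp: E_def comm vals act act0 poly_act_def[of _ 0])
      ultimately show ?thesis by simp
    qed
  qed auto
qed

section \<open>Conformal brackets at numerical values of lambda\<close>

context conformal_bracket begin

lemma scale_additive: "Modules.additive (sc t)"
  by (rule additive.intro) (rule scale_right_distrib)

text \<open>
  Evaluation at an element \<open>t\<close> of \<open>\<complex>[\<partial>]\<close>. Besides numbers \<open>\<lambda>\<close>, the value \<open>t = -\<lambda>-\<partial>\<close> is needed for
  skew-symmetry.
\<close>

definition ev where "ev t = subst_op (sc t) (\<lambda>v. v)"

lemma ev_add: "ev t (g + h) = ev t g + ev t h"
  unfolding ev_def by (rule subst_op_add[OF scale_additive]) (rule additive.intro, rule refl)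

lemma ev_0 [simp]: "ev t 0 = 0"
  unfolding ev_def by (rule subst_op_0) (rule refl)

lemma ev_pCons: "ev t (pCons a g) = a + sc t (ev t g)"
  unfolding ev_def by (rule subst_op_pCons[OF scale_additive]) (rule refl)

lemma ev_uminus: "ev t (- g) = - ev t g"
  using ev_add[of t g "- g"] by (simp add: eq_neg_iff_add_eq_0 add.commute)

lemma ev_map_scale: "ev t (map_poly (sc r) g) = sc r (ev t g)"
  by (induction g) (simp_all add: map_poly_pCons ev_pCons scale_right_distrib mult.commute)

lemma ev_poly_act: "ev t (poly_act sc q v) = sc (poly q t) v"
proof (induction q)
  case (pCons c q)
  have "poly_act sc (pCons c q) v = pCons (sc c v) (poly_act sc q v)"
    by (simp add: poly_act_def map_poly_pCons)
  then show ?case using pCons by (simp add: ev_pCons scale_left_distrib mult.commute)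
qed (simp add: poly_act_def)

text \<open>
  How the nested substitutions in the axioms are evaluated: a linear map that turns the substituted
  operator into multiplication by \<open>t\<close> turns the substitution into an evaluation at \<open>t\<close>.
\<close>

lemma subst_op_hom:
  assumes T: "Modules.additive T" and \<iota>: "\<iota> 0 = 0" and \<Phi>: "Modules.additive \<Phi>"
    and eig: "\<And>G. \<Phi> (T G) = sc t (\<Phi> G)"
  shows "\<Phi> (subst_op T \<iota> f) = subst_op (sc t) (\<lambda>v. \<Phi> (\<iota> v)) f"
proof -
  interpret \<Phi>: Modules.additive \<Phi> by fact
  show ?thesis
  proof (induction f)
    case 0
    show ?case using \<iota> by (simp add: subst_op_0 \<Phi>.zero)
  next
    case (pCons a f)
    have "subst_op (sc t) (\<lambda>v. \<Phi> (\<iota> v)) (pCons a f) = \<Phi> (\<iota> a) + sc t (subst_op (sc t) (\<lambda>v. \<Phi> (\<iota> v)) f)"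
      by (rule subst_op_pCons[OF scale_additive]) (simp add: \<iota> \<Phi>.zero)
    then show ?case using subst_op_pCons[of T \<iota> a f, OF T \<iota>] pCons by (simp add: \<Phi>.add eig)
  qed
qed

lemma ev_hom:
  assumes \<Psi>: "Modules.additive \<Psi>" and eig: "\<And>v. \<Psi> (sc t v) = sc t (\<Psi> v)"
  shows "subst_op (sc t) \<Psi> g = \<Psi> (ev t g)"
  unfolding ev_def using subst_op_hom[OF scale_additive _ \<Psi> eig, of "\<lambda>v. v" g] by simp

end

context conformal_bracket begin

definition Br where "Br l a b = ev [:l:] (br a b)"

lemma Br_add_left: "Br l (a + a') b = Br l a b + Br l a' b"
  by (simp add: Br_def add_left ev_add)

lemma Br_add_right: "Br l a (b + b') = Br l a b + Br l a b'"
  by (simp add: Br_def add_right ev_add)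

lemma Br_scale_left: "Br l (sc q a) b = sc [:poly q (- l):] (Br l a b)"
proof (induction q arbitrary: a)
  case 0
  show ?case by (simp add: Br_def)
next
  case (pCons z q)
  have h1: "sc (pCons z q) a = sc [:z:] a + sc q (sc [:0, 1:] a)" by (simp flip: scale_left_distrib)
  have h2: "Br l (sc [:0, 1:] a) b = sc [:- l:] (Br l a b)"
    by (simp add: Br_def del_left ev_uminus ev_pCons flip: scale_minus_left)
  have h3: "Br l (sc [:z:] a) b = sc [:z:] (Br l a b)"
    by (simp add: Br_def scale_left ev_map_scale)
  show ?case unfolding h1 Br_add_left h3 pCons.IH h2
    by (simp add: mult.commute flip: scale_left_distrib)
qed

lemma Br_scale_right: "Br l a (sc q b) = sc (q \<circ>\<^sub>p [:l, 1:]) (Br l a b)"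
proof (induction q arbitrary: b)
  case 0
  show ?case by (simp add: Br_def)
next
  case (pCons z q)
  have h1: "sc (pCons z q) b = sc [:z:] b + sc q (sc [:0, 1:] b)" by (simp flip: scale_left_distrib)
  have h2: "Br l a (sc [:0, 1:] b) = sc [:l, 1:] (Br l a b)"
    by (simp add: Br_def del_right mult_del_def ev_add ev_map_scale ev_pCons flip: scale_left_distrib)
  have h3: "Br l a (sc [:z:] b) = sc [:z:] (Br l a b)"
    by (simp add: Br_def scale_right ev_map_scale)
  show ?case unfolding h1 Br_add_right h3 pCons.IH h2 unfolding scale_scale pcompose_pCons
    by (simp only: mult.commute[of "[:l, 1:]"] scale_left_distrib)
qed

end

lemma (in lie_conformal_algebra) conformal: "conformal_bracket sc br"
  by unfold_locales (fact br_add_left br_add_right br_scale_left br_scale_right br_del_left br_del_right)+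

context lie_conformal_algebra begin

sublocale conformal_bracket sc br by (rule conformal)

text \<open>
  Both variables of the formal identity are evaluated, first \<open>\<mu>\<close> and then \<open>\<lambda>\<close>; each of its three
  substitutions is resolved by \<open>subst_op_hom\<close>.
\<close>

lemma Br_jacobi: "Br l a (Br m b c) = Br (l + m) (Br l a b) c + Br m b (Br l a c)"
proof -
  (* The outer variable of the Jacobi identity is evaluated at l, the inner one at m. *)
  define EV where "EV = subst_op (sc [:l:]) (ev [:m:])"
  have ev_additive: "Modules.additive (ev t)" for t by (rule additive.intro) (rule ev_add)
  have EV_add: "EV (G + H) = EV G + EV H" for G H
    unfolding EV_def by (rule subst_op_add[OF scale_additive ev_additive])
  have EV_additive: "Modules.additive EV" by (rule additive.intro) (rule EV_add)
  have EV_pCons: "EV (pCons g G) = ev [:m:] g + sc [:l:] (EV G)" for g G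
    unfolding EV_def by (rule subst_op_pCons[OF scale_additive]) simp
  have EV_0: "EV 0 = 0" unfolding EV_def by (rule subst_op_0) simp
  have EV_mu: "EV (map_poly (pCons 0) G) = sc [:m:] (EV G)" for G
    by (induction G) (simp_all add: map_poly_pCons EV_0 EV_pCons ev_pCons scale_right_distrib mult.commute)
  have EV_lam: "EV (pCons 0 G) = sc [:l:] (EV G)" for G by (simp add: EV_pCons)
  have EV_const: "EV [:g:] = ev [:m:] g" for g by (simp add: EV_pCons EV_0)
  have EV_map: "EV (map_poly (\<lambda>w. [:w:]) g) = ev [:l:] g" for g
    by (induction g) (simp_all add: map_poly_pCons EV_0 EV_pCons ev_pCons)
  have mu_additive: "Modules.additive (map_poly (pCons 0) :: 'v poly poly \<Rightarrow> _)"
    by (rule additive.intro, rule map_poly_add_hom) simp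
  have Br_additive: "Modules.additive (\<lambda>v. Br l' a' v)" "Modules.additive (\<lambda>v. Br l' v a')" for l' a'
    by (rule additive.intro, simp add: Br_add_left Br_add_right)+
  have 1: "EV (subst_op (map_poly (pCons 0)) (\<lambda>v. map_poly (\<lambda>w. [:w:]) (br a v)) (br b c)) = Br l a (Br m b c)"
  proof -
    have "EV (subst_op (map_poly (pCons 0)) (\<lambda>v. map_poly (\<lambda>w. [:w:]) (br a v)) (br b c))
      = subst_op (sc [:m:]) (\<lambda>v. EV (map_poly (\<lambda>w. [:w:]) (br a v))) (br b c)"
      by (rule subst_op_hom[OF mu_additive _ EV_additive EV_mu]) simp
    also have "\<dots> = subst_op (sc [:m:]) (\<lambda>v. Br l a v) (br b c)" by (simp add: EV_map Br_def)
    also have "\<dots> = Br l a (ev [:m:] (br b c))"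
      by (rule ev_hom[OF Br_additive(1)]) (simp add: Br_scale_right)
    finally show ?thesis by (simp add: Br_def)
  qed
  have 2: "EV (subst_op (\<lambda>g. pCons 0 g + map_poly (pCons 0) g) (\<lambda>w. [:[:w:]:]) h) = ev [:l + m:] h" for h
  proof -
    have "Modules.additive (\<lambda>g :: 'v poly poly. pCons 0 g + map_poly (pCons 0) g)"
      by (rule additive.intro)
        (simp only: additive.add[OF additive_lam] additive.add[OF mu_additive] add_ac)
    then have "EV (subst_op (\<lambda>g. pCons 0 g + map_poly (pCons 0) g) (\<lambda>w. [:[:w:]:]) h)
      = subst_op (sc [:l + m:]) (\<lambda>w. EV [:[:w:]:]) h"
      by (rule subst_op_hom[OF _ _ EV_additive]) (simp_all add: EV_add EV_lam EV_mu flip: scale_left_distrib)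
    then show ?thesis by (simp add: EV_const ev_pCons ev_def[of "[:l + m:]"])
  qed
  have 3: "EV (subst_op (pCons 0) (\<lambda>v. subst_op (\<lambda>g. pCons 0 g + map_poly (pCons 0) g) (\<lambda>w. [:[:w:]:]) (br v c)) (br a b))
    = Br (l + m) (Br l a b) c"
  proof -
    have "EV (subst_op (pCons 0) (\<lambda>v. subst_op (\<lambda>g. pCons 0 g + map_poly (pCons 0) g) (\<lambda>w. [:[:w:]:]) (br v c)) (br a b))
      = subst_op (sc [:l:]) (\<lambda>v. EV (subst_op (\<lambda>g. pCons 0 g + map_poly (pCons 0) g) (\<lambda>w. [:[:w:]:]) (br v c))) (br a b)"
      by (rule subst_op_hom[OF additive_lam _ EV_additive EV_lam]) (simp add: subst_op_0)
    also have "\<dots> = subst_op (sc [:l:]) (\<lambda>v. Br (l + m) v c) (br a b)" by (simp only: 2 Br_def)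
    also have "\<dots> = Br (l + m) (ev [:l:] (br a b)) c"
      by (rule ev_hom[OF Br_additive(2)]) (simp add: Br_scale_left)
    finally show ?thesis by (simp add: Br_def)
  qed
  have 4: "EV (subst_op (pCons 0) (\<lambda>v. [:br b v:]) (br a c)) = Br m b (Br l a c)"
  proof -
    have "EV (subst_op (pCons 0) (\<lambda>v. [:br b v:]) (br a c)) = subst_op (sc [:l:]) (\<lambda>v. EV [:br b v:]) (br a c)"
      by (rule subst_op_hom[OF additive_lam _ EV_additive EV_lam]) simp
    also have "\<dots> = subst_op (sc [:l:]) (\<lambda>v. Br m b v) (br a c)" by (simp only: EV_const Br_def)
    also have "\<dots> = Br m b (ev [:l:] (br a c))"
      by (rule ev_hom[OF Br_additive(1)]) (simp add: Br_scale_right)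
    finally show ?thesis by (simp add: Br_def)
  qed
  show ?thesis using arg_cong[OF br_jacobi[of a b c], of EV] unfolding EV_add 1 3 4 .
qed

lemma Br_skew: "Br l a b = - ev [:- l, - 1:] (br b a)"
proof -
  have h1: "Modules.additive (\<lambda>g. - pCons 0 g - mult_del sc g)"
    by (rule additive.intro)
      (simp only: additive.add[OF additive_lam] mult_del_def map_sc_add diff_conv_add_uminus minus_add_distrib add_ac)
  have h2: "ev [:l:] (- pCons 0 G - mult_del sc G) = sc [:- l, - 1:] (ev [:l:] G)" for G
  proof -
    have "ev [:l:] (- pCons 0 G + - mult_del sc G) = sc (- [:l:] + - [:0, 1:]) (ev [:l:] G)"
      by (simp only: ev_add ev_uminus ev_pCons mult_del_def ev_map_scale scale_left_distrib scale_minus_left add_0)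
    then show ?thesis by simp
  qed
  have h3: "Modules.additive (ev [:l:])" by (rule additive.intro) (rule ev_add)
  have "ev [:l:] (subst_op (\<lambda>g. - pCons 0 g - mult_del sc g) (\<lambda>v. [:v:]) (br b a))
    = subst_op (sc [:- l, - 1:]) (\<lambda>v. ev [:l:] [:v:]) (br b a)"
    by (rule subst_op_hom[where \<iota>="\<lambda>v. [:v:]" and \<Phi>="ev [:l:]" and t="[:- l, - 1:]", OF h1 _ h3 h2]) simp
  then show ?thesis using br_skew[of a b] by (simp add: Br_def ev_uminus ev_pCons flip: ev_def)
qed

end

section \<open>From class V to structure polynomials\<close>

text \<open>
  If \<open>[L\<^sub>1 \<^sub>\<lambda> L\<^sub>n]\<close> is zero, then so are all brackets of components of positive degree at most \<open>n\<close> that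
  lead beyond degree \<open>n\<close>: the Jacobi identity for \<open>1,i,j\<close> passes from row \<open>i\<close> to row \<open>i + 1\<close>, and the
  factor \<open>q\<^sub>1\<^sub>i\<close> with \<open>i < n\<close> can be cancelled.
\<close>

lemma brackets_beyond_vanish:
  fixes q :: "int \<Rightarrow> int \<Rightarrow> complex poly poly"
  assumes jac: "\<And>j k i x l m. peval (q j k) (x + l) m * peval (q i (j + k)) x l =
      peval (q i j) (- l - m) l * peval (q (i + j) k) x (l + m)
      + peval (q i k) (x + m) l * peval (q j (i + k)) x m"
    and nz: "\<And>j. \<lbrakk>1 \<le> j; j < n\<rbrakk> \<Longrightarrow> q 1 j \<noteq> 0" and z: "q 1 n = 0"
    and i: "1 \<le> i" "i \<le> n" and j: "1 \<le> j" "j \<le> n" "n < i + j"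
  shows "q i j = 0"
  using i j
proof (induction i arbitrary: j rule: int_ge_induct)
  case base
  then have "j = n" by simp
  then show ?case using z by simp
next
  case (step i)
  have "q i j = 0 \<or> q 1 (i + j) = 0"
  proof (cases "i + j = n")
    case True then show ?thesis using z by simp
  next
    case False then show ?thesis using step.IH[of j] step.prems by simp
  qed
  moreover have "q 1 j = 0 \<or> q i (1 + j) = 0"
  proof (cases "j = n")
    case True then show ?thesis using z by simp
  next
    case False then show ?thesis using step.IH[of "1 + j"] step.prems by simp
  qed
  ultimately have *: "peval (q 1 i) (- l - m) l * peval (q (1 + i) j) x (l + m) = 0" for x l m
    using jac[where i=1 and j=i and k=j and x=x and l=l and m=m] by auto
  have "q (1 + i) j = 0"
  proof (rule peval_cancel[of "q 1 i"])
    show "peval (q 1 i) y l * peval (q (1 + i) j) x (- y) = 0" for x y l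
      using *[of l "- y - l" x] by simp
    show "q 1 i \<noteq> 0" using nz[of i] step by simp
  qed
  then show ?case by (simp add: add.commute)
qed

locale graded_lca = lie_conformal_algebra sc br
  for sc :: "complex poly \<Rightarrow> 'v::ab_group_add \<Rightarrow> 'v" and br +
  fixes L :: "int \<Rightarrow> 'v set" and e :: "int \<Rightarrow> 'v" and p :: "int \<Rightarrow> int \<Rightarrow> complex poly poly"
  assumes graded: "Z_graded sc br L" and V: "class_V sc br L"
    and basis: "graded_basis sc L e" and polys: "structure_polys sc br e p"
begin

definition S where "S = {i. e i \<noteq> 0}"
text \<open>
  The given polynomials are arbitrary where a component is zero; they are replaced by zero there.
\<close>

definition p' where "p' i j = (if i \<in> S \<and> j \<in> S \<and> i + j \<in> S then p i j else 0)"

lemma e_zero: "i \<notin> S \<Longrightarrow> e i = 0" by (simp add: S_def)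

lemma L_eq: "L i = range (\<lambda>q. sc q (e i))"
proof (cases "L i = {0}")
  case True
  then have "e i = 0" using basis by (auto simp: graded_basis_def)
  then show ?thesis using True by auto
next
  case False
  then have "span {e i} = L i" using basis by (auto simp: graded_basis_def)
  then show ?thesis using span_singleton[of "e i"] by (simp add: full_SetCompr_eq)
qed

lemma torsion_free: "i \<in> S \<Longrightarrow> sc q (e i) = 0 \<longleftrightarrow> q = 0"
proof
  assume i: "i \<in> S" and z: "sc q (e i) = 0"
  then have "L i \<noteq> {0}" using basis by (auto simp: graded_basis_def S_def)
  then have "\<not> dependent {e i}" using basis by (auto simp: graded_basis_def)
  then show "q = 0" using z unfolding dependent_explicit
    by (auto dest!: spec[of _ "{e i}"] spec[of _ "\<lambda>_. q"])
qed simp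

lemma scale_cancel: "i \<in> S \<Longrightarrow> sc q (e i) = sc r (e i) \<longleftrightarrow> q = r"
  using torsion_free[of i "q - r"] by (simp add: scale_left_diff_distrib)

lemma module_sc: "module sc" by unfold_locales

text \<open>
  Coordinates over \<open>\<complex>[\<partial>]\<close>: the homogeneous components of a vector are unique by the grading, and each
  of them is a unique multiple of its basis vector.
\<close>

lemma basis_bij: "bij_betw (combine sc e) (supported_on S) UNIV"
proof -
  have ex1: "\<exists>!h. (\<forall>i. Poly_Mapping.lookup h i \<in> L i) \<and> x = (\<Sum>i\<in>Poly_Mapping.keys h. Poly_Mapping.lookup h i)" for x
    using graded by (simp add: Z_graded_def)
  define H where "H f = Poly_Mapping.mapp (\<lambda>i q. sc q (e i)) f" for f :: "int \<Rightarrow>\<^sub>0 complex poly"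
  have H: "Poly_Mapping.lookup (H f) i = sc (Poly_Mapping.lookup f i) (e i)" for f i
    by (simp add: H_def lookup_mapp in_keys_iff when_def)
  have H_L: "Poly_Mapping.lookup (H f) i \<in> L i" for f i unfolding H L_eq by blast
  have H_sum: "combine sc e f = (\<Sum>i\<in>Poly_Mapping.keys (H f). Poly_Mapping.lookup (H f) i)" for f
  proof -
    have "Poly_Mapping.keys (H f) \<subseteq> Poly_Mapping.keys f" by (auto simp: in_keys_iff H)
    then show ?thesis unfolding combine_def H
      by (intro sum.mono_neutral_right) (auto simp: in_keys_iff H)
  qed
  show ?thesis
    unfolding bij_betw_def
  proof (intro conjI equalityI subsetI inj_onI)
    fix f g assume fg: "f \<in> supported_on S" "g \<in> supported_on S" "combine sc e f = combine sc e g"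
    then have "H f = H g" using ex1[of "combine sc e f"] H_L H_sum by (metis (no_types, lifting))
    then have eq: "sc (Poly_Mapping.lookup f i) (e i) = sc (Poly_Mapping.lookup g i) (e i)" for i
      using H by metis
    show "f = g"
    proof (rule poly_mapping_eqI)
      fix i show "Poly_Mapping.lookup f i = Poly_Mapping.lookup g i"
      proof (cases "i \<in> S")
        case True then show ?thesis using eq scale_cancel by blast
      next
        case False
        then have "i \<notin> Poly_Mapping.keys f" "i \<notin> Poly_Mapping.keys g" using fg(1,2) by (auto simp: supported_on_def)
        then show ?thesis by (simp add: in_keys_iff)
      qed
    qed
  next
    fix x :: 'v
    obtain h where h: "\<And>i. Poly_Mapping.lookup h i \<in> L i" "x = (\<Sum>i\<in>Poly_Mapping.keys h. Poly_Mapping.lookup h i)"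
      using ex1[of x] by blast
    then have "\<forall>i. \<exists>q. Poly_Mapping.lookup h i = sc q (e i)" unfolding L_eq by blast
    then obtain q where q: "\<And>i. Poly_Mapping.lookup h i = sc (q i) (e i)" by metis
    define f where "f = Poly_Mapping.Abs_poly_mapping (\<lambda>i. if Poly_Mapping.lookup h i = 0 then 0 else q i)"
    have "finite {i. (if Poly_Mapping.lookup h i = 0 then 0 else q i) \<noteq> 0}"
      by (rule finite_subset[of _ "Poly_Mapping.keys h"]) (auto simp: in_keys_iff)
    then have f: "Poly_Mapping.lookup f i = (if Poly_Mapping.lookup h i = 0 then 0 else q i)" for i
      by (simp add: f_def)
    have "H f = h" by (rule poly_mapping_eqI) (simp add: H f q)
    then have "x = combine sc e f" using h(2) H_sum[of f] by simp
    moreover have "f \<in> supported_on S"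
      by (auto simp: supported_on_def in_keys_iff f S_def q split: if_splits)
    ultimately show "x \<in> combine sc e ` supported_on S" by blast
  qed auto
qed

lemma br_e: "br (e i) (e j) = poly_act sc (p' i j) (e (i + j))"
proof -
  have act0: "poly_act sc q 0 = 0" for q by (intro poly_eqI) (simp add: poly_act_def coeff_map_poly)
  have "br (e i) (e j) = poly_act sc (p i j) (e (i + j))" using polys by (simp add: structure_polys_def)
  moreover have "poly_act sc 0 v = 0" for v by (simp add: poly_act_def)
  ultimately show ?thesis by (auto simp: p'_def act0 dest!: e_zero)
qed

lemma Br_e: "Br l (e i) (e j) = sc (poly (p' i j) [:l:]) (e (i + j))"
  by (simp add: Br_def br_e ev_poly_act)

lemma supp: "p' i j \<noteq> 0 \<Longrightarrow> i \<in> S \<and> j \<in> S \<and> i + j \<in> S"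
  by (auto simp: p'_def split: if_splits)

lemma br_e_zero_iff: "br (e i) (e j) = 0 \<longleftrightarrow> p' i j = 0"
proof
  assume z: "br (e i) (e j) = 0"
  show "p' i j = 0"
  proof (rule ccontr)
    assume nz: "p' i j \<noteq> 0"
    have "sc (coeff (p' i j) n) (e (i + j)) = 0" for n
      using arg_cong[OF z, of "\<lambda>g. coeff g n"] by (simp add: br_e poly_act_def coeff_map_poly)
    then have "coeff (p' i j) n = 0" for n using torsion_free supp[OF nz] by blast
    then show False using nz by (simp add: poly_eq_iff)
  qed
qed (simp add: br_e poly_act_def)

text \<open>
  If the component of degree \<open>i + j + k\<close> is zero, all entries with this total degree are zero by the
  convention on \<open>p'\<close>.
\<close>

lemma jacobi': "peval (p' j k) (x + l) m * peval (p' i (j + k)) x l =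
      peval (p' i j) (- l - m) l * peval (p' (i + j) k) x (l + m)
      + peval (p' i k) (x + m) l * peval (p' j (i + k)) x m"
proof (cases "i + (j + k) \<in> S")
  case True
  have "Br l (e i) (Br m (e j) (e k)) =
      sc ((poly (p' j k) [:m:] \<circ>\<^sub>p [:l, 1:]) * poly (p' i (j + k)) [:l:]) (e (i + (j + k)))"
    by (simp add: Br_e Br_scale_right)
  moreover have "Br (l + m) (Br l (e i) (e j)) (e k) =
      sc ([:poly (poly (p' i j) [:l:]) (- (l + m)):] * poly (p' (i + j) k) [:l + m:]) (e (i + (j + k)))"
    by (simp add: Br_e Br_scale_left add.assoc)
  moreover have "Br m (e j) (Br l (e i) (e k)) =
      sc ((poly (p' i k) [:l:] \<circ>\<^sub>p [:m, 1:]) * poly (p' j (i + k)) [:m:]) (e (i + (j + k)))"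
    by (simp add: Br_e Br_scale_right add.left_commute)
  ultimately have "(poly (p' j k) [:m:] \<circ>\<^sub>p [:l, 1:]) * poly (p' i (j + k)) [:l:] =
      [:poly (poly (p' i j) [:l:]) (- (l + m)):] * poly (p' (i + j) k) [:l + m:]
      + (poly (p' i k) [:l:] \<circ>\<^sub>p [:m, 1:]) * poly (p' j (i + k)) [:m:]"
    using Br_jacobi[of l "e i" m "e j" "e k"] scale_cancel[OF True] by (simp only: flip: scale_left_distrib)
  from arg_cong[OF this, of "\<lambda>q. poly q x"] show ?thesis
    by (simp add: poly_pcompose peval_def[symmetric] add.commute)
next
  case False
  then have "i + j + k \<notin> S" "j + (i + k) \<notin> S" by (simp_all add: add.assoc add.left_commute)
  then have "p' i (j + k) = 0" "p' (i + j) k = 0" "p' j (i + k) = 0" using False supp by blast+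
  then show ?thesis by simp
qed

lemma skew': "peval (p' i j) x l = - peval (p' j i) x (- l - x)"
proof (cases "i + j \<in> S")
  case True
  have "sc (poly (p' i j) [:l:]) (e (i + j)) = sc (- poly (p' j i) [:- l, - 1:]) (e (i + j))"
    using Br_skew[of l "e i" "e j"] by (simp add: Br_e br_e ev_poly_act add.commute)
  then have "poly (p' i j) [:l:] = - poly (p' j i) [:- l, - 1:]" using scale_cancel[OF True] by blast
  from arg_cong[OF this, of "\<lambda>q. poly q x"] show ?thesis
    by (simp add: poly_poly_peval)
next
  case False
  then have "p' i j = 0" "p' j i = 0" using supp[of i j] supp[of j i] add.commute[of i j] by metis+
  then show ?thesis by simp
qed

lemma e_in_L: "e i \<in> L i"
  unfolding L_eq by (rule range_eqI[of _ _ 1]) simp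

lemma bracket_nonzero:
  assumes "a \<in> L i" "b \<in> L j" "br a b \<noteq> 0"
  shows "p' i j \<noteq> 0"
proof
  assume "p' i j = 0"
  then have z: "br (e i) (e j) = 0" by (simp add: br_e_zero_iff)
  obtain q r where ab: "a = sc q (e i)" "b = sc r (e j)" using assms(1,2) unfolding L_eq by blast
  have "subspace {b. br (e i) b = 0}"
    by (rule subspaceI_const_del[OF module_sc]) (auto simp: add_right scale_right del_right mult_del_def)
  then have "br (e i) b = 0" using z unfolding ab using subspace_scale by blast
  moreover have "subspace {a. br a b = 0}"
    by (rule subspaceI_const_del[OF module_sc]) (auto simp: add_left scale_left del_left)
  ultimately have "br a b = 0" unfolding ab(1) using subspace_scale by blast
  then show False using assms(3) by simp
qed

text \<open>
  The components of degree at most \<open>n\<close> form a subalgebra, by \<open>brackets_beyond_vanish\<close> for two positive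
  degrees and by addition of degrees otherwise. It contains the generators, so it is everything. The
  sign \<open>\<epsilon>\<close> treats both directions at once.
\<close>

lemma generation:
  fixes \<epsilon> :: int
  assumes \<epsilon>: "\<epsilon> = 1 \<or> \<epsilon> = -1" and n: "1 \<le> n" "n < m"
    and nz: "\<And>j. \<lbrakk>1 \<le> j; j < n\<rbrakk> \<Longrightarrow> p' \<epsilon> (\<epsilon> * j) \<noteq> 0" and z: "p' \<epsilon> (\<epsilon> * n) = 0"
  shows "\<epsilon> * m \<notin> S"
proof
  assume m: "\<epsilon> * m \<in> S"
  have \<epsilon>2: "\<epsilon> * (\<epsilon> * i) = i" for i using \<epsilon> by auto
  have vanish: "p' i j = 0" if "\<epsilon> * i \<le> n" "\<epsilon> * j \<le> n" "n < \<epsilon> * (i + j)" for i j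
  proof -
    define q where "q i j = p' (\<epsilon> * i) (\<epsilon> * j)" for i j
    have "q (\<epsilon> * i) (\<epsilon> * j) = 0"
    proof (rule brackets_beyond_vanish[where n=n])
      fix i j k x l m
      show "peval (q j k) (x + l) m * peval (q i (j + k)) x l =
        peval (q i j) (- l - m) l * peval (q (i + j) k) x (l + m) + peval (q i k) (x + m) l * peval (q j (i + k)) x m"
        using jacobi'[where i="\<epsilon> * i" and j="\<epsilon> * j" and k="\<epsilon> * k" and x=x and l=l and m=m]
        by (simp add: q_def distrib_left)
    qed (use that nz z in \<open>auto simp: q_def distrib_left\<close>)
    then show ?thesis by (simp add: q_def \<epsilon>2)
  qed
  define W where "W = combine sc e ` supported_on {i \<in> S. \<epsilon> * i \<le> n}"
  have subW: "subspace W"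
    unfolding subspace_def W_def
  proof (intro conjI ballI allI)
    have "combine sc e 0 = 0" by (simp add: combine_def)
    moreover have "0 \<in> supported_on {i \<in> S. \<epsilon> * i \<le> n}" by (simp add: supported_on_def)
    ultimately show "0 \<in> combine sc e ` supported_on {i \<in> S. \<epsilon> * i \<le> n}" by (metis imageI)
    fix x y c assume "x \<in> combine sc e ` supported_on {i \<in> S. \<epsilon> * i \<le> n}"
    then obtain f where f: "f \<in> supported_on {i \<in> S. \<epsilon> * i \<le> n}" "x = combine sc e f" by blast
    then show "sc c x \<in> combine sc e ` supported_on {i \<in> S. \<epsilon> * i \<le> n}"
      using supported_on_scale combine_scale[OF module_sc, of e c f] by (metis imageI)
    assume "y \<in> combine sc e ` supported_on {i \<in> S. \<epsilon> * i \<le> n}"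
    then obtain g where g: "g \<in> supported_on {i \<in> S. \<epsilon> * i \<le> n}" "y = combine sc e g" by blast
    then show "x + y \<in> combine sc e ` supported_on {i \<in> S. \<epsilon> * i \<le> n}"
      using f supported_on_add combine_add[OF module_sc, of e f g] by (metis imageI)
  qed
  have eW: "e i \<in> W" if "\<epsilon> * i \<le> n" for i
  proof (cases "i \<in> S")
    case True
    then have "Poly_Mapping.single i 1 \<in> supported_on {i \<in> S. \<epsilon> * i \<le> n}" using that by (simp add: supported_on_def)
    moreover have "combine sc e (Poly_Mapping.single i 1) = e i" by (simp add: combine_single[OF module_sc])
    ultimately show ?thesis unfolding W_def by (intro image_eqI[of _ _ "Poly_Mapping.single i 1"]) simp_all
  next
    case False
    then show ?thesis using e_zero subspace_0[OF subW] by simp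
  qed
  have closed: "combine sc e f \<in> A" if "f \<in> supported_on {i \<in> S. \<epsilon> * i \<le> n}" "subspace A"
    "\<And>i. \<epsilon> * i \<le> n \<Longrightarrow> e i \<in> A" for f A
    unfolding combine_def using that by (intro subspace_sum subspace_scale) (auto simp: supported_on_def)
  have coeff_W: "coeff (map_poly (sc q) g) k \<in> W" if "\<forall>k. coeff g k \<in> W" for q g k
    using that subspace_scale[OF subW] by (simp add: coeff_map_poly)
  have coeff_lam: "coeff (pCons 0 g) k \<in> W" if "\<forall>k. coeff g k \<in> W" for g k
    using that subspace_0[OF subW] by (cases k) auto
  have left: "coeff (br a (e j)) k \<in> W" if a: "a \<in> W" and j: "\<epsilon> * j \<le> n" for a j k
  proof -
    let ?A = "{a. \<forall>k. coeff (br a (e j)) k \<in> W}"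
    have "subspace ?A"
    proof (rule subspaceI_const_del[OF module_sc])
      show "0 \<in> ?A" by (simp add: subspace_0[OF subW])
      show "a + b \<in> ?A" if "a \<in> ?A" "b \<in> ?A" for a b
        using that subspace_add[OF subW] by (simp add: add_left)
      show "sc [:z:] a \<in> ?A" if "a \<in> ?A" for z a
        using that coeff_W by (simp add: scale_left)
      show "sc [:0, 1:] a \<in> ?A" if "a \<in> ?A" for a
        using that coeff_lam[of "br a (e j)"] subspace_neg[OF subW] by (simp add: del_left del: minus_pCons)
    qed
    moreover have "e i \<in> ?A" if i: "\<epsilon> * i \<le> n" for i
    proof (cases "\<epsilon> * (i + j) \<le> n")
      case True
      then show ?thesis using eW[OF True] subspace_scale[OF subW]
        by (simp add: br_e poly_act_def coeff_map_poly)
    next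
      case False
      then have "p' i j = 0" using vanish[OF i j] by simp
      then show ?thesis using subspace_0[OF subW] by (simp add: br_e poly_act_def)
    qed
    ultimately have "a \<in> ?A" using a closed unfolding W_def by blast
    then show ?thesis by blast
  qed
  have right: "coeff (br a b) k \<in> W" if a: "a \<in> W" and b: "b \<in> W" for a b k
  proof -
    let ?B = "{b. \<forall>k. coeff (br a b) k \<in> W}"
    have "subspace ?B"
    proof (rule subspaceI_const_del[OF module_sc])
      show "0 \<in> ?B" by (simp add: subspace_0[OF subW])
      show "b + c \<in> ?B" if "b \<in> ?B" "c \<in> ?B" for b c
        using that subspace_add[OF subW] by (simp add: add_right)
      show "sc [:z:] b \<in> ?B" if "b \<in> ?B" for z b
        using that coeff_W by (simp add: scale_right)
      show "sc [:0, 1:] b \<in> ?B" if "b \<in> ?B" for b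
        using that coeff_lam[of "br a b"] coeff_W[of "br a b"] subspace_add[OF subW]
        by (simp add: del_right mult_del_def)
    qed
    moreover have "e i \<in> ?B" if i: "\<epsilon> * i \<le> n" for i using left[OF a i] by blast
    ultimately have "b \<in> ?B" using b closed unfolding W_def by blast
    then show ?thesis by blast
  qed
  have "lca_subalgebra sc br W"
    unfolding lca_subalgebra_def using subW right by blast
  moreover have "L 1 \<union> L 0 \<union> L (-1) \<subseteq> W"
  proof -
    have "L i \<subseteq> W" if "\<epsilon> * i \<le> n" for i
      unfolding L_eq using eW[OF that] subspace_scale[OF subW] by blast
    moreover have "\<epsilon> * 1 \<le> n" "\<epsilon> * 0 \<le> n" "\<epsilon> * (-1) \<le> n" using \<epsilon> n(1) by auto
    ultimately show ?thesis by blast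
  qed
  ultimately have "lca_subalgebra sc br hull (L 1 \<union> L 0 \<union> L (-1)) \<subseteq> W" by (rule hull_minimal[rotated])
  moreover have "lca_subalgebra sc br hull (L 1 \<union> L 0 \<union> L (-1)) = UNIV"
    using V unfolding class_V_def by blast
  ultimately have "W = UNIV" by blast
  then have "e (\<epsilon> * m) \<in> W" by simp
  then obtain f where f: "f \<in> supported_on {i \<in> S. \<epsilon> * i \<le> n}" "e (\<epsilon> * m) = combine sc e f"
    unfolding W_def by blast
  have "combine sc e (Poly_Mapping.single (\<epsilon> * m) 1) = combine sc e f"
    using f(2) by (simp add: combine_single[OF module_sc])
  moreover have "Poly_Mapping.single (\<epsilon> * m) 1 \<in> supported_on S" using m by (simp add: supported_on_def)
  moreover have "f \<in> supported_on S" using f(1) by (auto simp: supported_on_def)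
  ultimately have "Poly_Mapping.single (\<epsilon> * m) 1 = f"
    using basis_bij unfolding bij_betw_def inj_on_def by blast
  then have "\<epsilon> * m \<in> {i \<in> S. \<epsilon> * i \<le> n}" using f(1) by (auto simp: supported_on_def)
  then show False using n(2) by (simp add: \<epsilon>2)
qed

lemma structure_system: "structure_system p' S"
proof
  show "p' 0 0 = 0"
  proof -
    have "br (e 0) (e 0) = 0" using V e_in_L[of 0] unfolding class_V_def by blast
    then show ?thesis by (simp add: br_e_zero_iff)
  qed
  show "p' (- 1) 1 \<noteq> 0" "p' 0 1 \<noteq> 0"
    using V bracket_nonzero unfolding class_V_def by blast+
  show "k \<notin> S" if "1 \<le> n" "\<And>j. 1 \<le> j \<Longrightarrow> j < n \<Longrightarrow> p' 1 j \<noteq> 0" "p' 1 n = 0" "n < k" for n k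
    using generation[of 1 n k] that by simp
  show "- k \<notin> S" if "1 \<le> n" "\<And>j. 1 \<le> j \<Longrightarrow> j < n \<Longrightarrow> p' (- 1) (- j) \<noteq> 0" "p' (- 1) (- n) = 0" "n < k" for n k
    using generation[of "-1" n k] that by simp
qed (fact jacobi' skew' supp)+

end

section \<open>The classification\<close>

lemma coeff_const: "coeff [:c:] n = (if n = 0 then c else 0)"
  by (cases n) simp_all

lemma total_degree_const_lam: "total_degree [:g:] = degree g"
  unfolding total_degree_def
proof (rule Max_eqI)
  have *: "{m + n |m n. coeff (coeff [:g:] n) m \<noteq> 0} = {m. coeff g m \<noteq> 0}"
    by (auto simp: coeff_const)
  show "finite (insert 0 {m + n |m n. coeff (coeff [:g:] n) m \<noteq> 0})"
    unfolding * by (simp add: finite_subset[of _ "{..degree g}"] subset_iff le_degree)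
  show "y \<le> degree g" if "y \<in> insert 0 {m + n |m n. coeff (coeff [:g:] n) m \<noteq> 0}" for y
    using that unfolding * by (auto intro: le_degree)
  show "degree g \<in> insert 0 {m + n |m n. coeff (coeff [:g:] n) m \<noteq> 0}"
    unfolding * by (cases "g = 0") auto
qed

lemma total_degree_const_del: "total_degree (map_poly (\<lambda>c. [:c:]) f) = degree f"
  unfolding total_degree_def
proof (rule Max_eqI)
  have *: "{m + n |m n. coeff (coeff (map_poly (\<lambda>c. [:c:]) f) n) m \<noteq> 0} = {n. coeff f n \<noteq> 0}"
    by (auto simp: coeff_map_poly coeff_const)
  show "finite (insert 0 {m + n |m n. coeff (coeff (map_poly (\<lambda>c. [:c:]) f) n) m \<noteq> 0})"
    unfolding * by (simp add: finite_subset[of _ "{..degree f}"] subset_iff le_degree)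
  show "y \<le> degree f" if "y \<in> insert 0 {m + n |m n. coeff (coeff (map_poly (\<lambda>c. [:c:]) f) n) m \<noteq> 0}" for y
    using that unfolding * by (auto intro: le_degree)
  show "degree f \<in> insert 0 {m + n |m n. coeff (coeff (map_poly (\<lambda>c. [:c:]) f) n) m \<noteq> 0}"
    unfolding * by (cases "f = 0") auto
qed

lemma const_dvd: "c \<noteq> 0 \<Longrightarrow> [:c:] dvd (q :: complex poly)"
  by (rule dvdI[of _ _ "smult (1 / c) q"]) simp

lemma peval_CL3_table: "peval (CL3_table s i j) x l =
    (if i + j = 0 then of_int i * (x + s) else if i = 0 then - of_int j * (2 * s - l)
     else if j = 0 then of_int i * (x + l + 2 * s) else cl2 s i j x l)"
  unfolding CL3_table_def peval_CL2_table[symmetric]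
  by (simp del: mult_pCons_left mult_pCons_right)

lemma peval_ECL_table: "peval (ECL_table s i j) x l =
    (if i + j = 0 then of_int i * (x + s) * (x + 2 * s) else if i = 0 then - of_int j
     else if j = 0 then of_int i else cl2 s i j x l)"
  unfolding ECL_table_def peval_CL2_table[symmetric]
  by (simp add: add.commute[of s] add.commute[of "2 * s"] del: mult_pCons_left mult_pCons_right)

context graded_lca begin

interpretation ss: structure_system p' S by (rule structure_system)

lemma degrees: "total_degree (p (-1) 1) = degree ss.g" "total_degree (p 0 1) = degree ss.f"
proof -
  have "p (-1) 1 = p' (-1) 1" "p 0 1 = p' 0 1" using ss.units_in_S by (simp_all add: p'_def)
  moreover have "p' (-1) 1 = [:ss.g:]" by (intro peval_eqI) (simp add: ss.p_m1_1_val)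
  moreover have "p' 0 1 = map_poly (\<lambda>c. [:c:]) ss.f"
    using ss.units_in_S by (intro peval_eqI) (simp add: ss.p_0_val)
  ultimately show "total_degree (p (-1) 1) = degree ss.g" "total_degree (p 0 1) = degree ss.f"
    by (simp_all add: total_degree_const_lam total_degree_const_del)
qed

text \<open>
  The four cases are whether \<open>L\<^sub>2\<close> and \<open>L\<^sub>-\<^sub>2\<close> vanish. If only \<open>L\<^sub>2\<close> does, the algebra is \<open>M(1)\<close> with the
  grading reversed.
\<close>

lemma degree_zero_case:
  assumes z: "ss.\<alpha> = 0" "ss.\<beta> = 0"
  shows "iso_Cur_sl2 sc br \<or> iso_M1 sc br \<or> iso_M2 sc br"
proof -
  note const = ss.constants[OF z]
  have supp': "p' i j \<noteq> 0 \<Longrightarrow> i + j \<in> S" for i j using supp by blast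
  note free = isomorphic_to_free[OF conformal basis_bij e_zero br_e supp']
  consider "p' 1 1 = 0" "p' (-1) (-1) = 0" | "p' 1 1 \<noteq> 0" "p' (-1) (-1) = 0"
    | "p' 1 1 = 0" "p' (-1) (-1) \<noteq> 0" | "p' 1 1 \<noteq> 0" "p' (-1) (-1) \<noteq> 0" by blast
  then show ?thesis
  proof cases
    case 1
    note S = ss.sl2_values(1)[OF 1]
    have "lca_isomorphic sc br (cur_carrier sl2) curs curb"
    proof (rule isomorphic_to_current_sl2[OF conformal _ _ br_e const(3,4)])
      show "bij_betw (combine sc e) (supported_on {-1, 0, 1}) UNIV" using basis_bij S by simp
      show "i \<notin> {-1, 0, 1} \<Longrightarrow> e i = 0" for i using e_zero[of i] S by simp
      show "p' 0 0 = 0" by (rule ss.p_0_0)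
      show "p' 0 1 = Cst (poly ss.f 0)" "p' 0 (-1) = Cst (- poly ss.f 0)"
        "p' 1 0 = Cst (- poly ss.f 0)" "p' (-1) 0 = Cst (poly ss.f 0)"
        "p' (-1) 1 = Cst (poly ss.g 0)" "p' 1 (-1) = Cst (- poly ss.g 0)"
        using ss.units_in_S const(1,2)
        by (intro peval_eqI; simp add: ss.p_0_val ss.p_val_0 ss.p_m1_1_val ss.p_1_m1_val; metis)+
    qed
    then show ?thesis by (simp add: iso_Cur_sl2_def)
  next
    case 2
    obtain c where c: "S = {-1..}" "\<And>i. c i \<noteq> 0"
      "\<And>i j x l. peval (p' i j) x l * c (i + j) = c i * c j * peval (m1 i j) x l"
      by (rule ss.M1_scaling[OF z 2]) blast
    have "lca_isomorphic sc br M1_carrier free_scale (free_bracket m1)"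
    proof (rule free[where \<sigma>=id and w="\<lambda>i. [:c i:]"])
      show "M1_carrier = {f. \<forall>i. (i \<in> S \<longrightarrow> [:c i:] dvd Poly_Mapping.lookup f (id i)) \<and>
          (i \<notin> S \<longrightarrow> Poly_Mapping.lookup f (id i) = 0)}"
        using c(2) unfolding c(1) M1_carrier_def
        by (auto simp: const_dvd in_keys_iff subset_iff)
    qed (use c in auto)
    then show ?thesis by (simp add: iso_M1_def)
  next
    case 3
    interpret fl: structure_system "\<lambda>i j. - p' (- i) (- j)" "{i. - i \<in> S}" by (rule ss.flip)
    have zf: "fl.\<alpha> = 0" "fl.\<beta> = 0" using ss.flip_params z by simp_all
    have nzf: "- p' (- 1) (- 1) \<noteq> 0" "- p' (- (- 1)) (- (- 1)) = 0" using 3 by simp_all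
    obtain c where c: "{i. - i \<in> S} = {-1..}" "\<And>i. c i \<noteq> 0"
      "\<And>i j x l. peval (- p' (- i) (- j)) x l * c (i + j) = c i * c j * peval (m1 i j) x l"
      by (rule fl.M1_scaling[OF zf nzf]) blast
    have S: "i \<in> S \<longleftrightarrow> - i \<ge> -1" for i
    proof -
      have "- i \<in> {i. - i \<in> S} \<longleftrightarrow> - i \<in> {-1..}" by (simp only: c(1))
      then show ?thesis by simp
    qed
    have "lca_isomorphic sc br M1_carrier free_scale (free_bracket m1)"
    proof (rule free[where \<sigma>=uminus and w="\<lambda>i. [:- c (- i):]"])
      show "M1_carrier = {f. \<forall>i. (i \<in> S \<longrightarrow> [:- c (- i):] dvd Poly_Mapping.lookup f (- i)) \<and>
          (i \<notin> S \<longrightarrow> Poly_Mapping.lookup f (- i) = 0)}"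
      proof -
        have "(\<forall>i. (i \<in> S \<longrightarrow> [:- c (- i):] dvd Poly_Mapping.lookup f (- i)) \<and> (i \<notin> S \<longrightarrow> Poly_Mapping.lookup f (- i) = 0))
          \<longleftrightarrow> (\<forall>i. \<not> i \<ge> -1 \<longrightarrow> Poly_Mapping.lookup f i = 0)" (is "?A \<longleftrightarrow> ?B") for f
        proof
          assume A: ?A
          show ?B
          proof (intro allI impI)
            fix i :: int assume "\<not> i \<ge> -1"
            then have "- i \<notin> S" by (simp add: S)
            then have "Poly_Mapping.lookup f (- (- i)) = 0" using A by blast
            then show "Poly_Mapping.lookup f i = 0" by simp
          qed
        next
          assume B: ?B
          show ?A
          proof (intro allI conjI impI)
            fix i show "[:- c (- i):] dvd Poly_Mapping.lookup f (- i)" using c(2) by (intro const_dvd) simp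
            show "i \<notin> S \<Longrightarrow> Poly_Mapping.lookup f (- i) = 0" using B S by blast
          qed
        qed
        then show ?thesis unfolding M1_carrier_def by (auto simp: in_keys_iff subset_iff)
      qed
      show "peval (p' i j) x l * poly [:- c (- (i + j)):] x =
          poly [:- c (- i):] (- l) * poly [:- c (- j):] (x + l) * peval (m1 (- i) (- j)) x l" for i j x l
        using c(3)[of "- i" "- j" x l] by simp
    qed (use c in auto)
    then show ?thesis by (simp add: iso_M1_def)
  next
    case 4
    obtain c where c: "S = UNIV" "\<And>i. c i \<noteq> 0"
      "\<And>i j x l. peval (p' i j) x l * c (i + j) = c i * c j * peval (m2 i j) x l"
      by (rule ss.M2_scaling[OF z 4]) blast
    have "lca_isomorphic sc br UNIV free_scale (free_bracket m2)"
      by (rule free[where \<sigma>=id and w="\<lambda>i. [:c i:]"]) (use c in \<open>auto simp: const_dvd\<close>)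
    then show ?thesis by (simp add: iso_M2_def)
  qed
qed

text \<open>
  The four algebras of degree two differ only in the entries that involve \<open>L\<^sub>0\<close>, namely in
  \<open>P\<^sub>i\<^sub>,\<^sub>-\<^sub>i = i A(\<partial>)\<close> and \<open>P\<^sub>0\<^sub>j = j B(\<lambda>)\<close>. The weight \<open>w\<^sub>0\<close> of \<open>L\<^sub>0\<close> has to turn \<open>g\<close> into \<open>A\<close> and \<open>f\<close> into
  \<open>B\<close>, up to sign and the factor \<open>\<alpha>\<close>.
\<close>

lemma isomorphic_to_CL_type:
  assumes a: "ss.\<alpha> \<noteq> 0" and w0: "w0 \<noteq> 0"
    and T: "\<And>i j x l. i \<noteq> 0 \<Longrightarrow> j \<noteq> 0 \<Longrightarrow> i + j \<noteq> 0 \<Longrightarrow> peval (T i j) x l = cl2 ss.s i j x l"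
      "\<And>i x l. peval (T i (- i)) x l = of_int i * A x"
      "\<And>j x l. j \<noteq> 0 \<Longrightarrow> peval (T 0 j) x l = of_int j * B l"
      "\<And>j x l. j \<noteq> 0 \<Longrightarrow> peval (T j 0) x l = - of_int j * B (- l - x)"
    and A: "\<And>x. poly ss.g x * poly w0 x = - ss.\<alpha> * A x"
    and B: "\<And>l. poly ss.f l = poly w0 (- l) * B l"
  shows "lca_isomorphic sc br {f. w0 dvd Poly_Mapping.lookup f 0} free_scale (free_bracket T)"
proof -
  obtain c where c: "S = UNIV" "c 0 = 1" "\<And>i. c i \<noteq> 0"
    "\<And>i j x l. i \<noteq> 0 \<Longrightarrow> j \<noteq> 0 \<Longrightarrow> i + j \<noteq> 0 \<Longrightarrow> peval (p' i j) x l * c (i + j) = c i * c j * cl2 ss.s i j x l"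
    "\<And>i x l. peval (p' i (- i)) x l = c i * c (- i) * (- of_int i * (poly ss.g x / ss.\<alpha>))"
    by (rule ss.CL_scaling[OF a]) blast
  define w where "w i = (if i = 0 then w0 else [:c i:])" for i
  have supp': "p' i j \<noteq> 0 \<Longrightarrow> i + j \<in> S" for i j using supp by blast
  show ?thesis
  proof (rule isomorphic_to_free[OF conformal basis_bij e_zero br_e supp', where \<sigma>=id and w=w])
    fix i j x l
    show "peval (p' i j) x l * poly (w (i + j)) x = poly (w i) (- l) * poly (w j) (x + l) * peval (T (id i) (id j)) x l"
    proof -
      consider "i = 0" "j = 0" | "i = 0" "j \<noteq> 0" | "i \<noteq> 0" "j = 0" | "i \<noteq> 0" "j = - i"
        | "i \<noteq> 0" "j \<noteq> 0" "i + j \<noteq> 0" by linarith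
      then show ?thesis
      proof cases
        case 1 then show ?thesis using T(2)[of 0 x l] by (simp add: ss.p_0_0)
      next
        case 2 then show ?thesis using T(3)[of j x l] B[of l] by (simp add: ss.p_0_val c(1) w_def mult_ac)
      next
        case 3
        have "- (- l - x) = x + l" by simp
        then show ?thesis using 3 T(4)[of i x l] B[of "- l - x"] by (simp add: ss.p_val_0 c(1) w_def mult_ac)
      next
        case 4
        have "poly ss.g x / ss.\<alpha> * poly w0 x = - A x" using A[of x] a by (simp add: field_simps)
        moreover have "peval (p' i (- i)) x l * poly w0 x
          = c i * c (- i) * (- of_int i) * (poly ss.g x / ss.\<alpha> * poly w0 x)"
          unfolding c(5) by (simp only: mult_ac)
        ultimately have "peval (p' i (- i)) x l * poly w0 x = c i * c (- i) * (of_int i * A x)" by simp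
        then show ?thesis using 4 T(2)[of i x l] by (simp add: w_def)
      next
        case 5 then show ?thesis using T(1)[of i j x l] c(4)[of i j x l] by (simp add: w_def)
      qed
    qed
    show "{f. w0 dvd Poly_Mapping.lookup f 0} = {f. \<forall>i. (i \<in> S \<longrightarrow> w i dvd Poly_Mapping.lookup f (id i)) \<and>
        (i \<notin> S \<longrightarrow> Poly_Mapping.lookup f (id i) = 0)}"
      unfolding c(1) w_def using c(3) by (auto simp: const_dvd)
  qed (use w0 c(3) in \<open>auto simp: w_def\<close>)
qed

text \<open>
  The polynomials \<open>g(x)\<close> and \<open>f(-x)\<close> share out the factors \<open>x + s\<close> and \<open>x + 2s\<close>: both in \<open>f\<close> gives
  \<open>SCL\<^sub>2(0,s)\<close>, both in \<open>g\<close> gives \<open>ECL(s)\<close>, and \<open>g\<close> taking one of them gives \<open>CL\<^sub>2(0,s)\<close> or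
  \<open>CL\<^sub>3(s)\<close>.
\<close>

lemma degree_two_case:
  assumes a: "ss.\<alpha> \<noteq> 0"
  shows "\<exists>s. iso_ECL s sc br \<or> iso_SCL2 s sc br \<or> iso_CL2 s sc br \<or> iso_CL3 s sc br"
proof -
  define s where "s = ss.s"
  note F = ss.F_factored[OF a, folded s_def]
  note iso = isomorphic_to_CL_type[OF a, folded s_def]
  have all: "{f :: int \<Rightarrow>\<^sub>0 complex poly. [:k:] dvd Poly_Mapping.lookup f 0} = UNIV" if "k \<noteq> 0" for k :: complex
    using that by (auto simp: const_dvd)
  have CL2: "peval (CL2_table s i (- i)) x l = of_int i * (x + 2 * s)"
    "peval (CL2_table s 0 j) x l = of_int j * (l - s)"
    "peval (CL2_table s j 0) x l = - of_int j * ((- l - x) - s)" for i j x l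
    by (simp_all add: peval_CL2_table cl2_def algebra_simps)
  have "degree ss.g + degree ss.f = 2" unfolding ss.degree_sum using a by simp
  then consider "degree ss.g = 0" | "degree ss.g = 1" | "degree ss.f = 0" by linarith
  then show ?thesis
  proof cases
    case 1
    then obtain g0 where g: "ss.g = [:g0:]" by (rule degree_eq_zeroE)
    have g0: "g0 \<noteq> 0" using ss.g_nonzero g by simp
    (* The generator of degree 0 is a multiple of (del + 2 s) L 0, the only way to accommodate a constant g. *)
    define w0 where "w0 = smult (- ss.\<alpha> / g0) [:2 * s, 1:]"
    have "lca_isomorphic sc br {f. w0 dvd Poly_Mapping.lookup f 0} free_scale (free_bracket (CL2_table s))"
    proof (rule iso[where A="\<lambda>x. x + 2 * s" and B="\<lambda>l. l - s"])
      show "w0 \<noteq> 0" using a g0 by (simp add: w0_def)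
      show "poly ss.g x * poly w0 x = - ss.\<alpha> * (x + 2 * s)" for x
        using g0 by (simp add: g w0_def field_simps)
      show "poly ss.f l = poly w0 (- l) * (l - s)" for l
        using F[of "- l"] g0 by (simp add: g w0_def field_simps)
    qed (rule CL2 peval_CL2_table)+
    moreover have "{f. w0 dvd Poly_Mapping.lookup f 0} = SCL2_carrier s"
      using a g0 by (simp add: SCL2_carrier_def w0_def smult_dvd_iff del: smult_pCons)
    ultimately show ?thesis unfolding iso_SCL2_def by auto
  next
    case 3
    then obtain f0 where f: "ss.f = [:f0:]" by (rule degree_eq_zeroE)
    have f0: "f0 \<noteq> 0" using ss.f_nonzero f by simp
    have "lca_isomorphic sc br {f. [:- f0:] dvd Poly_Mapping.lookup f 0} free_scale (free_bracket (ECL_table s))"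
    proof (rule iso[where A="\<lambda>x. (x + s) * (x + 2 * s)" and B="\<lambda>l. -1"])
      show "[:- f0:] \<noteq> 0" using f0 by simp
      show "poly ss.g x * poly [:- f0:] x = - ss.\<alpha> * ((x + s) * (x + 2 * s))" for x
        using F[of x] by (simp add: f)
    qed (simp_all add: f peval_ECL_table)
    then show ?thesis unfolding iso_ECL_def all[of "- f0"] using f0 all[of "- f0"] by auto
  next
    case 2
    define g1 where "g1 = coeff ss.g 1"
    define r where "r = - coeff ss.g 0 / g1"
    have g1: "g1 \<noteq> 0" using 2 ss.g_nonzero by (metis g1_def leading_coeff_0_iff)
    have "ss.g = [:coeff ss.g 0, g1:]"
      using 2 by (intro poly_eqI) (auto simp: g1_def coeff_pCons coeff_eq_0 split: nat.split)
    then have "poly ss.g x = coeff ss.g 0 + x * g1" for x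
      by (metis add_0_right mult_zero_right poly_0 poly_pCons)
    then have g: "poly ss.g x = g1 * (x - r)" for x using g1 by (simp add: r_def field_simps)
    (* The weight of L 0 is constant; this value makes g and f match the table. *)
    define k where "k = - ss.\<alpha> / g1"
    have k: "k \<noteq> 0" "g1 * k = - ss.\<alpha>" using a g1 by (simp_all add: k_def)
    have f: "poly ss.f l = k * (l - t)" if t: "\<And>x. (x + s) * (x + 2 * s) = (x - r) * (x + t)" for t l
    proof -
      have "[:- r, 1:] * (ss.f \<circ>\<^sub>p [:0, -1:]) = [:- r, 1:] * smult (- k) [:t, 1:]"
      proof (rule poly_eq_poly_eq_iff[THEN iffD1], rule ext)
        fix x
        have "g1 * ((x - r) * poly ss.f (- x)) = g1 * ((x - r) * (- k * (x + t)))"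
        proof -
          have "ss.\<alpha> = - (g1 * k)" using k(2) by simp
          then show ?thesis using F[of x] unfolding g t by (simp add: algebra_simps)
        qed
        then have "(x - r) * poly ss.f (- x) = (x - r) * (- k * (x + t))" using g1 mult_cancel_left by blast
        then show "poly ([:- r, 1:] * (ss.f \<circ>\<^sub>p [:0, -1:])) x = poly ([:- r, 1:] * smult (- k) [:t, 1:]) x"
          by (simp add: poly_pcompose algebra_simps)
      qed
      then have "ss.f \<circ>\<^sub>p [:0, -1:] = smult (- k) [:t, 1:]" by (simp only: mult_cancel_left) simp
      from arg_cong[OF this, of "\<lambda>q. poly q (- l)"] show ?thesis by (simp add: poly_pcompose algebra_simps)
    qed
    have "(r + s) * (r + 2 * s) = 0" using F[of r] a by (simp add: g)
    then consider "r = - (2 * s)" | "r = - s" by (auto simp: add_eq_0_iff2)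
    then show ?thesis
    proof cases
      case 1
      have f': "poly ss.f l = k * (l - s)" for l by (rule f) (simp add: 1 mult.commute)
      have "lca_isomorphic sc br {f. [:k:] dvd Poly_Mapping.lookup f 0} free_scale (free_bracket (CL2_table s))"
      proof (rule iso[where A="\<lambda>x. x + 2 * s" and B="\<lambda>l. l - s"])
        show "poly ss.g x * poly [:k:] x = - ss.\<alpha> * (x + 2 * s)" for x
          using k(2) by (simp add: g 1 mult_ac flip: k(2))
      qed (rule CL2 peval_CL2_table | simp add: k f')+
      then show ?thesis unfolding iso_CL2_def all[OF k(1)] by blast
    next
      case 2
      have f': "poly ss.f l = k * (l - 2 * s)" for l by (rule f) (simp add: 2)
      have "lca_isomorphic sc br {f. [:k:] dvd Poly_Mapping.lookup f 0} free_scale (free_bracket (CL3_table s))"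
      proof (rule iso[where A="\<lambda>x. x + s" and B="\<lambda>l. l - 2 * s"])
        show "poly ss.g x * poly [:k:] x = - ss.\<alpha> * (x + s)" for x
          by (simp add: g 2 mult_ac flip: k(2))
      qed (simp_all add: peval_CL3_table k f' algebra_simps)
      then show ?thesis unfolding iso_CL3_def all[OF k(1)] by blast
    qed
  qed
qed

lemma classification:
  "total_degree (p (-1) 1) + total_degree (p 0 1) \<noteq> 1 \<and>
    (total_degree (p (-1) 1) + total_degree (p 0 1) = 0 \<longrightarrow> iso_Cur_sl2 sc br \<or> iso_M1 sc br \<or> iso_M2 sc br) \<and>
    (total_degree (p (-1) 1) + total_degree (p 0 1) = 2 \<longrightarrow>
      (\<exists>s. iso_ECL s sc br \<or> iso_SCL2 s sc br \<or> iso_CL2 s sc br \<or> iso_CL3 s sc br))"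
  unfolding degrees ss.degree_sum
  using ss.not_linear degree_zero_case degree_two_case
  by (cases "ss.\<alpha> = 0") simp_all

end

theorem theorem4p13:
  fixes sc :: "complex poly \<Rightarrow> 'v::ab_group_add \<Rightarrow> 'v"
    and br :: "'v \<Rightarrow> 'v \<Rightarrow> 'v poly"
    and L :: "int \<Rightarrow> 'v set"
    and e :: "int \<Rightarrow> 'v"
    and p :: "int \<Rightarrow> int \<Rightarrow> complex poly poly"
  assumes "lie_conformal_algebra sc br"
    and "Z_graded sc br L"
    and "class_V sc br L"
    and "graded_basis sc L e"
    and "structure_polys sc br e p"
  shows "total_degree (p (-1) 1) + total_degree (p 0 1) \<noteq> 1 \<and>
    (total_degree (p (-1) 1) + total_degree (p 0 1) = 0 \<longrightarrow>
      iso_Cur_sl2 sc br \<or> iso_M1 sc br \<or> iso_M2 sc br) \<and>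
    (total_degree (p (-1) 1) + total_degree (p 0 1) = 2 \<longrightarrow>
      (\<exists>s. iso_ECL s sc br \<or> iso_SCL2 s sc br \<or> iso_CL2 s sc br \<or> iso_CL3 s sc br))"
  proof -
  interpret lie_conformal_algebra sc br by fact
  interpret graded_lca sc br L e p using assms(2-5) by unfold_locales
  show ?thesis by (rule classification)
qed

end
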